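(* For any function $\omega(n)$ with $\omega(n)\to+\infty$ as $n\to\infty$, there is a constant $L>0$ such that the following hold. For every $\delta\in(0,1)$, for all $n$ sufficiently large, with probability greater than $1-\delta$, \[ \alpha^\star \log n - L \log\log n \le \max_{1 \leq i,j \leq n}|P_{ij}| \leq \alpha^\star \log n + \omega(n). \] Furthermore, for all $n$ sufficiently large, \[ \alpha^\star \log n - L \log \log n \leq \mathbf{E}\Big[\max_{1 \leq i,j \leq n}|P_{ij}|\Big] \leq \alpha^\star \log n + L. \]
   Context: $K_n$ is the complete graph on the vertex set $[n]=\{1,\dots,n\}$. Its edges carry independent random weights $X_e$, $e\in E(K_n)$, each exponentially distributed with mean $n$. For a subgraph $H$ of $K_n$, $|H|$ denotes the number of edges of $H$ and $w(H)=\sum_{e\in E(H)}X_e$. For $i,j\in[n]$, $P_{ij}$ is the (almost surely unique) minimum-weight path from $i$ to $j$, with $P_{ii}=\emptyset$ (so $|P_{ii}|=0$); thus $|P_{ij}|$ is the number of edges of this path. The constant $\alpha^\star\approx 3.5911$ is the unique positive solution of $\alpha\log\alpha-\alpha=1$. *)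

theory Defs
  imports "HOL-Probability.Probability"
begin

definition complete_edges :: "nat \<Rightarrow> nat set set" where
  "complete_edges n = {e. e \<subseteq> {1..n} \<and> card e = 2}"

text \<open>Subgraphs are identified with their edge sets, so that the number of edges
  of \<open>H\<close> is \<^term>\<open>card H\<close>.\<close>

definition weight :: "(nat set \<Rightarrow> real) \<Rightarrow> nat set set \<Rightarrow> real" where
  "weight x H = (\<Sum>e\<in>H. x e)"

definition list_edges :: "nat list \<Rightarrow> nat set set" where
  "list_edges vs = {{vs ! k, vs ! Suc k} | k. Suc k < length vs}"

text \<open>For \<open>i = j\<close> the only admissible vertex sequence is \<open>[i]\<close>, so the only path is
  the empty one.\<close>

definition paths :: "nat \<Rightarrow> nat \<Rightarrow> nat \<Rightarrow> nat set set set" where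
  "paths n i j = {list_edges vs | vs.
     vs \<noteq> [] \<and> distinct vs \<and> set vs \<subseteq> {1..n} \<and> hd vs = i \<and> last vs = j}"

text \<open>On the null event that the minimum is attained more than once, some minimiser
  is chosen. The choice depends only on the set of minimisers, hence the path
  is still a measurable function of the weights.\<close>

definition min_path :: "nat \<Rightarrow> (nat set \<Rightarrow> real) \<Rightarrow> nat \<Rightarrow> nat \<Rightarrow> nat set set" where
  "min_path n x i j = arg_min_on (weight x) (paths n i j)"

definition max_path_length :: "nat \<Rightarrow> (nat set \<Rightarrow> real) \<Rightarrow> nat" where
  "max_path_length n x = Max {card (min_path n x i j) | i j. i \<in> {1..n} \<and> j \<in> {1..n}}"

text \<open>The parameter of \<^const>\<open>exponential_density\<close> is the rate, i.e. the reciprocal of the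
  mean.\<close>

definition exponential_weights ::
  "nat \<Rightarrow> 'w measure \<Rightarrow> (nat set \<Rightarrow> 'w \<Rightarrow> real) \<Rightarrow> bool" where
  "exponential_weights n M X \<longleftrightarrow>
     prob_space M \<and>
     prob_space.indep_vars M (\<lambda>_. borel) X (complete_edges n) \<and>
     (\<forall>e\<in>complete_edges n. distributed M lborel (X e) (exponential_density (1 / real n)))"

definition alpha_star :: real where
  "alpha_star = (THE a. a > 0 \<and> a * ln a - a = 1)"

lemma alpha_star_ex1: "\<exists>!a::real. a > 0 \<and> a * ln a - a = 1"
proof -
  define f where "f = (\<lambda>a::real. a * ln a - a)"
  have gt1: "a > 1" if "a > 0" "f a = 1" for a
  proof (rule ccontr)
    assume "\<not> a > 1"
    then have "a * ln a \<le> 0"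
      using that by (simp add: mult_nonneg_nonpos)
    with that show False unfolding f_def by linarith
  qed
  have mono: "f a < f b" if "1 < a" "a < b" for a b
  proof (rule DERIV_pos_imp_increasing[OF that(2)])
    fix x assume "a \<le> x" "x \<le> b"
    with that have "x > 1" by linarith
    then have "(f has_real_derivative ln x) (at x)"
      unfolding f_def by (auto intro!: derivative_eq_intros)
    moreover have "ln x > 0" using \<open>x > 1\<close> by simp
    ultimately show "\<exists>y. (f has_real_derivative y) (at x) \<and> y > 0" by blast
  qed
  have e: "(1::real) \<le> exp 2" "f 1 \<le> 1" by (simp_all add: f_def)
  have "1 + 2 \<le> exp (2::real)" by (rule exp_ge_add_one_self)
  then have "1 \<le> f (exp 2)" by (simp add: f_def)
  moreover have "continuous_on {1..exp 2} f"
    unfolding f_def by (intro continuous_intros) auto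
  ultimately obtain a where a: "1 \<le> a" "f a = 1"
    using IVT'[of f 1 1 "exp 2"] e by blast
  have "b = a" if "b > 0" "f b = 1" for b
    using mono[of a b] mono[of b a] gt1[of a] gt1[of b] that a by linarith
  moreover have "a > 0" using a by simp
  ultimately show ?thesis using a(2) unfolding f_def by blast
qed

end

theory Submission
  imports Defs "HOL-Real_Asymp.Real_Asymp"
begin

text \<open>
  Upper bound: by memorylessness, Dijkstra's algorithm from a fixed source attaches each new vertex to a
  uniformly chosen explored vertex, so the shortest path tree is a random recursive tree. Hence
  \<open>Z = \<Sum>\<^sub>v z ^ depth v\<close> grows in expectation by the factor \<open>1 + z/m\<close> when the tree has \<open>m\<close> vertices and ends
  at \<open>O(n\<^sup>z)\<close>. With \<open>z = \<alpha>\<close> and a sum over all sources, the exponential moment \<open>E \<alpha> ^ max |P\<^sub>i\<^sub>j|\<close> is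
  \<open>O(n ^ (1 + \<alpha>)) = O(\<alpha> ^ (\<alpha> log n))\<close>.

  Lower bound: a path of weight at most \<open>s = log n - A log log n\<close> is geodesic with probability \<open>1 - o(1)\<close>,
  because the expected number of light detours between two of its vertices is about \<open>exp s / n\<close>. The
  second moment method shows that such paths with \<open>\<alpha> s\<close> edges exist: two paths without
  light detours meet in a single segment, and the pairs sharing a segment are controlled by restricting to
  paths whose weight is spread evenly.
\<close>

section \<open>Products of exponential distributions\<close>

text \<open>The constant \<open>alpha_star\<close> optimises two first moments at once. With base
  \<open>z\<close>, the moment bound gives a path of a log n edges probability at most of order n^(1
  + z - a log z); the ratio (1 + z) / log z is smallest where z log z - z = 1, and its value there
  is z. Conversely, there are about n^(k+1) vertex lists with k edges, each of weight at most s with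
  probability about (e s / (k n))^k. For k = \<alpha> s the expected number of light ones is n exp
  (-s) up to powers of log n, so s must stay below log n by a multiple of log log n. The obstacle is
  the second moment: a mean that is only a power of log n is swamped by pairs sharing a segment as
  soon as that segment is much lighter than its length suggests, since it then has very many light
  completions. The barrier in \<open>balanced\<close> forbids such segments. Every loss of the
  argument is a power of log n, and the multiple of log log n is chosen to outweigh them all. The
  upper bound has no such loss, because its centred exponential moment is bounded uniformly in
  n.\<close>

definition exp_measure :: "real \<Rightarrow> real measure" where
  "exp_measure l = density lborel (exponential_density l)"

abbreviation exp_product :: "real \<Rightarrow> 'a set \<Rightarrow> ('a \<Rightarrow> real) measure" where
  "exp_product l I \<equiv> Pi\<^sub>M I (\<lambda>_. exp_measure l)"

abbreviation edge_weights :: "real \<Rightarrow> nat \<Rightarrow> (nat set \<Rightarrow> real) measure" where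
  "edge_weights l n \<equiv> exp_product l (complete_edges n)"

text \<open>Events are predicates on all weight functions, so being determined by the coordinates in
  \<open>A\<close> can be phrased as invariance under changes outside \<open>A\<close>, without
  sub-sigma-algebras.\<close>

definition depends_on :: "'a set \<Rightarrow> (('a \<Rightarrow> real) \<Rightarrow> 'b) \<Rightarrow> bool" where
  "depends_on A f \<longleftrightarrow> (\<forall>x y. (\<forall>e\<in>A. x e = y e) \<longrightarrow> f x = f y)"

lemma depends_onD: "depends_on A f \<Longrightarrow> (\<And>e. e \<in> A \<Longrightarrow> x e = y e) \<Longrightarrow> f x = f y"
  unfolding depends_on_def by blast

lemma sets_exp_measure [measurable_cong, simp]: "sets (exp_measure l) = sets borel"
  by (simp add: exp_measure_def)

lemma space_exp_measure [simp]: "space (exp_measure l) = UNIV"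
  by (simp add: exp_measure_def)

lemma measurable_exp_component:
  assumes "e \<in> I"
  shows "(\<lambda>x. x e) \<in> borel_measurable (exp_product l I)"
proof -
  have "(\<lambda>x. x e) \<in> exp_product l I \<rightarrow>\<^sub>M exp_measure l"
    using assms by (rule measurable_component_singleton)
  also have "(exp_product l I \<rightarrow>\<^sub>M exp_measure l) = borel_measurable (exp_product l I)"
    by (rule measurable_cong_sets) auto
  finally show ?thesis .
qed

lemma prob_space_exp_measure: "0 < l \<Longrightarrow> prob_space (exp_measure l)"
  unfolding exp_measure_def by (rule prob_space_exponential_density)

lemma emeasure_exp_measure_atLeast:
  assumes "0 < l" "0 \<le> s"
  shows "emeasure (exp_measure l) {s..} = ennreal (exp (- l * s))"
proof -
  interpret prob_space "exp_measure l" by (rule prob_space_exp_measure) fact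
  have "emeasure (exp_measure l) {..<s} = emeasure (exp_measure l) {..s}"
  proof (rule emeasure_eq_AE)
    have "AE x in lborel. x \<noteq> s"
      by (rule AE_lborel_singleton)
    then show "AE x in exp_measure l. x \<in> {..<s} \<longleftrightarrow> x \<in> {..s}"
      unfolding exp_measure_def by (subst AE_density) auto
  qed auto
  also have "\<dots> = ennreal (1 - exp (- l * s))"
    unfolding exp_measure_def using assms
    by (subst emeasure_erlang_density) (auto simp: erlang_CDF_def)
  finally have "measure (exp_measure l) {..<s} = 1 - exp (- l * s)"
    using assms by (simp add: measure_def)
  moreover have "{s..} = space (exp_measure l) - {..<s}" by auto
  ultimately have "measure (exp_measure l) {s..} = exp (- l * s)"
    using prob_compl[of "{..<s}"] by simp
  then show ?thesis by (simp add: emeasure_eq_measure)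
qed

lemma AE_exp_measure_nonneg: "AE t in exp_measure l. 0 \<le> t"
  unfolding exp_measure_def by (subst AE_density) (auto simp: exponential_density_def intro!: AE_I2)

lemma nn_integral_exp_measure_exp:
  assumes "0 < l" "0 \<le> c"
  shows "(\<integral>\<^sup>+t. ennreal (exp (- (c * t))) \<partial>exp_measure l) = ennreal (l / (l + c))"
proof -
  have "(\<integral>\<^sup>+t. ennreal (exp (- (c * t))) \<partial>exp_measure l)
      = (\<integral>\<^sup>+t. ennreal (exponential_density l t) * ennreal (exp (- (c * t))) \<partial>lborel)"
    unfolding exp_measure_def by (subst nn_integral_density) auto
  also have "\<dots> = (\<integral>\<^sup>+t. ennreal (l / (l + c)) * ennreal (exponential_density (l + c) t) \<partial>lborel)"
    using assms
    by (intro nn_integral_cong)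
      (auto simp: ennreal_mult[symmetric] exponential_density_def field_simps simp flip: exp_add)
  also have "\<dots> = ennreal (l / (l + c)) * (\<integral>\<^sup>+t. ennreal (exponential_density (l + c) t) \<partial>lborel)"
    by (rule nn_integral_cmult) auto
  also have "(\<integral>\<^sup>+t. ennreal (exponential_density (l + c) t) \<partial>lborel) = 1"
  proof -
    have "prob_space (density lborel (exponential_density (l + c)))"
      using assms by (intro prob_space_exponential_density) auto
    from prob_space.emeasure_space_1[OF this] show ?thesis
      by (simp add: emeasure_density)
  qed
  finally show ?thesis by simp
qed

text \<open>Rescaling all weights leaves the minimum paths unchanged, so the tree argument is
  carried out for an arbitrary rate. In the estimates, \<open>l = 1 / real n\<close> is imposed only
  on the lower bound side, where weights are compared with log n.\<close>

locale exp_rate =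
  fixes l :: real
  assumes rate_pos: "0 < l"
begin

sublocale prob_exp: prob_space "exp_measure l"
  by (rule prob_space_exp_measure) (rule rate_pos)

sublocale prod: product_sigma_finite "\<lambda>_::'a. exp_measure l"
  by unfold_locales

lemma prob_space_exp_product: "prob_space (exp_product l I)"
  by (rule prob_space_PiM) (rule prob_exp.prob_space_axioms)

lemma AE_exp_product_nonneg:
  assumes "finite I"
  shows "AE x in exp_product l I. \<forall>e\<in>I. 0 \<le> x e"
proof (rule AE_finite_allI[OF assms])
  fix e assume "e \<in> I"
  from AE_PiM_component[OF prob_exp.prob_space_axioms this AE_exp_measure_nonneg]
  show "AE x in exp_product l I. 0 \<le> x e" by simp
qed

text \<open>Fubini in the form of conditioning: the coordinates in \<open>A\<close> are frozen and
  the event is measured over the remaining ones. It replaces conditional probabilities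
  throughout.\<close>

lemma emeasure_exp_product_split:
  fixes I :: "'a set"
  assumes I: "finite I" and A: "A \<subseteq> I" and [measurable]: "Measurable.pred (exp_product l I) R"
  shows "emeasure (exp_product l I) {x \<in> space (exp_product l I). R x}
    = (\<integral>\<^sup>+x. emeasure (exp_product l (I - A))
        {y \<in> space (exp_product l (I - A)). R (merge A (I - A) (x, y))} \<partial>exp_product l A)"
proof -
  let ?J = "I - A"
  have IJ: "I = A \<union> ?J" "A \<inter> ?J = {}" "finite A" "finite ?J"
    using A I by (auto intro: finite_subset)
  let ?M = "exp_product l I" and ?MA = "exp_product l A" and ?MJ = "exp_product l ?J"
  have merge [measurable]: "merge A ?J \<in> ?MA \<Otimes>\<^sub>M ?MJ \<rightarrow>\<^sub>M ?M"
    using IJ(1) measurable_merge by metis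
  have "emeasure ?M {x \<in> space ?M. R x} = (\<integral>\<^sup>+x. indicator {x \<in> space ?M. R x} x \<partial>?M)"
    by (rule nn_integral_indicator[symmetric]) measurable
  also have "\<dots> = (\<integral>\<^sup>+x. indicator {x. R x} x \<partial>?M)"
    by (intro nn_integral_cong) (auto simp: indicator_def)
  also have "\<dots> = (\<integral>\<^sup>+x. indicator {x. R x} x \<partial>exp_product l (A \<union> ?J))"
    using A by (simp add: Un_absorb1)
  also have "\<dots> = (\<integral>\<^sup>+x. (\<integral>\<^sup>+y. indicator {x. R x} (merge A ?J (x, y)) \<partial>?MJ) \<partial>?MA)"
    using IJ(2-4) A by (intro prod.product_nn_integral_fold) (auto simp: Un_absorb1)
  also have "\<dots> = (\<integral>\<^sup>+x. emeasure ?MJ {y \<in> space ?MJ. R (merge A ?J (x, y))} \<partial>?MA)"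
  proof (rule nn_integral_cong)
    fix x assume x: "x \<in> space ?MA"
    have "(\<lambda>y. merge A ?J (x, y)) \<in> ?MJ \<rightarrow>\<^sub>M ?M"
      using measurable_compose[OF measurable_Pair1'[OF x] merge] by simp
    then have "Measurable.pred ?MJ (\<lambda>y. R (merge A ?J (x, y)))"
      by measurable
    then have S: "{y \<in> space ?MJ. R (merge A ?J (x, y))} \<in> sets ?MJ"
      by measurable
    have "(\<integral>\<^sup>+y. indicator {x. R x} (merge A ?J (x, y)) \<partial>?MJ)
        = (\<integral>\<^sup>+y. indicator {y \<in> space ?MJ. R (merge A ?J (x, y))} y \<partial>?MJ)"
      by (intro nn_integral_cong) (auto simp: indicator_def)
    also have "\<dots> = emeasure ?MJ {y \<in> space ?MJ. R (merge A ?J (x, y))}"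
      using S by (rule nn_integral_indicator)
    finally show "(\<integral>\<^sup>+y. indicator {x. R x} (merge A ?J (x, y)) \<partial>?MJ)
      = emeasure ?MJ {y \<in> space ?MJ. R (merge A ?J (x, y))}" .
  qed
  finally show ?thesis .
qed

lemma exp_product_indep:
  fixes I :: "'a set"
  assumes I: "finite I" and AB: "A \<inter> B = {}" "A \<subseteq> I" "B \<subseteq> I"
    and dep: "depends_on A P" "depends_on B Q"
    and meas: "Measurable.pred (exp_product l I) P" "Measurable.pred (exp_product l I) Q"
  shows "\<P>(x in exp_product l I. P x \<and> Q x)
    = \<P>(x in exp_product l I. P x)
      * \<P>(x in exp_product l I. Q x)"
proof -
  let ?J = "I - A"
  let ?M = "exp_product l I" and ?A = "exp_product l A" and ?J' = "exp_product l (I - A)"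
  interpret prob_space ?M by (rule prob_space_exp_product)
  interpret J: prob_space ?J' by (rule prob_space_exp_product)
  \<comment> \<open>\<open>u\<close> is a dummy filler for the coordinates that a predicate ignores.
    Its membership in the space makes the section \<open>merge A ?J (x, u)\<close> measurable in
    \<open>x\<close>.\<close>
  obtain u where u: "u \<in> space ?J'" using J.not_empty by blast
  have "merge A ?J \<in> ?A \<Otimes>\<^sub>M ?J' \<rightarrow>\<^sub>M exp_product l (A \<union> ?J)" by (rule measurable_merge)
  also have "A \<union> ?J = I" using AB(2) by auto
  finally have "(\<lambda>x. merge A ?J (x, u)) \<in> ?A \<rightarrow>\<^sub>M ?M"
    using measurable_compose[OF measurable_Pair2'[OF u]] by blast
  then have m: "(\<lambda>x. indicator {x. P x} (merge A ?J (x, u)) :: ennreal) \<in> borel_measurable ?A"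
    using meas(1) by measurable
  have P: "P (merge A ?J (x, y)) = P (merge A ?J (x, u))" for x y
    by (rule depends_onD[OF dep(1)]) (simp add: merge_def)
  have Q: "Q (merge A ?J (x, y)) = Q (merge A ?J (u, y))" for x y
    using AB by (intro depends_onD[OF dep(2)]) (auto simp: merge_def)
  define C where "C = emeasure ?J' {y \<in> space ?J'. Q (merge A ?J (u, y))}"
  note split = emeasure_exp_product_split[OF I AB(2)]
  have "emeasure ?M {x \<in> space ?M. P x \<and> Q x} = (\<integral>\<^sup>+x. indicator {x. P x} (merge A ?J (x, u)) * C \<partial>?A)"
    using pred_intros_logic(3)[OF meas] unfolding C_def
    by (subst split, assumption, subst P, subst Q) (auto intro!: nn_integral_cong simp: indicator_def)
  also have "\<dots> = (\<integral>\<^sup>+x. indicator {x. P x} (merge A ?J (x, u)) \<partial>?A) * C"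
    using m by (rule nn_integral_multc)
  also have "(\<integral>\<^sup>+x. indicator {x. P x} (merge A ?J (x, u)) \<partial>?A) = emeasure ?M {x \<in> space ?M. P x}"
    by (subst split[OF meas(1)], subst P)
      (auto intro!: nn_integral_cong simp: indicator_def J.emeasure_space_1)
  also have "C = emeasure ?M {x \<in> space ?M. Q x}"
    unfolding C_def
    by (subst split[OF meas(2)], subst Q)
      (simp add: prob_space.emeasure_space_1[OF prob_space_exp_product])
  finally show ?thesis
    by (simp add: emeasure_eq_measure flip: ennreal_mult)
qed

lemma exp_product_exp_sum:
  fixes I :: "'a set" and c :: "'a \<Rightarrow> real"
  assumes I: "finite I" and A: "A \<subseteq> I" and c: "\<And>e. e \<in> A \<Longrightarrow> 0 \<le> c e"
  shows "(\<integral>\<^sup>+x. ennreal (exp (- (\<Sum>e\<in>A. c e * x e))) \<partial>exp_product l I)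
    = ennreal (\<Prod>e\<in>A. l / (l + c e))"
proof -
  let ?c = "\<lambda>e. if e \<in> A then c e else 0"
  have fA: "finite A" using I A finite_subset by blast
  have eq: "(\<Sum>e\<in>I. ?c e * x e) = (\<Sum>e\<in>A. c e * x e)" for x :: "'a \<Rightarrow> real"
  proof -
    have "(\<Sum>e\<in>I. ?c e * x e) = (\<Sum>e\<in>I. if e \<in> A then c e * x e else 0)"
      by (rule sum.cong) auto
    also have "\<dots> = (\<Sum>e\<in>A. c e * x e)"
      using sum.inter_restrict[OF I, of "\<lambda>e. c e * x e" A] A by (simp add: Int_absorb1)
    finally show ?thesis .
  qed
  have "(\<integral>\<^sup>+x. ennreal (exp (- (\<Sum>e\<in>A. c e * x e))) \<partial>exp_product l I)
      = (\<integral>\<^sup>+x. (\<Prod>e\<in>I. ennreal (exp (- (?c e * x e)))) \<partial>exp_product l I)"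
    by (subst eq[symmetric]) (simp add: prod_ennreal exp_sum[OF I] flip: sum_negf)
  also have "\<dots> = (\<Prod>e\<in>I. \<integral>\<^sup>+t. ennreal (exp (- (?c e * t))) \<partial>exp_measure l)"
    by (rule prod.product_nn_integral_prod[OF I]) auto
  also have "\<dots> = (\<Prod>e\<in>I. ennreal (l / (l + ?c e)))"
    using c rate_pos by (intro prod.cong refl nn_integral_exp_measure_exp) auto
  also have "\<dots> = ennreal (\<Prod>e\<in>I. l / (l + ?c e))"
    using c rate_pos by (intro prod_ennreal) auto
  also have "(\<Prod>e\<in>I. l / (l + ?c e)) = (\<Prod>e\<in>I. if e \<in> A then l / (l + c e) else 1)"
    using rate_pos by (intro prod.cong) auto
  also have "\<dots> = (\<Prod>e\<in>A. l / (l + c e))"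
    using prod.inter_restrict[OF I, of "\<lambda>e. l / (l + c e)" A] A by (simp add: Int_absorb1)
  finally show ?thesis .
qed

text \<open>Exponential Markov inequality with an individual tilt for every edge; the barrier
  estimate for unbalanced paths needs two different tilts on one path. The exact factor
  \<open>l / (l + c e)\<close> is relaxed to \<open>l / c e\<close>, which costs little when
  \<open>l\<close> is as small as 1/n.\<close>

lemma chernoff:
  fixes I :: "'a set" and c :: "'a \<Rightarrow> real"
  assumes I: "finite I" and A: "A \<subseteq> I" and c: "\<And>e. e \<in> A \<Longrightarrow> 0 < c e"
    and P: "\<And>x. P x \<Longrightarrow> (\<Sum>e\<in>A. c e * x e) \<le> s"
  shows "\<P>(x in exp_product l I. P x) \<le> exp s * (\<Prod>e\<in>A. l / c e)"
proof -
  let ?M = "exp_product l I"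
  interpret prob_space ?M by (rule prob_space_exp_product)
  have [measurable]: "(\<lambda>x. x e) \<in> borel_measurable ?M" if "e \<in> A" for e
    using A that by (intro measurable_exp_component) auto
  have "\<P>(x in ?M. P x)
      \<le> \<P>(x in ?M. (\<Sum>e\<in>A. c e * x e) \<le> s)"
    by (rule finite_measure_mono) (use P in auto)
  also have "\<dots> \<le> exp s * (\<Prod>e\<in>A. l / c e)"
  proof -
    have "emeasure ?M {x \<in> space ?M. (\<Sum>e\<in>A. c e * x e) \<le> s}
        = (\<integral>\<^sup>+x. indicator {x \<in> space ?M. (\<Sum>e\<in>A. c e * x e) \<le> s} x \<partial>?M)"
      by simp
    also have "\<dots> \<le> (\<integral>\<^sup>+x. ennreal (exp s) * ennreal (exp (- (\<Sum>e\<in>A. c e * x e))) \<partial>?M)"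
      by (intro nn_integral_mono)
        (auto simp: indicator_def exp_minus simp flip: ennreal_mult divide_inverse ennreal_1)
    also have "\<dots> = ennreal (exp s) * ennreal (\<Prod>e\<in>A. l / (l + c e))"
      using c by (subst nn_integral_cmult) (auto simp: exp_product_exp_sum[OF I A] less_imp_le)
    also have "\<dots> \<le> ennreal (exp s) * ennreal (\<Prod>e\<in>A. l / c e)"
      using c rate_pos
      by (intro mult_left_mono ennreal_leI prod_mono) (auto intro!: divide_left_mono divide_nonneg_pos add_pos_pos mult_pos_pos simp: less_imp_le)
    finally show ?thesis
      using c rate_pos by (auto simp: emeasure_eq_measure prod_nonneg less_imp_le simp flip: ennreal_mult)
  qed
  finally show ?thesis .
qed

text \<open>The Chernoff bound only bounds lightness from above; the second moment method also needs
  a lower bound, which is read off the exact law.\<close>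

lemma prob_sum_le_erlang:
  fixes I :: "'a set"
  assumes I: "finite I" and A: "A \<subseteq> I" "A \<noteq> {}" and s: "0 \<le> s"
  shows "\<P>(x in exp_product l I. (\<Sum>e\<in>A. x e) \<le> s)
      = erlang_CDF (card A - 1) l s"
proof -
  let ?M = "exp_product l I"
  interpret prob_space ?M by (rule prob_space_exp_product)
  have I0: "I \<noteq> {}" using A by auto
  have fA: "finite A" using I A finite_subset by blast
  have comp: "distr ?M (exp_measure l) (\<lambda>x. x e) = exp_measure l" if "e \<in> I" for e
    using that by (intro distr_PiM_component prob_exp.prob_space_axioms)
  have iv: "indep_vars (\<lambda>_. exp_measure l) (\<lambda>e x. x e) I"
  proof (subst indep_vars_iff_distr_eq_PiM'[OF I0])
    have "distr ?M ?M (\<lambda>x. restrict x I) = distr ?M ?M (\<lambda>x. x)"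
      by (rule distr_cong) (auto simp: space_PiM)
    also have "\<dots> = ?M" by simp
    also have "\<dots> = PiM I (\<lambda>e. distr ?M (exp_measure l) (\<lambda>x. x e))"
      by (rule PiM_cong) (use comp in auto)
    finally show "distr ?M ?M (\<lambda>x. restrict x I) = PiM I (\<lambda>e. distr ?M (exp_measure l) (\<lambda>x. x e))" .
  qed auto
  have "indep_vars (\<lambda>_. borel) (\<lambda>e x. x e) I"
    using iv unfolding indep_vars_def by (simp cong: measurable_cong_sets)
  then have ind: "indep_vars (\<lambda>_. borel) (\<lambda>e x. x e) A"
    using A(1) by (rule indep_vars_subset)
  have "distributed ?M lborel (\<lambda>x. x e) (exponential_density l)" if "e \<in> A" for e
  proof -
    have "e \<in> I" using that A by auto
    then show ?thesis
      unfolding distributed_def using comp[of e]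
      by (auto simp: exp_measure_def intro!: measurable_component_singleton cong: distr_cong)
  qed
  from exponential_distributed_sum[OF fA A(2) rate_pos this ind]
  have "distributed ?M lborel (\<lambda>x. \<Sum>e\<in>A. x e) (erlang_density (card A - 1) l)" .
  from erlang_distributed_le[OF this rate_pos s] show ?thesis .
qed

lemma emeasure_exp_product_box:
  fixes J :: "'a set" and c :: "'a \<Rightarrow> real"
  assumes J: "finite J" and F: "F \<subseteq> J" and c: "\<And>f. f \<in> F \<Longrightarrow> 0 \<le> c f"
  shows "emeasure (exp_product l J) {y \<in> space (exp_product l J). \<forall>f\<in>F. c f \<le> y f}
    = ennreal (exp (- l * (\<Sum>f\<in>F. c f)))"
proof -
  let ?A = "\<lambda>f. if f \<in> F then {c f..} else UNIV"
  have fF: "finite F" using F J finite_subset by blast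
  have "{y \<in> space (exp_product l J). \<forall>f\<in>F. c f \<le> y f} = Pi\<^sub>E J ?A"
    using F by (auto simp: space_PiM PiE_def Pi_def split: if_splits)
  then have "emeasure (exp_product l J) {y \<in> space (exp_product l J). \<forall>f\<in>F. c f \<le> y f}
      = (\<Prod>f\<in>J. emeasure (exp_measure l) (?A f))"
    using J by (simp add: prod.emeasure_PiM)
  also have "\<dots> = (\<Prod>f\<in>J. if f \<in> F then ennreal (exp (- l * c f)) else 1)"
    using c rate_pos prob_exp.emeasure_space_1
    by (intro prod.cong refl) (auto simp: emeasure_exp_measure_atLeast)
  also have "\<dots> = (\<Prod>f\<in>F. ennreal (exp (- l * c f)))"
    using prod.inter_restrict[OF J, of "\<lambda>f. ennreal (exp (- l * c f))" F] F
    by (simp add: Int_absorb1)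
  also have "\<dots> = ennreal (exp (- l * (\<Sum>f\<in>F. c f)))"
    by (simp add: prod_ennreal exp_sum[OF fF] sum_distrib_left flip: sum_negf)
  finally show ?thesis .
qed

text \<open>Given that every \<open>y f\<close> exceeds \<open>c f\<close>, the residuals
  \<open>y f - c f\<close> are again independent exponentials, so each of them is the smallest with
  equal probability. Ties are null, which is why closed inequalities still give an exact equality.
  The proof integrates out the coordinate \<open>g\<close>, the other ones contributing box
  probabilities.\<close>

lemma memoryless_min:
  fixes J :: "'a set" and c :: "'a \<Rightarrow> real"
  assumes J: "finite J" and F: "F \<subseteq> J" "g \<in> F" and c: "\<And>f. f \<in> F \<Longrightarrow> 0 \<le> c f"
  shows "emeasure (exp_product l J)
      {y \<in> space (exp_product l J). c g \<le> y g \<and> (\<forall>f\<in>F. c f + (y g - c g) \<le> y f)}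
    = ennreal (1 / real (card F)) *
      emeasure (exp_product l J) {y \<in> space (exp_product l J). \<forall>f\<in>F. c f \<le> y f}"
proof -
  define J' F' where "J' = J - {g}" and "F' = F - {g}"
  define m where "m = real (card F)"
  let ?P = "\<lambda>y. c g \<le> y g \<and> (\<forall>f\<in>F. c f + (y g - c g) \<le> y f)"
  have fF: "finite F" using F J finite_subset by blast
  have J': "finite J'" "g \<notin> J'" "J = insert g J'" "F' \<subseteq> J'" "F = insert g F'" "g \<notin> F'" "finite F'"
    using F J fF by (auto simp: J'_def F'_def)
  have m: "m = 1 + real (card F')" "0 < m" using J' by (auto simp: m_def)
  let ?M = "exp_product l J" and ?M' = "exp_product l J'"
  have meas: "(\<lambda>x. x e) \<in> borel_measurable ?M" if "e \<in> F" for e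
    using F that by (intro measurable_exp_component) auto
  note [measurable] = meas[OF F(2)]
  have [measurable]: "Measurable.pred ?M (\<lambda>y. c f + (y g - c g) \<le> y f)" if "f \<in> F" for f
    unfolding pred_def
    by (intro borel_measurable_le borel_measurable_add borel_measurable_diff
      borel_measurable_const meas F that)
  have S: "{y \<in> space ?M. ?P y} \<in> sets ?M"
    using fF by measurable
  have "emeasure ?M {y \<in> space ?M. ?P y} = (\<integral>\<^sup>+x. indicator {y \<in> space ?M. ?P y} x \<partial>?M)"
    using S by simp
  also have "\<dots> = (\<integral>\<^sup>+t. (\<integral>\<^sup>+x. indicator {y \<in> space ?M. ?P y} (x(g := t)) \<partial>?M') \<partial>exp_measure l)"
    using S unfolding J'(3) by (intro prod.product_nn_integral_insert_rev J') auto
  also have "\<dots> = (\<integral>\<^sup>+t. indicator {c g..} t * ennreal (exp (- l * (\<Sum>f\<in>F'. c f + (t - c g)))) \<partial>exp_measure l)"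
  proof (rule nn_integral_cong)
    fix t
    have "(\<integral>\<^sup>+x. indicator {y \<in> space ?M. ?P y} (x(g := t)) \<partial>?M')
        = (\<integral>\<^sup>+x. indicator {c g..} t *
            indicator {y \<in> space ?M'. \<forall>f\<in>F'. c f + (t - c g) \<le> y f} x \<partial>?M')"
      using J' by (intro nn_integral_cong) (auto simp: indicator_def space_PiM PiE_def Pi_def extensional_def)
    also have "\<dots> = indicator {c g..} t *
        emeasure ?M' {y \<in> space ?M'. \<forall>f\<in>F'. c f + (t - c g) \<le> y f}"
    proof -
      have [measurable]: "(\<lambda>x. x e) \<in> borel_measurable ?M'" if "e \<in> F'" for e
    using subsetD[OF J'(4) that] by (intro measurable_exp_component) auto
      have "{y \<in> space ?M'. \<forall>f\<in>F'. c f + (t - c g) \<le> y f} \<in> sets ?M'"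
        using J'(7) by measurable
      then show ?thesis by (simp add: nn_integral_cmult)
    qed
    also have "\<dots> = indicator {c g..} t * ennreal (exp (- l * (\<Sum>f\<in>F'. c f + (t - c g))))"
      using J' c by (cases "c g \<le> t") (auto simp: emeasure_exp_product_box)
    finally show "(\<integral>\<^sup>+x. indicator {y \<in> space ?M. ?P y} (x(g := t)) \<partial>?M')
      = indicator {c g..} t * ennreal (exp (- l * (\<Sum>f\<in>F'. c f + (t - c g))))" .
  qed
  also have "\<dots> = (\<integral>\<^sup>+t. ennreal (exponential_density l t) *
      (indicator {c g..} t * ennreal (exp (- l * (\<Sum>f\<in>F'. c f + (t - c g))))) \<partial>lborel)"
    unfolding exp_measure_def by (subst nn_integral_density) auto
  \<comment> \<open>The exponents combine into the density of rate \<open>l * m\<close>, the law of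
    the minimum of \<open>m\<close> residuals. The factor \<open>exp (l * m * c g)\<close> is the
    one that the tail of this density beyond \<open>c g\<close> cancels.\<close>
  also have "\<dots> = (\<integral>\<^sup>+t. ennreal (1 / m * exp (- l * (\<Sum>f\<in>F. c f)) * exp (l * m * c g)) *
      (ennreal (exponential_density (l * m) t) * indicator {c g..} t) \<partial>lborel)"
  proof (rule nn_integral_cong)
    fix t
    have "exponential_density l t * exp (- l * (\<Sum>f\<in>F'. c f + (t - c g)))
        = 1 / m * exp (- l * (\<Sum>f\<in>F. c f)) * exp (l * m * c g) * exponential_density (l * m) t"
      if "c g \<le> t"
    proof -
      have "0 \<le> t" using that c[OF F(2)] by linarith
      have "- (t * l) + - l * (\<Sum>f\<in>F'. c f + (t - c g))
          = - l * (\<Sum>f\<in>F. c f) + l * m * c g + - (t * (l * m))"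
        using J' m by (simp add: sum.distrib sum_subtractf algebra_simps)
      then have "exp (- (t * l)) * exp (- l * (\<Sum>f\<in>F'. c f + (t - c g)))
          = exp (- l * (\<Sum>f\<in>F. c f)) * exp (l * m * c g) * exp (- (t * (l * m)))"
        by (metis exp_add)
      then show ?thesis
        using \<open>0 \<le> t\<close> m by (simp add: exponential_density_def field_simps)
    qed
    then show "ennreal (exponential_density l t) *
        (indicator {c g..} t * ennreal (exp (- l * (\<Sum>f\<in>F'. c f + (t - c g)))))
      = ennreal (1 / m * exp (- l * (\<Sum>f\<in>F. c f)) * exp (l * m * c g)) *
        (ennreal (exponential_density (l * m) t) * indicator {c g..} t)"
      using rate_pos m by (auto simp: indicator_def simp flip: ennreal_mult)
  qed
  also have "\<dots> = ennreal (1 / m * exp (- l * (\<Sum>f\<in>F. c f)) * exp (l * m * c g)) *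
      emeasure (exp_measure (l * m)) {c g..}"
    unfolding exp_measure_def by (subst nn_integral_cmult) (auto simp: emeasure_density)
  also have "\<dots> = ennreal (1 / m) * ennreal (exp (- l * (\<Sum>f\<in>F. c f)))"
  proof -
    have "emeasure (exp_measure (l * m)) {c g..} = ennreal (exp (- (l * m) * c g))"
      using c[OF F(2)] rate_pos m by (intro emeasure_exp_measure_atLeast) auto
    moreover have "exp (l * m * c g) * exp (- (l * m) * c g) = 1"
      by (simp flip: exp_add)
    ultimately show ?thesis
      using m by (simp add: mult.assoc flip: ennreal_mult)
  qed
  also have "ennreal (exp (- l * (\<Sum>f\<in>F. c f)))
      = emeasure ?M {y \<in> space ?M. \<forall>f\<in>F. c f \<le> y f}"
    using emeasure_exp_product_box[OF J F(1) c] by simp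
  finally show ?thesis by (simp add: m_def)
qed

text \<open>Some edge \<open>g\<close> lies in exactly one of the two sets. With all other weights
  fixed, equality leaves a single value for the weight of \<open>g\<close>, which has probability
  zero. This gives almost sure uniqueness of minimum paths.\<close>

lemma AE_exp_product_sum_neq:
  fixes I :: "'a set"
  assumes I: "finite I" and AB: "A \<subseteq> I" "B \<subseteq> I" "A \<noteq> B"
  shows "AE x in exp_product l I. (\<Sum>e\<in>A. x e) \<noteq> (\<Sum>e\<in>B. x e)"
proof -
  have *: "AE x in exp_product l I. (\<Sum>e\<in>A. x e) \<noteq> (\<Sum>e\<in>B. x e)"
    if AB: "A \<subseteq> I" "B \<subseteq> I" and g: "g \<in> A" "g \<notin> B" for A B g
  proof -
    let ?M = "exp_product l I" and ?P = "\<lambda>x. (\<Sum>e\<in>A. x e) = (\<Sum>e\<in>B. x e)"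
    define J where "J = I - {g}"
    have fin: "finite A" "finite B" using I AB finite_subset by auto
    have J: "I = insert g J" "g \<notin> J" "finite J" using g AB I by (auto simp: J_def)
    have [measurable]: "(\<lambda>x. x e) \<in> borel_measurable ?M" if "e \<in> A \<union> B" for e
    using AB that by (intro measurable_exp_component) auto
    have S: "{x \<in> space ?M. ?P x} \<in> sets ?M"
      by measurable
    have "emeasure ?M {x \<in> space ?M. ?P x} = (\<integral>\<^sup>+x. indicator {x \<in> space ?M. ?P x} x \<partial>?M)"
      using S by simp
    also have "\<dots> = (\<integral>\<^sup>+x. (\<integral>\<^sup>+t. indicator {x \<in> space ?M. ?P x} (x(g := t)) \<partial>exp_measure l) \<partial>exp_product l J)"
      using S unfolding J(1) by (intro prod.product_nn_integral_insert J) auto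
    also have "\<dots> = (\<integral>\<^sup>+x. 0 \<partial>exp_product l J)"
    proof (rule nn_integral_cong)
      fix x :: "'a \<Rightarrow> real"
      define a where "a = (\<Sum>e\<in>B. x e) - (\<Sum>e\<in>A - {g}. x e)"
      have A: "(\<Sum>e\<in>A. (x(g := t)) e) = t + (\<Sum>e\<in>A - {g}. x e)" for t
        using fin g by (subst sum.remove[of _ g]) (auto intro!: sum.cong)
      have B: "(\<Sum>e\<in>B. (x(g := t)) e) = (\<Sum>e\<in>B. x e)" for t
        using g by (intro sum.cong) auto
      have "(\<integral>\<^sup>+t. indicator {x \<in> space ?M. ?P x} (x(g := t)) \<partial>exp_measure l)
          \<le> (\<integral>\<^sup>+t. indicator {a} t \<partial>exp_measure l)"
        using A B by (intro nn_integral_mono) (auto simp: indicator_def a_def simp del: fun_upd_apply)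
      also have "\<dots> = emeasure (exp_measure l) {a}"
        by simp
      also have "\<dots> = 0"
      proof -
        have "AE x in lborel. x \<noteq> a" by (rule AE_lborel_singleton)
        then have "AE x in exp_measure l. x \<notin> {a}"
          unfolding exp_measure_def by (subst AE_density) auto
        then show ?thesis
          by (subst AE_iff_measurable[symmetric, where P = "\<lambda>x. x \<notin> {a}"]) auto
      qed
      finally show "(\<integral>\<^sup>+t. indicator {x \<in> space ?M. ?P x} (x(g := t)) \<partial>exp_measure l) = 0"
        by simp
    qed
    finally have "emeasure ?M {x \<in> space ?M. ?P x} = 0" by simp
    then show ?thesis
      using S by (subst AE_iff_measurable[where N = "{x \<in> space ?M. ?P x}"]) auto
  qed
  from AB(3) consider g where "g \<in> A" "g \<notin> B" | g where "g \<in> B" "g \<notin> A" by blast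
  then show ?thesis
  proof cases
    case 1 then show ?thesis using *[of A B g] AB by simp
  next
    case 2
    then have "AE x in exp_product l I. (\<Sum>e\<in>B. x e) \<noteq> (\<Sum>e\<in>A. x e)"
      using *[of B A g] AB by simp
    then show ?thesis by (simp add: eq_commute)
  qed
qed

end

section \<open>Measurability of the maximal path length and transfer to the product measure\<close>

lemma finite_complete_edges [simp]: "finite (complete_edges n)"
  unfolding complete_edges_def by (rule finite_subset[of _ "Pow {1..n}"]) auto

lemma pair_in_complete_edges:
  "{u, v} \<in> complete_edges n \<longleftrightarrow> u \<in> {1..n} \<and> v \<in> {1..n} \<and> u \<noteq> v"
  by (auto simp: complete_edges_def card_insert_if)

lemma list_edges_subset:
  assumes "distinct vs" "set vs \<subseteq> {1..n}"
  shows "list_edges vs \<subseteq> complete_edges n"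
proof
  fix e assume "e \<in> list_edges vs"
  then obtain k where k: "Suc k < length vs" "e = {vs ! k, vs ! Suc k}"
    by (auto simp: list_edges_def)
  then have "vs ! k \<in> {1..n}" "vs ! Suc k \<in> {1..n}"
    by (intro subsetD[OF assms(2)] nth_mem; simp)+
  moreover have "vs ! k \<noteq> vs ! Suc k"
    using k assms(1) by (simp add: nth_eq_iff_index_eq)
  ultimately show "e \<in> complete_edges n"
    by (simp only: k pair_in_complete_edges simp_thms)
qed

lemma paths_subset: "A \<in> paths n i j \<Longrightarrow> A \<subseteq> complete_edges n"
  unfolding paths_def using list_edges_subset by blast

lemma finite_paths [simp]: "finite (paths n i j)"
  by (rule finite_subset[of _ "Pow (complete_edges n)"]) (auto dest: paths_subset)

text \<open>The choice made by \<open>arg_min_on\<close> depends only on the set of minimisers, and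
  that set is determined by the strict comparisons between path weights.\<close>

lemma min_path_cong:
  assumes "\<And>A B. A \<in> paths n i j \<Longrightarrow> B \<in> paths n i j \<Longrightarrow>
    weight x A < weight x B \<longleftrightarrow> weight y A < weight y B"
  shows "min_path n x i j = min_path n y i j"
proof -
  have "is_arg_min (weight x) (\<lambda>A. A \<in> paths n i j) = is_arg_min (weight y) (\<lambda>A. A \<in> paths n i j)"
    using assms unfolding is_arg_min_def fun_eq_iff by blast
  then show ?thesis
    by (simp add: min_path_def arg_min_on_def arg_min_def)
qed

lemma max_path_length_cong:
  assumes "\<And>A B i j. A \<in> paths n i j \<Longrightarrow> B \<in> paths n i j \<Longrightarrow>
    weight x A < weight x B \<longleftrightarrow> weight y A < weight y B"
  shows "max_path_length n x = max_path_length n y"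
proof -
  have "min_path n x = min_path n y"
    using min_path_cong[OF assms] by (simp add: fun_eq_iff)
  then show ?thesis by (simp add: max_path_length_def)
qed

lemma weight_cong: "(\<And>e. e \<in> A \<Longrightarrow> x e = y e) \<Longrightarrow> weight x A = weight y A"
  by (simp add: weight_def)

lemma max_path_length_restrict:
  "max_path_length n (restrict x (complete_edges n)) = max_path_length n x"
proof (rule max_path_length_cong)
  fix A B i j assume "A \<in> paths n i j" "B \<in> paths n i j"
  then have "weight (restrict x (complete_edges n)) A = weight x A"
    "weight (restrict x (complete_edges n)) B = weight x B"
    by (auto intro!: weight_cong dest: subsetD[OF paths_subset])
  then show "weight (restrict x (complete_edges n)) A < weight (restrict x (complete_edges n)) B
    \<longleftrightarrow> weight x A < weight x B" by simp
qed

lemma measurable_weight: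
  "A \<subseteq> I \<Longrightarrow> (\<lambda>x. weight x A) \<in> borel_measurable (exp_product l I)"
  unfolding weight_def by (intro borel_measurable_sum measurable_exp_component) auto

text \<open>The value factors through the comparison pattern \<open>R\<close> of all pairs of edge
  sets. This pattern takes finitely many values and each is cut out by finitely many measurable
  inequalities.\<close>

lemma measurable_max_path_length:
  "max_path_length n \<in> edge_weights l n \<rightarrow>\<^sub>M count_space UNIV"
proof -
  let ?M = "edge_weights l n"
  define S where "S = Pow (complete_edges n) \<times> Pow (complete_edges n)"
  define R where "R x = {p \<in> S. weight x (fst p) < weight x (snd p)}" for x
  \<comment> \<open>Any weight function realising the pattern \<open>r\<close> may serve as
    representative, since the maximal path length is constant on patterns.\<close>
  define G where "G r = max_path_length n (SOME x. R x = r)" for r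
  have "finite S" by (simp add: S_def)
  have G: "max_path_length n x = G (R x)" for x
  proof -
    have "R (SOME y. R y = R x) = R x" by (rule someI[of "\<lambda>y. R y = R x"]) simp
    then have "weight (SOME y. R y = R x) A < weight (SOME y. R y = R x) B \<longleftrightarrow> weight x A < weight x B"
      if "A \<subseteq> complete_edges n" "B \<subseteq> complete_edges n" for A B
      using that unfolding R_def S_def by (auto simp: set_eq_iff)
    then show ?thesis
      unfolding G_def by (intro max_path_length_cong) (auto dest!: paths_subset)
  qed
  have "R \<in> ?M \<rightarrow>\<^sub>M count_space (Pow S)"
  proof (subst measurable_count_space_eq2)
    show "finite (Pow S)" using \<open>finite S\<close> by simp
    have "R -` {r} \<inter> space ?M \<in> sets ?M" if "r \<subseteq> S" for r
    proof -
      have "R -` {r} \<inter> space ?M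
        = {x \<in> space ?M. \<forall>p\<in>S. p \<in> r \<longleftrightarrow> weight x (fst p) < weight x (snd p)}"
        using that unfolding R_def by blast
      also have "\<dots> \<in> sets ?M"
      proof -
        have [measurable]: "Measurable.pred ?M (\<lambda>x. weight x (fst p) < weight x (snd p))" if "p \<in> S" for p
          unfolding pred_def using that
          by (intro borel_measurable_less measurable_weight) (auto simp: S_def)
        show ?thesis using \<open>finite S\<close> by measurable
      qed
      finally show ?thesis .
    qed
    then show "R \<in> space ?M \<rightarrow> Pow S \<and> (\<forall>r\<in>Pow S. R -` {r} \<inter> space ?M \<in> sets ?M)"
      by (auto simp: R_def)
  qed
  then have "(\<lambda>x. G (R x)) \<in> ?M \<rightarrow>\<^sub>M count_space UNIV"
    by (rule measurable_compose) simp
  also have "(\<lambda>x. G (R x)) = max_path_length n"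
    using G by (simp add: fun_eq_iff)
  finally show ?thesis .
qed

text \<open>Independence together with the marginal laws says exactly that the joint law is the
  product measure. The weights are restricted to the edge set because points of a product space are
  extensional functions.\<close>

lemma exponential_weights_distr:
  assumes X: "exponential_weights n M X" and n: "2 \<le> n"
  shows "distr M (edge_weights (1 / real n) n) (\<lambda>w. \<lambda>e\<in>complete_edges n. X e w)
    = edge_weights (1 / real n) n"
proof -
  let ?E = "complete_edges n" and ?W = "edge_weights (1 / real n) n"
  interpret prob_space M using X by (simp add: exponential_weights_def)
  \<comment> \<open>The characterisation of independence by the joint law requires a nonempty index
    set, hence at least two vertices.\<close>
  have "{1, 2} \<in> ?E" using n by (subst pair_in_complete_edges) auto
  then have E0: "?E \<noteq> {}" by blast
  have dist: "distr M lborel (X e) = exp_measure (1 / real n)" "X e \<in> borel_measurable M" if "e \<in> ?E" for e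
    using X that by (auto simp: exponential_weights_def distributed_def exp_measure_def)
  have sets: "sets (PiM ?E (\<lambda>_. borel :: real measure)) = sets ?W"
    by (rule sets_PiM_cong) auto
  have "indep_vars (\<lambda>_. borel) X ?E"
    using X by (simp add: exponential_weights_def)
  then have "distr M (PiM ?E (\<lambda>_. borel)) (\<lambda>w. \<lambda>e\<in>?E. X e w) = PiM ?E (\<lambda>e. distr M borel (X e))"
    using indep_vars_iff_distr_eq_PiM'[OF E0, where M' = "\<lambda>_. borel" and X = X] dist by blast
  also have "\<dots> = ?W"
    using dist by (intro PiM_cong) (auto cong: distr_cong)
  finally show ?thesis
    using sets by (simp cong: distr_cong)
qed

text \<open>All estimates are proved for the coordinate functions of one concrete product space;
  this lemma carries them to arbitrary weights with the prescribed law.\<close>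

lemma exponential_weights_transfer:
  fixes f :: "nat \<Rightarrow> real"
  assumes X: "exponential_weights n M X" and n: "2 \<le> n"
  shows "measure M {w \<in> space M. P (max_path_length n (\<lambda>e. X e w))}
      = \<P>(x in edge_weights (1 / real n) n. P (max_path_length n x))"
    and "(\<integral>w. f (max_path_length n (\<lambda>e. X e w)) \<partial>M)
      = (\<integral>x. f (max_path_length n x) \<partial>edge_weights (1 / real n) n)"
proof -
  let ?E = "complete_edges n" and ?W = "edge_weights (1 / real n) n"
  let ?Y = "\<lambda>w. \<lambda>e\<in>?E. X e w"
  have "X e \<in> borel_measurable M" if "e \<in> ?E" for e
    using X that by (auto simp: exponential_weights_def distributed_def)
  then have Y: "?Y \<in> M \<rightarrow>\<^sub>M ?W"
    by (intro measurable_restrict) (auto cong: measurable_cong_sets)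
  note [measurable] = measurable_max_path_length
  have "\<P>(x in ?W. P (max_path_length n x))
      = measure (distr M ?W ?Y) {x \<in> space ?W. P (max_path_length n x)}"
    by (simp only: exponential_weights_distr[OF X n])
  also have "\<dots> = measure M (?Y -` {x \<in> space ?W. P (max_path_length n x)} \<inter> space M)"
    by (rule measure_distr[OF Y]) measurable
  also have "?Y -` {x \<in> space ?W. P (max_path_length n x)} \<inter> space M
      = {w \<in> space M. P (max_path_length n (\<lambda>e. X e w))}"
    using measurable_space[OF Y] by (auto simp: max_path_length_restrict)
  finally show "measure M {w \<in> space M. P (max_path_length n (\<lambda>e. X e w))}
      = \<P>(x in ?W. P (max_path_length n x))" by simp
  have "(\<integral>x. f (max_path_length n x) \<partial>?W) = (\<integral>x. f (max_path_length n x) \<partial>distr M ?W ?Y)"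
    by (simp only: exponential_weights_distr[OF X n])
  also have "\<dots> = (\<integral>w. f (max_path_length n (?Y w)) \<partial>M)"
    by (rule integral_distr[OF Y]) measurable
  finally show "(\<integral>w. f (max_path_length n (\<lambda>e. X e w)) \<partial>M) = (\<integral>x. f (max_path_length n x) \<partial>?W)"
    by (simp add: max_path_length_restrict)
qed

section \<open>Shortest path trees\<close>

lemma list_edges_Nil [simp]: "list_edges [] = {}"
  and list_edges_single [simp]: "list_edges [v] = {}"
  by (auto simp: list_edges_def)

lemma list_edges_conv_image: "list_edges vs = (\<lambda>k. {vs ! k, vs ! Suc k}) ` {..<length vs - 1}"
  by (auto simp: list_edges_def)

lemma list_edges_Union: "e \<in> list_edges vs \<Longrightarrow> e \<subseteq> set vs"
  by (auto simp: list_edges_def)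

lemma finite_list_edges [simp]: "finite (list_edges vs)"
  by (simp add: list_edges_conv_image)

lemma inj_on_nth_edge:
  assumes "distinct vs"
  shows "inj_on (\<lambda>k. {vs ! k, vs ! Suc k}) {..<length vs - 1}"
proof (rule inj_onI)
  fix j k assume jk: "j \<in> {..<length vs - 1}" "k \<in> {..<length vs - 1}"
    and "{vs ! j, vs ! Suc j} = {vs ! k, vs ! Suc k}"
  then have "vs ! j = vs ! k \<or> (vs ! j = vs ! Suc k \<and> vs ! Suc j = vs ! k)"
    by (auto simp: doubleton_eq_iff)
  with assms jk show "j = k" by (auto simp: nth_eq_iff_index_eq)
qed

lemma card_list_edges: "distinct vs \<Longrightarrow> card (list_edges vs) = length vs - 1"
  unfolding list_edges_conv_image by (subst card_image[OF inj_on_nth_edge]) simp_all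

lemma weight_list_edges:
  "distinct vs \<Longrightarrow> weight x (list_edges vs) = (\<Sum>k<length vs - 1. x {vs ! k, vs ! Suc k})"
  unfolding list_edges_conv_image weight_def by (subst sum.reindex[OF inj_on_nth_edge]) simp_all

lemma list_edges_snoc:
  assumes "vs \<noteq> []"
  shows "list_edges (vs @ [v]) = insert {last vs, v} (list_edges vs)"
proof -
  have "{..<length (vs @ [v]) - 1} = insert (length vs - 1) {..<length vs - 1}"
    using assms by (cases vs) auto
  then have "list_edges (vs @ [v])
      = insert {(vs @ [v]) ! (length vs - 1), (vs @ [v]) ! Suc (length vs - 1)}
          ((\<lambda>k. {(vs @ [v]) ! k, (vs @ [v]) ! Suc k}) ` {..<length vs - 1})"
    by (simp add: list_edges_conv_image)
  moreover have "(\<lambda>k. {(vs @ [v]) ! k, (vs @ [v]) ! Suc k}) ` {..<length vs - 1} = list_edges vs"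
    unfolding list_edges_conv_image by (intro image_cong) (auto simp: nth_append)
  moreover have "(vs @ [v]) ! (length vs - 1) = last vs" "(vs @ [v]) ! Suc (length vs - 1) = v"
    using assms by (auto simp: nth_append last_conv_nth)
  ultimately show ?thesis by simp
qed

lemma weight_list_edges_snoc:
  assumes "vs \<noteq> []" "v \<notin> set vs"
  shows "weight x (list_edges (vs @ [v])) = weight x (list_edges vs) + x {last vs, v}"
proof -
  have "{last vs, v} \<notin> list_edges vs"
    using assms list_edges_Union by blast
  then show ?thesis
    using assms by (simp add: list_edges_snoc weight_def)
qed

section \<open>Exploration histories of Dijkstra's algorithm\<close>

type_synonym history = "(nat \<times> nat) list"

text \<open>Dijkstra's algorithm started at a vertex \<open>i\<close>: a history lists the tree edges (parent, child)
  in reverse order of discovery, and \<open>radius\<close> is the distance of the vertex found last.\<close>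

definition verts :: "nat \<Rightarrow> history \<Rightarrow> nat set" where
  "verts i h = insert i (snd ` set h)"

definition boundary :: "nat \<Rightarrow> nat \<Rightarrow> history \<Rightarrow> (nat \<times> nat) set" where
  "boundary n i h = verts i h \<times> ({1..n} - verts i h)"

fun histories :: "nat \<Rightarrow> nat \<Rightarrow> nat \<Rightarrow> history set" where
  "histories n i 0 = {[]}"
| "histories n i (Suc m) = (\<lambda>(h, e). e # h) ` Sigma (histories n i m) (boundary n i)"

text \<open>The base value serves the root. It is also the default for vertices that the history
  never reaches, so statements about distances are confined to \<open>verts i h\<close>.\<close>

fun tree_dist :: "(nat set \<Rightarrow> real) \<Rightarrow> history \<Rightarrow> nat \<Rightarrow> real" where
  "tree_dist x [] w = 0"
| "tree_dist x ((u, v) # h) w = (if w = v then tree_dist x h u + x {u, v} else tree_dist x h w)"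

fun tree_depth :: "history \<Rightarrow> nat \<Rightarrow> nat" where
  "tree_depth [] w = 0"
| "tree_depth ((u, v) # h) w = (if w = v then Suc (tree_depth h u) else tree_depth h w)"

fun radius :: "(nat set \<Rightarrow> real) \<Rightarrow> history \<Rightarrow> real" where
  "radius x [] = 0"
| "radius x ((u, v) # h) = tree_dist x h u + x {u, v}"

text \<open>The minimality test is non-strict, so a greedy history exists for every weight function;
  several may exist when there are ties, which an upper bound tolerates.\<close>

fun greedy :: "nat \<Rightarrow> nat \<Rightarrow> (nat set \<Rightarrow> real) \<Rightarrow> history \<Rightarrow> bool" where
  "greedy n i x [] = True"
| "greedy n i x ((u, v) # h) \<longleftrightarrow> greedy n i x h \<and>
     (\<forall>(a, w)\<in>boundary n i h. tree_dist x h u + x {u, v} \<le> tree_dist x h a + x {a, w})"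

text \<open>The part of \<open>greedy\<close> that only concerns edges between explored vertices. Given these edges, what
  remains is that every boundary edge ends outside the ball of the current radius, so memorylessness
  makes the next tree edge uniform on the boundary.\<close>

fun inner_greedy :: "nat \<Rightarrow> (nat set \<Rightarrow> real) \<Rightarrow> history \<Rightarrow> bool" where
  "inner_greedy i x [] = True"
| "inner_greedy i x ((u, v) # h) \<longleftrightarrow> inner_greedy i x h \<and> radius x h \<le> tree_dist x h u + x {u, v} \<and>
     (\<forall>a\<in>verts i h. tree_dist x h u + x {u, v} \<le> tree_dist x h a + x {a, v})"

lemma verts_Nil [simp]: "verts i [] = {i}"
  and verts_Cons [simp]: "verts i ((u, v) # h) = insert v (verts i h)"
  and finite_verts [simp]: "finite (verts i h)"
  by (auto simp: verts_def)

lemma finite_boundary [simp]: "finite (boundary n i h)"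
  by (simp add: boundary_def)

lemma finite_histories [simp]: "finite (histories n i m)"
  by (induction m) auto

lemma histories_induct [consumes 2, case_names Nil Cons]:
  assumes "h \<in> histories n i m" "i \<in> {1..n}"
    and "P 0 []"
    and "\<And>m h u v. h \<in> histories n i m \<Longrightarrow> P m h \<Longrightarrow> u \<in> verts i h \<Longrightarrow> v \<in> {1..n} \<Longrightarrow>
      v \<notin> verts i h \<Longrightarrow> P (Suc m) ((u, v) # h)"
  shows "P m h"
  using assms(1)
proof (induction m arbitrary: h)
  case 0 then show ?case using assms(3) by simp
next
  case (Suc m) then show ?case using assms(4) by (auto simp: boundary_def)
qed

lemma verts_histories:
  assumes "h \<in> histories n i m" "i \<in> {1..n}"
  shows "verts i h \<subseteq> {1..n} \<and> card (verts i h) = Suc m \<and> i \<in> verts i h"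
  using assms
proof (induction rule: histories_induct)
  case Nil
  show ?case using assms(2) by simp
qed auto

lemma card_boundary:
  assumes "h \<in> histories n i m" "i \<in> {1..n}"
  shows "card (boundary n i h) = Suc m * (n - Suc m)"
  using verts_histories[OF assms]
  by (auto simp: boundary_def card_cartesian_product card_Diff_subset)

lemma tree_dist_root:
  assumes "h \<in> histories n i m" "i \<in> {1..n}"
  shows "tree_dist x h i = 0"
  using assms
proof (induction rule: histories_induct)
  case (Cons m h u v)
  then show ?case using verts_histories[of h n i m] assms(2) by auto
qed auto

lemma tree_dist_le_radius:
  assumes "h \<in> histories n i m" "i \<in> {1..n}" "inner_greedy i x h" "a \<in> verts i h"
  shows "tree_dist x h a \<le> radius x h"
  using assms
proof (induction arbitrary: a rule: histories_induct)
  case (Cons m h u v)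
  then show ?case by (force intro: order_trans)
qed auto

text \<open>When \<open>v\<close> joins the tree, the minimality conditions on edges into
  \<open>v\<close> become inner conditions, and those on edges to other unexplored vertices stay
  boundary conditions. The new boundary edges start at \<open>v\<close>, whose distance is the
  radius, so nonnegative weights satisfy their condition for free.\<close>

lemma greedy_iff:
  assumes "h \<in> histories n i m" "i \<in> {1..n}" and x: "\<And>e. e \<in> complete_edges n \<Longrightarrow> 0 \<le> x e"
  shows "greedy n i x h \<longleftrightarrow> inner_greedy i x h \<and>
    (\<forall>(a, w)\<in>boundary n i h. radius x h \<le> tree_dist x h a + x {a, w})"
  using assms(1,2)
proof (induction rule: histories_induct)
  case Nil
  then show ?case using x assms(2) by (auto simp: boundary_def pair_in_complete_edges)
next
  case (Cons m h u v)
  note V = verts_histories[OF Cons.hyps(1) assms(2)]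
  have xv: "0 \<le> x {v, w}" if "w \<in> {1..n} - insert v (verts i h)" for w
    using that Cons.hyps by (intro x) (subst pair_in_complete_edges, auto)
  let ?s = "tree_dist x h u + x {u, v}"
  have ne: "a \<noteq> v" if "a \<in> verts i h" for a using that Cons.hyps by auto
  \<comment> \<open>The old boundary bounds by \<open>radius x h\<close> survive only as
    \<open>radius x h \<le> ?s\<close>: together with the new bounds by \<open>?s\<close> this
    implies all of them.\<close>
  have "greedy n i x ((u, v) # h) \<longleftrightarrow> inner_greedy i x h \<and> radius x h \<le> ?s \<and>
    (\<forall>a\<in>verts i h. \<forall>w\<in>{1..n} - verts i h. ?s \<le> tree_dist x h a + x {a, w})"
    unfolding greedy.simps Cons.IH using Cons.hyps by (force simp: boundary_def)
  also have "\<dots> \<longleftrightarrow> inner_greedy i x h \<and> radius x h \<le> ?s \<and>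
    (\<forall>a\<in>verts i h. ?s \<le> tree_dist x h a + x {a, v}) \<and>
    (\<forall>a\<in>verts i h. \<forall>w\<in>{1..n} - insert v (verts i h). ?s \<le> tree_dist x h a + x {a, w})"
    using Cons.hyps by blast
  also have "\<dots> \<longleftrightarrow> inner_greedy i x ((u, v) # h) \<and>
    (\<forall>(a, w)\<in>boundary n i ((u, v) # h). radius x ((u, v) # h) \<le> tree_dist x ((u, v) # h) a + x {a, w})"
    using xv ne by (auto simp: boundary_def)
  finally show ?case .
qed

section \<open>Uniform attachment in the exploration\<close>

context exp_rate
begin

text \<open>The thresholds \<open>c f\<close> are now random, but determined by coordinates disjoint
  from \<open>F\<close>. Freezing those turns them into constants, and \<open>memoryless_min\<close>
  applies inside the outer integral.\<close>

lemma memoryless_min_conditional: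
  fixes I :: "'a set" and c :: "'a \<Rightarrow> ('a \<Rightarrow> real) \<Rightarrow> real"
  assumes I: "finite I" and A: "A \<subseteq> I" and F: "F \<subseteq> I - A" "g \<in> F"
    and Q: "depends_on A Q" "Measurable.pred (exp_product l I) Q"
    and c: "\<And>f. f \<in> F \<Longrightarrow> depends_on A (c f)" "\<And>f. f \<in> F \<Longrightarrow> c f \<in> borel_measurable (exp_product l I)"
    and c0: "\<And>f x. f \<in> F \<Longrightarrow> Q x \<Longrightarrow> 0 \<le> c f x"
  shows "emeasure (exp_product l I) {x \<in> space (exp_product l I).
        Q x \<and> c g x \<le> x g \<and> (\<forall>f\<in>F. c f x + (x g - c g x) \<le> x f)}
    = ennreal (1 / real (card F)) * emeasure (exp_product l I)
        {x \<in> space (exp_product l I). Q x \<and> (\<forall>f\<in>F. c f x \<le> x f)}"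
proof -
  let ?J = "I - A"
  let ?M = "exp_product l I" and ?MA = "exp_product l A" and ?MJ = "exp_product l ?J"
  have fin: "finite F" "finite ?J" "finite A" using I F A by (auto intro: finite_subset)
  have comp: "(\<lambda>x. x f) \<in> borel_measurable ?M" if "f \<in> F" for f
    using F that by (intro measurable_exp_component) auto
  note [measurable] = Q(2) comp[OF F(2)] c(2)[OF F(2)]
  have p: "Measurable.pred ?M (\<lambda>x. c f x + (x g - c g x) \<le> x f)"
    "Measurable.pred ?M (\<lambda>x. c f x \<le> x f)" if "f \<in> F" for f
    unfolding pred_def
    by (intro borel_measurable_le borel_measurable_add borel_measurable_diff c(2) comp F(2) that)+
  let ?R = "\<lambda>x. Q x \<and> c g x \<le> x g \<and> (\<forall>f\<in>F. c f x + (x g - c g x) \<le> x f)"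
  let ?S = "\<lambda>x. Q x \<and> (\<forall>f\<in>F. c f x \<le> x f)"
  have [measurable]: "Measurable.pred ?M ?R" "Measurable.pred ?M ?S"
    by (intro pred_intros_logic pred_intros_finite fin p Q F(2); assumption)+
  have "emeasure ?M {x \<in> space ?M. ?R x}
      = (\<integral>\<^sup>+x. emeasure ?MJ {y \<in> space ?MJ. ?R (merge A ?J (x, y))} \<partial>?MA)"
    by (rule emeasure_exp_product_split[OF I A]) measurable
  also have "\<dots> = (\<integral>\<^sup>+x. ennreal (1 / real (card F)) *
      emeasure ?MJ {y \<in> space ?MJ. ?S (merge A ?J (x, y))} \<partial>?MA)"
  proof (rule nn_integral_cong)
    fix x :: "'a \<Rightarrow> real"
    \<comment> \<open>The coordinates outside \<open>A\<close> may be filled arbitrarily, because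
      \<open>Q\<close> and all \<open>c f\<close> ignore them.\<close>
    define x' where "x' = merge A ?J (x, undefined)"
    have Q': "Q (merge A ?J (x, y)) = Q x'" for y
      unfolding x'_def by (rule depends_onD[OF Q(1)]) (simp add: merge_def)
    have c': "c f (merge A ?J (x, y)) = c f x'" if "f \<in> F" for f y
      unfolding x'_def by (rule depends_onD[OF c(1)[OF that]]) (simp add: merge_def)
    have m: "merge A ?J (x, y) f = y f" if "f \<in> F" for f y
      using F that by (auto simp: merge_def)
    show "emeasure ?MJ {y \<in> space ?MJ. ?R (merge A ?J (x, y))}
      = ennreal (1 / real (card F)) * emeasure ?MJ {y \<in> space ?MJ. ?S (merge A ?J (x, y))}"
    proof (cases "Q x'")
      case True
      have R: "?R (merge A ?J (x, y)) \<longleftrightarrow>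
          c g x' \<le> y g \<and> (\<forall>f\<in>F. c f x' + (y g - c g x') \<le> y f)" for y
        using True F(2) by (auto simp: Q' c' m)
      have S: "?S (merge A ?J (x, y)) \<longleftrightarrow> (\<forall>f\<in>F. c f x' \<le> y f)" for y
        using True F(2) by (auto simp: Q' c' m)
      show ?thesis
        unfolding R S using c0 True by (intro memoryless_min fin F) auto
    qed (simp add: Q')
  qed
  also have "\<dots> = ennreal (1 / real (card F)) *
      (\<integral>\<^sup>+x. emeasure ?MJ {y \<in> space ?MJ. ?S (merge A ?J (x, y))} \<partial>?MA)"
  proof (rule nn_integral_cmult)
    have IJ: "A \<union> ?J = I" using A by auto
    have [measurable]: "merge A ?J \<in> ?MA \<Otimes>\<^sub>M ?MJ \<rightarrow>\<^sub>M ?M"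
      using measurable_merge[of A ?J "\<lambda>_. exp_measure l"] IJ by simp
    interpret J: sigma_finite_measure ?MJ
      using fin by (intro prod.sigma_finite)
    have "{z \<in> space (?MA \<Otimes>\<^sub>M ?MJ). ?S (merge A ?J z)} \<in> sets (?MA \<Otimes>\<^sub>M ?MJ)"
      by measurable
    from J.measurable_emeasure_Pair[OF this]
    show "(\<lambda>x. emeasure ?MJ {y \<in> space ?MJ. ?S (merge A ?J (x, y))}) \<in> borel_measurable ?MA"
      by (rule measurable_cong[THEN iffD1, rotated])
        (auto intro!: arg_cong[where f = "emeasure ?MJ"] simp: space_pair_measure)
  qed
  also have "(\<integral>\<^sup>+x. emeasure ?MJ {y \<in> space ?MJ. ?S (merge A ?J (x, y))} \<partial>?MA)
      = emeasure ?M {x \<in> space ?M. ?S x}"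
    by (rule emeasure_exp_product_split[OF I A, symmetric]) measurable
  finally show ?thesis .
qed

end

lemma tree_dist_depends_on:
  assumes "h \<in> histories n i m" "i \<in> {1..n}"
  shows "w \<in> verts i h \<Longrightarrow> depends_on (complete_edges n \<inter> Pow (verts i h)) (\<lambda>x. tree_dist x h w)"
    and "depends_on (complete_edges n \<inter> Pow (verts i h)) (\<lambda>x. radius x h)"
    and "depends_on (complete_edges n \<inter> Pow (verts i h)) (\<lambda>x. inner_greedy i x h)"
proof -
  have *: "(w \<in> verts i h \<longrightarrow> tree_dist x h w = tree_dist y h w) \<and> radius x h = radius y h \<and>
      inner_greedy i x h = inner_greedy i y h"
    if "\<forall>e\<in>complete_edges n \<inter> Pow (verts i h). x e = y e" for x y :: "nat set \<Rightarrow> real" and w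
    using assms that
  proof (induction arbitrary: w rule: histories_induct)
    case (Cons m h u v)
    note V = verts_histories[OF Cons.hyps(1) assms(2)]
    have IH: "tree_dist x h w = tree_dist y h w" "radius x h = radius y h"
        "inner_greedy i x h = inner_greedy i y h" if "w \<in> verts i h" for w
      using Cons.IH[of w] Cons.prems that by auto
    have e: "x {a, v} = y {a, v}" if "a \<in> verts i h" for a
    proof -
      have "{a, v} \<in> complete_edges n"
        using that V Cons.hyps by (subst pair_in_complete_edges) auto
      then show ?thesis using Cons.prems that by auto
    qed
    show ?case
      using IH e Cons.hyps(2) by auto
  qed auto
  show "w \<in> verts i h \<Longrightarrow> depends_on (complete_edges n \<inter> Pow (verts i h)) (\<lambda>x. tree_dist x h w)"
    "depends_on (complete_edges n \<inter> Pow (verts i h)) (\<lambda>x. radius x h)"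
    "depends_on (complete_edges n \<inter> Pow (verts i h)) (\<lambda>x. inner_greedy i x h)"
    unfolding depends_on_def using * by blast+
qed

lemma tree_dist_measurable:
  assumes "h \<in> histories n i m" "i \<in> {1..n}"
  shows "w \<in> verts i h \<Longrightarrow> (\<lambda>x. tree_dist x h w) \<in> borel_measurable (edge_weights l n)"
    and "(\<lambda>x. radius x h) \<in> borel_measurable (edge_weights l n)"
    and "Measurable.pred (edge_weights l n) (\<lambda>x. inner_greedy i x h)"
    and "Measurable.pred (edge_weights l n) (\<lambda>x. greedy n i x h)"
proof -
  let ?M = "edge_weights l n"
  have *: "(w \<in> verts i h \<longrightarrow> (\<lambda>x. tree_dist x h w) \<in> borel_measurable ?M) \<and>
    (\<lambda>x. radius x h) \<in> borel_measurable ?M \<and> Measurable.pred ?M (\<lambda>x. inner_greedy i x h) \<and>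
    Measurable.pred ?M (\<lambda>x. greedy n i x h)" for w
    using assms
  proof (induction arbitrary: w rule: histories_induct)
    case (Cons m h u v)
    note V = verts_histories[OF Cons.hyps(1) assms(2)]
    have IH: "(\<lambda>x. tree_dist x h w) \<in> borel_measurable ?M" if "w \<in> verts i h" for w
      using Cons.IH that by blast
    have e: "(\<lambda>x. x {a, w}) \<in> borel_measurable ?M" if "a \<in> verts i h" "w \<in> {1..n} - verts i h" for a w
      using that V by (intro measurable_exp_component, subst pair_in_complete_edges) auto
    have v: "v \<in> {1..n} - verts i h" using Cons.hyps by simp
    have d: "(\<lambda>x. tree_dist x h u + x {u, v}) \<in> borel_measurable ?M"
      by (intro borel_measurable_add IH e Cons.hyps v)
    have r: "(\<lambda>x. radius x h) \<in> borel_measurable ?M"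
      and [measurable]: "Measurable.pred ?M (\<lambda>x. inner_greedy i x h)" "Measurable.pred ?M (\<lambda>x. greedy n i x h)"
      using Cons.IH by blast+
    have [measurable]: "Measurable.pred ?M (\<lambda>x. tree_dist x h u + x {u, v} \<le> tree_dist x h a + x {a, w})"
      if "a \<in> verts i h" "w \<in> {1..n} - verts i h" for a w
      unfolding pred_def by (intro borel_measurable_le d borel_measurable_add IH e that)
    have [measurable]: "Measurable.pred ?M (\<lambda>x. radius x h \<le> tree_dist x h u + x {u, v})"
      unfolding pred_def by (intro borel_measurable_le d r)
    have "Measurable.pred ?M (\<lambda>x. \<forall>p\<in>boundary n i h. tree_dist x h u + x {u, v} \<le> tree_dist x h (fst p) + x {fst p, snd p})"
      by (rule pred_intros_finite) (auto simp: boundary_def)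
    moreover have "Measurable.pred ?M (\<lambda>x. \<forall>a\<in>verts i h. tree_dist x h u + x {u, v} \<le> tree_dist x h a + x {a, v})"
      by (rule pred_intros_finite) (use v in auto)
    moreover have "(\<lambda>x. tree_dist x ((u, v) # h) w) \<in> borel_measurable ?M" if "w \<in> verts i ((u, v) # h)"
      using that d IH by auto
    ultimately show ?case
      using d by (auto simp: case_prod_beta intro!: pred_intros_logic)
  qed auto
  show "w \<in> verts i h \<Longrightarrow> (\<lambda>x. tree_dist x h w) \<in> borel_measurable ?M"
    "(\<lambda>x. radius x h) \<in> borel_measurable ?M" "Measurable.pred ?M (\<lambda>x. inner_greedy i x h)"
    "Measurable.pred ?M (\<lambda>x. greedy n i x h)"
    using * by blast+
qed

text \<open>A greedy history amounts to inner conditions plus the fact that every boundary edge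
  outlives its threshold. The next tree edge is the boundary edge with the smallest residual, hence
  uniform among the \<open>Suc m * (n - Suc m)\<close> boundary edges; in particular its parent is
  uniform among the explored vertices.\<close>

lemma (in exp_rate) measure_greedy_step:
  fixes n i m h u v
  defines "W \<equiv> edge_weights l n"
  assumes h: "h \<in> histories n i m" and i: "i \<in> {1..n}" and uv: "(u, v) \<in> boundary n i h"
  shows "\<P>(x in W. greedy n i x ((u, v) # h))
    \<le> \<P>(x in W. greedy n i x h) / (real (Suc m) * real (n - Suc m))"
proof -
  let ?V = "verts i h" and ?bd = "boundary n i h"
  define A where "A = complete_edges n \<inter> Pow ?V"
  define edge :: "nat \<times> nat \<Rightarrow> nat set" where "edge p = {fst p, snd p}" for p
  define F where "F = edge ` ?bd"
  \<comment> \<open>The threshold is the part of a boundary edge already covered when the ball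
    reaches the current radius. Edges are unordered sets, so the explored endpoint has to be
    recovered through \<open>inv_into\<close>.\<close>
  define c where "c f x = radius x h - tree_dist x h (fst (inv_into ?bd edge f))" for f x
  interpret W: prob_space W unfolding W_def by (rule prob_space_exp_product)
  note V = verts_histories[OF h i]
  have inj: "inj_on edge ?bd"
    by (auto simp: inj_on_def edge_def boundary_def doubleton_eq_iff)
  have c_edge: "c {a, w} x = radius x h - tree_dist x h a" if "(a, w) \<in> ?bd" for a w x
    using inv_into_f_f[OF inj that] by (simp add: c_def edge_def)
  have F_cases: "\<exists>a w. f = {a, w} \<and> (a, w) \<in> ?bd" if "f \<in> F" for f
    using that unfolding F_def edge_def by (metis (no_types, lifting) imageE prod.collapse)
  have ball_F: "(\<forall>f\<in>F. P f) \<longleftrightarrow> (\<forall>(a, w)\<in>?bd. P {a, w})" for P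
    by (auto simp: F_def edge_def)
  have gF: "{u, v} \<in> F" using uv by (force simp: F_def edge_def)
  have cardF: "card F = Suc m * (n - Suc m)"
    unfolding F_def by (simp add: card_image[OF inj] card_boundary[OF h i])
  have FI: "F \<subseteq> complete_edges n - A"
  proof
    fix f assume "f \<in> F"
    then obtain a w where f: "f = {a, w}" "(a, w) \<in> ?bd" using F_cases by blast
    then have "a \<in> ?V" "w \<in> {1..n} - ?V" by (auto simp: boundary_def)
    then have "{a, w} \<in> complete_edges n"
      using V by (subst pair_in_complete_edges) auto
    then show "f \<in> complete_edges n - A"
      using f \<open>w \<in> {1..n} - ?V\<close> by (auto simp: A_def)
  qed
  have nonneg: "AE x in W. \<forall>e\<in>complete_edges n. 0 \<le> x e"
    unfolding W_def by (rule AE_exp_product_nonneg) simp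
  have c_props: "depends_on A (c f)" "c f \<in> borel_measurable W" "inner_greedy i x h \<Longrightarrow> 0 \<le> c f x"
    "(\<lambda>x. x f) \<in> borel_measurable W" if fF: "f \<in> F" for f x
  proof -
    obtain a w where f: "f = {a, w}" "(a, w) \<in> ?bd" using F_cases[OF fF] by blast
    have cf: "c f = (\<lambda>x. radius x h - tree_dist x h a)"
      using c_edge[OF f(2)] f(1) by (simp add: fun_eq_iff)
    have a: "a \<in> ?V" using f by (auto simp: boundary_def)
    have "depends_on A (\<lambda>x. radius x h)" "depends_on A (\<lambda>x. tree_dist x h a)"
      unfolding A_def using a by (auto intro: tree_dist_depends_on[OF h i])
    then show "depends_on A (c f)"
      unfolding cf depends_on_def by metis
    show "c f \<in> borel_measurable W"
      unfolding cf W_def by (intro borel_measurable_diff tree_dist_measurable[OF h i] a)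
    show "inner_greedy i x h \<Longrightarrow> 0 \<le> c f x"
      unfolding cf using tree_dist_le_radius[OF h i _ a] by simp
    show "(\<lambda>x. x f) \<in> borel_measurable W"
      unfolding W_def using FI fF by (intro measurable_exp_component) auto
  qed
  have cond: "emeasure W {x \<in> space W. inner_greedy i x h \<and> c {u, v} x \<le> x {u, v} \<and>
        (\<forall>f\<in>F. c f x + (x {u, v} - c {u, v} x) \<le> x f)}
    = ennreal (1 / real (card F)) * emeasure W {x \<in> space W. inner_greedy i x h \<and> (\<forall>f\<in>F. c f x \<le> x f)}"
    unfolding W_def
  proof (rule memoryless_min_conditional[OF _ _ FI gF])
    show "depends_on A (\<lambda>x. inner_greedy i x h)"
      unfolding A_def by (rule tree_dist_depends_on[OF h i])
    show "Measurable.pred (edge_weights l n) (\<lambda>x. inner_greedy i x h)"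
      by (rule tree_dist_measurable[OF h i])
    fix f assume f: "f \<in> F"
    show "depends_on A (c f)" "c f \<in> borel_measurable (edge_weights l n)"
      using c_props[OF f] by (auto simp: W_def)
    show "0 \<le> c f x" if "inner_greedy i x h" for x using c_props(3)[OF f that] .
  qed (auto simp: A_def)
  have meas: "{x \<in> space W. greedy n i x h} \<in> sets W"
    unfolding W_def using tree_dist_measurable(4)[OF h i] by measurable
  have p1: "Measurable.pred W (\<lambda>x. c f x \<le> x f)"
    and p2: "Measurable.pred W (\<lambda>x. c f x + (x {u, v} - c {u, v} x) \<le> x f)" if "f \<in> F" for f
    unfolding pred_def
    by (intro borel_measurable_le borel_measurable_add borel_measurable_diff c_props gF that)+
  have finF: "finite F" by (simp add: F_def)
  have Q: "Measurable.pred W (\<lambda>x. inner_greedy i x h)"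
    unfolding W_def by (rule tree_dist_measurable[OF h i])
  have "Measurable.pred W (\<lambda>x. inner_greedy i x h \<and> (\<forall>f\<in>F. c f x \<le> x f))"
    by (intro pred_intros_logic pred_intros_finite finF p1 Q)
  then have R: "{x \<in> space W. inner_greedy i x h \<and> (\<forall>f\<in>F. c f x \<le> x f)} \<in> sets W"
    by measurable
  have "Measurable.pred W (\<lambda>x. inner_greedy i x h \<and> c {u, v} x \<le> x {u, v} \<and>
      (\<forall>f\<in>F. c f x + (x {u, v} - c {u, v} x) \<le> x f))"
    by (intro pred_intros_logic pred_intros_finite finF p1 p2 Q gF)
  then have R': "{x \<in> space W. inner_greedy i x h \<and> c {u, v} x \<le> x {u, v} \<and>
      (\<forall>f\<in>F. c f x + (x {u, v} - c {u, v} x) \<le> x f)} \<in> sets W"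
    by measurable
  have "emeasure W {x \<in> space W. greedy n i x ((u, v) # h)}
      \<le> emeasure W {x \<in> space W. inner_greedy i x h \<and> c {u, v} x \<le> x {u, v} \<and>
        (\<forall>f\<in>F. c f x + (x {u, v} - c {u, v} x) \<le> x f)}"
  proof (rule emeasure_mono_AE[OF _ R'], use nonneg in eventually_elim)
    fix x :: "nat set \<Rightarrow> real" assume x: "\<forall>e\<in>complete_edges n. 0 \<le> x e"
    show "x \<in> {x \<in> space W. greedy n i x ((u, v) # h)} \<longrightarrow>
      x \<in> {x \<in> space W. inner_greedy i x h \<and> c {u, v} x \<le> x {u, v} \<and>
        (\<forall>f\<in>F. c f x + (x {u, v} - c {u, v} x) \<le> x f)}"
      unfolding ball_F using x greedy_iff[OF h i, of x] uv by (force simp: c_edge)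
  qed
  also note cond
  also have "emeasure W {x \<in> space W. inner_greedy i x h \<and> (\<forall>f\<in>F. c f x \<le> x f)}
      = emeasure W {x \<in> space W. greedy n i x h}"
  proof (rule emeasure_eq_AE[OF _ R meas], use nonneg in eventually_elim)
    fix x :: "nat set \<Rightarrow> real" assume x: "\<forall>e\<in>complete_edges n. 0 \<le> x e"
    show "x \<in> {x \<in> space W. inner_greedy i x h \<and> (\<forall>f\<in>F. c f x \<le> x f)} \<longleftrightarrow>
      x \<in> {x \<in> space W. greedy n i x h}"
      unfolding ball_F using x greedy_iff[OF h i, of x] by (force simp: c_edge)
  qed
  finally have "\<P>(x in W. greedy n i x ((u, v) # h))
      \<le> 1 / real (card F) * \<P>(x in W. greedy n i x h)"
    by (simp add: W.emeasure_eq_measure ennreal_mult[symmetric] del: greedy.simps)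
  then show ?thesis
    by (simp only: cardF of_nat_mult mult_1_left times_divide_eq_left)
qed

section \<open>The generating polynomial of the vertex depths\<close>

definition tree_potential :: "real \<Rightarrow> nat \<Rightarrow> history \<Rightarrow> real" where
  "tree_potential z i h = (\<Sum>w\<in>verts i h. z ^ tree_depth h w)"

lemma tree_potential_nonneg: "0 \<le> z \<Longrightarrow> 0 \<le> tree_potential z i h"
  by (simp add: tree_potential_def sum_nonneg)

lemma tree_potential_Cons:
  assumes "v \<notin> verts i h"
  shows "tree_potential z i ((u, v) # h) = tree_potential z i h + z * z ^ tree_depth h u"
proof -
  have "(\<Sum>w\<in>verts i h. z ^ tree_depth ((u, v) # h) w) = (\<Sum>w\<in>verts i h. z ^ tree_depth h w)"
    using assms by (intro sum.cong) auto
  then show ?thesis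
    using assms by (simp add: tree_potential_def)
qed

text \<open>A new leaf below \<open>u\<close> adds \<open>z * z ^ tree_depth h u\<close>. Averaging
  over a uniform parent among \<open>Suc m\<close> vertices adds \<open>z / Suc m\<close> times the
  current potential, whereas the label of the child does not matter, so the \<open>n - Suc m\<close>
  choices for it cancel against the boundary size.\<close>

lemma (in exp_rate) expected_tree_potential:
  fixes n i m z
  defines "W \<equiv> edge_weights l n"
  assumes i: "i \<in> {1..n}" and z: "0 \<le> z" and m: "m < n"
  shows "(\<Sum>h\<in>histories n i m. \<P>(x in W. greedy n i x h) * tree_potential z i h)
    \<le> (\<Prod>k=1..m. 1 + z / real k)"
  using m
proof (induction m)
  case 0
  interpret W: prob_space W unfolding W_def by (rule prob_space_exp_product)
  show ?case by (simp add: tree_potential_def W.prob_space)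
next
  case (Suc m)
  interpret W: prob_space W unfolding W_def by (rule prob_space_exp_product)
  let ?p = "\<lambda>h. \<P>(x in W. greedy n i x h)"
  let ?B = "real (Suc m) * real (n - Suc m)"
  have B: "0 < ?B" using Suc.prems by simp
  have inj: "inj_on (\<lambda>(h, e). e # h) (Sigma (histories n i m) (boundary n i))"
    by (auto simp: inj_on_def)
  have step: "(\<Sum>(u, v)\<in>boundary n i h. ?p ((u, v) # h) * tree_potential z i ((u, v) # h))
      \<le> ?p h * tree_potential z i h * (1 + z / real (Suc m))" if h: "h \<in> histories n i m" for h
  proof -
    note V = verts_histories[OF h i]
    have "(\<Sum>(u, v)\<in>boundary n i h. ?p ((u, v) # h) * tree_potential z i ((u, v) # h))
        \<le> (\<Sum>(u, v)\<in>boundary n i h. ?p h / ?B * (tree_potential z i h + z * z ^ tree_depth h u))"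
    proof (rule sum_mono, clarify)
      fix u v assume uv: "(u, v) \<in> boundary n i h"
      then have "v \<notin> verts i h" by (auto simp: boundary_def)
      then show "?p ((u, v) # h) * tree_potential z i ((u, v) # h)
          \<le> ?p h / ?B * (tree_potential z i h + z * z ^ tree_depth h u)"
        using measure_greedy_step[OF h i uv] z unfolding tree_potential_Cons[OF \<open>v \<notin> verts i h\<close>] W_def
        by (intro mult_right_mono add_nonneg_nonneg tree_potential_nonneg mult_nonneg_nonneg zero_le_power)
    qed
    also have "\<dots> = (\<Sum>u\<in>verts i h. \<Sum>v\<in>{1..n} - verts i h.
        ?p h / ?B * (tree_potential z i h + z * z ^ tree_depth h u))"
      unfolding boundary_def by (rule sum.cartesian_product[symmetric])
    also have "\<dots> = real (n - Suc m) * (?p h / ?B) *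
        (real (Suc m) * tree_potential z i h + z * tree_potential z i h)"
    proof -
      define q where "q = ?p h / ?B"
      have "card ({1..n} - verts i h) = n - Suc m" "card (verts i h) = Suc m"
        using V by (auto simp: card_Diff_subset)
      then show ?thesis
        unfolding q_def[symmetric]
        by (simp add: sum.distrib tree_potential_def algebra_simps flip: sum_distrib_left del: of_nat_Suc)
    qed
    also have "\<dots> = ?p h * tree_potential z i h * (1 + z / real (Suc m))"
    proof -
      have "d * (p / (s * d)) * (s * t + z * t) = p * t * (1 + z / s)"
        if "0 < s" "0 < d" for s d p t :: real
        using that by (simp add: field_simps)
      from this[of "real (Suc m)" "real (n - Suc m)"] show ?thesis
        using Suc.prems by (simp only: of_nat_0_less_iff zero_less_Suc zero_less_diff simp_thms)
    qed
    finally show ?thesis .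
  qed
  have "(\<Sum>h\<in>histories n i (Suc m). ?p h * tree_potential z i h)
      = (\<Sum>(h, e)\<in>Sigma (histories n i m) (boundary n i). ?p (e # h) * tree_potential z i (e # h))"
    unfolding histories.simps by (subst sum.reindex[OF inj]) (simp add: case_prod_beta)
  also have "\<dots> = (\<Sum>h\<in>histories n i m. \<Sum>(u, v)\<in>boundary n i h.
      ?p ((u, v) # h) * tree_potential z i ((u, v) # h))"
    by (subst sum.Sigma[symmetric]) (auto simp: case_prod_beta simp del: greedy.simps)
  also have "\<dots> \<le> (\<Sum>h\<in>histories n i m. ?p h * tree_potential z i h * (1 + z / real (Suc m)))"
    by (rule sum_mono) (rule step)
  also have "\<dots> = (\<Sum>h\<in>histories n i m. ?p h * tree_potential z i h) * (1 + z / real (Suc m))"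
    by (simp add: sum_distrib_right)
  also have "\<dots> \<le> (\<Prod>k=1..m. 1 + z / real k) * (1 + z / real (Suc m))"
    using Suc.IH Suc.prems z by (intro mult_right_mono) auto
  finally show ?case by simp
qed

section \<open>Tree paths are the minimum-weight paths\<close>

lemma tree_path_exists:
  assumes "h \<in> histories n i m" "i \<in> {1..n}" "w \<in> verts i h"
  shows "\<exists>vs. vs \<noteq> [] \<and> distinct vs \<and> set vs \<subseteq> verts i h \<and> hd vs = i \<and> last vs = w \<and>
    length vs = Suc (tree_depth h w) \<and> weight x (list_edges vs) = tree_dist x h w"
  using assms
proof (induction arbitrary: w rule: histories_induct)
  case Nil
  then show ?case by (intro exI[of _ "[i]"]) (auto simp: weight_def)
next
  case (Cons m h u v)
  show ?case
  proof (cases "w = v")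
    case True
    obtain vs where vs: "vs \<noteq> []" "distinct vs" "set vs \<subseteq> verts i h" "hd vs = i" "last vs = u"
        "length vs = Suc (tree_depth h u)" "weight x (list_edges vs) = tree_dist x h u"
      using Cons.IH[OF Cons.hyps(2)] by blast
    have "v \<notin> set vs" using vs Cons.hyps by auto
    then show ?thesis
      using vs True by (intro exI[of _ "vs @ [v]"]) (auto simp: weight_list_edges_snoc)
  next
    case False
    then have "w \<in> verts i h" using Cons.prems by simp
    from Cons.IH[OF this] show ?thesis using False by auto
  qed
qed

text \<open>This makes the tree distance a dual certificate: it vanishes at the root and grows along
  an edge by at most the weight of the edge, so it bounds the weight of every path from below. For
  an edge between an old vertex and the newest one, greedy minimality settles one direction, and the
  other holds since old vertices lie within the radius.\<close>

lemma tree_dist_lipschitz: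
  assumes "h \<in> histories n i m" "i \<in> {1..n}" and x: "\<And>e. e \<in> complete_edges n \<Longrightarrow> 0 \<le> x e"
    and "greedy n i x h" "a \<in> verts i h" "b \<in> verts i h" "a \<noteq> b"
  shows "tree_dist x h b \<le> tree_dist x h a + x {a, b}"
  using assms(1,2,4-)
proof (induction arbitrary: a b rule: histories_induct)
  case (Cons m h u v)
  note V = verts_histories[OF Cons.hyps(1) assms(2)]
  let ?s = "tree_dist x h u + x {u, v}"
  have uv: "(u, v) \<in> boundary n i h" using Cons.hyps by (simp add: boundary_def)
  have gr: "greedy n i x h" using Cons.prems by simp
  have inner: "inner_greedy i x h" and "radius x h \<le> ?s"
    using greedy_iff[OF Cons.hyps(1) assms(2) x] gr uv by auto
  consider "a \<in> verts i h" "b \<in> verts i h" | "b = v" "a \<in> verts i h" | "a = v" "b \<in> verts i h"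
    using Cons.prems by auto
  then show ?case
  proof cases
    case 1
    then have "a \<noteq> v" "b \<noteq> v" using Cons.hyps by auto
    then show ?thesis using Cons.IH[OF gr 1] Cons.prems by simp
  next
    case 2
    then have "(a, v) \<in> boundary n i h" using Cons.hyps by (simp add: boundary_def)
    moreover have "a \<noteq> v" using 2 Cons.hyps by auto
    ultimately show ?thesis using Cons.prems(1) 2 by auto
  next
    case 3
    then have "tree_dist x h b \<le> ?s"
      using tree_dist_le_radius[OF Cons.hyps(1) assms(2) inner 3(2)] \<open>radius x h \<le> ?s\<close> by simp
    moreover have "0 \<le> x {v, b}"
      using 3 V Cons.hyps by (intro x, subst pair_in_complete_edges) auto
    moreover have "b \<noteq> v" using 3 Cons.hyps by auto
    ultimately show ?thesis using 3 by simp
  qed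
qed auto

lemma greedy_exists:
  assumes "i \<in> {1..n}" "m < n"
  shows "\<exists>h\<in>histories n i m. greedy n i x h"
  using assms(2)
proof (induction m)
  case (Suc m)
  then obtain h where h: "h \<in> histories n i m" "greedy n i x h" by auto
  let ?f = "\<lambda>p. tree_dist x h (fst p) + x {fst p, snd p}"
  have "0 < card (boundary n i h)"
    using card_boundary[OF h(1) assms(1)] Suc.prems by simp
  then have "boundary n i h \<noteq> {}" by auto
  then obtain p where p: "p \<in> boundary n i h" "\<And>q. q \<in> boundary n i h \<Longrightarrow> ?f p \<le> ?f q"
    using ex_min_if_finite[of "?f ` boundary n i h"] by (auto simp: not_less)
  have "greedy n i x (p # h)"
    using p h by (cases p) force
  moreover have "p # h \<in> histories n i (Suc m)"
    using p h by (force simp: image_iff)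
  ultimately show ?case by blast
qed auto

lemma weight_ge_tree_dist:
  assumes "h \<in> histories n i m" "i \<in> {1..n}" and x: "\<And>e. e \<in> complete_edges n \<Longrightarrow> 0 \<le> x e"
    and g: "greedy n i x h"
    and "vs \<noteq> []" "distinct vs" "set vs \<subseteq> verts i h" "hd vs = i"
  shows "tree_dist x h (last vs) \<le> weight x (list_edges vs)"
  using assms(5-)
proof (induction vs rule: rev_nonempty_induct)
  case (single v)
  then show ?case
    using tree_dist_root[OF assms(1,2)] by (simp add: weight_def)
next
  case (snoc v vs)
  then have "tree_dist x h (last vs) \<le> weight x (list_edges vs)" by simp
  moreover have "tree_dist x h v \<le> tree_dist x h (last vs) + x {last vs, v}"
    using snoc by (intro tree_dist_lipschitz[OF assms(1,2) x g]) auto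
  ultimately show ?case
    using snoc by (simp add: weight_list_edges_snoc)
qed

text \<open>The tree path and the minimum path have equal weight. Only the absence of ties turns
  this into equality of the paths, and hence of the numbers of edges.\<close>

lemma card_min_path_eq_depth:
  assumes h: "h \<in> histories n i (n - 1)" and i: "i \<in> {1..n}" and x: "\<And>e. e \<in> complete_edges n \<Longrightarrow> 0 \<le> x e"
    and g: "greedy n i x h" and j: "j \<in> {1..n}"
    and ties: "\<And>A B. A \<subseteq> complete_edges n \<Longrightarrow> B \<subseteq> complete_edges n \<Longrightarrow> A \<noteq> B \<Longrightarrow> weight x A \<noteq> weight x B"
  shows "card (min_path n x i j) = tree_depth h j"
proof -
  note V = verts_histories[OF h i]
  have V_eq: "verts i h = {1..n}"
    using V i by (intro card_subset_eq) auto
  then obtain vs where vs: "vs \<noteq> []" "distinct vs" "set vs \<subseteq> {1..n}" "hd vs = i" "last vs = j"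
      "length vs = Suc (tree_depth h j)" "weight x (list_edges vs) = tree_dist x h j"
    using tree_path_exists[OF h i, of j x] j by auto
  have vs_path: "list_edges vs \<in> paths n i j"
    using vs by (auto simp: paths_def)
  then have ne: "paths n i j \<noteq> {}" by auto
  have mp: "min_path n x i j \<in> paths n i j"
    unfolding min_path_def by (rule arg_min_if_finite(1)) (use ne in auto)
  have "\<not> weight x (list_edges vs) < weight x (min_path n x i j)"
    using arg_min_if_finite(2)[OF _ ne, of "weight x"] vs_path unfolding min_path_def by auto
  moreover obtain us where us: "min_path n x i j = list_edges us" "us \<noteq> []" "distinct us"
      "set us \<subseteq> {1..n}" "hd us = i" "last us = j"
    using mp by (auto simp: paths_def)
  then have "tree_dist x h j \<le> weight x (min_path n x i j)"
    using weight_ge_tree_dist[OF h i x g, of us] V_eq by simp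
  ultimately have "weight x (min_path n x i j) = weight x (list_edges vs)"
    using vs by simp
  then have "min_path n x i j = list_edges vs"
    using ties paths_subset[OF mp] paths_subset[OF vs_path] by blast
  then show ?thesis
    using vs by (simp add: card_list_edges)
qed

text \<open>Writing the bound as a sum over all histories with indicators avoids a measurable
  selection of the greedy history; each term can be integrated separately.\<close>

lemma sum_power_min_path_le:
  assumes i: "i \<in> {1..n}" and z: "0 \<le> z" and x: "\<And>e. e \<in> complete_edges n \<Longrightarrow> 0 \<le> x e"
    and ties: "\<And>A B. A \<subseteq> complete_edges n \<Longrightarrow> B \<subseteq> complete_edges n \<Longrightarrow> A \<noteq> B \<Longrightarrow> weight x A \<noteq> weight x B"
  shows "(\<Sum>j=1..n. z ^ card (min_path n x i j))
    \<le> (\<Sum>h\<in>histories n i (n - 1). indicator {h. greedy n i x h} h * tree_potential z i h)"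
proof -
  have "n - 1 < n" using i by auto
  then obtain h where h: "h \<in> histories n i (n - 1)" "greedy n i x h"
    using greedy_exists[OF i] by blast
  have "verts i h = {1..n}"
    using verts_histories[OF h(1) i] i by (intro card_subset_eq) auto
  then have "(\<Sum>j=1..n. z ^ card (min_path n x i j)) = tree_potential z i h"
    unfolding tree_potential_def
    by (intro sum.cong) (auto simp: card_min_path_eq_depth[OF h(1) i x h(2) _ ties])
  also have "\<dots> = indicator {h. greedy n i x h} h * tree_potential z i h"
    using h by simp
  also have "\<dots> \<le> (\<Sum>h\<in>histories n i (n - 1). indicator {h. greedy n i x h} h * tree_potential z i h)"
    using h z by (intro member_le_sum) (auto intro!: mult_nonneg_nonneg tree_potential_nonneg)
  finally show ?thesis .
qed

section \<open>The exponential moment of the maximal path length\<close>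

lemma max_path_length_attained:
  assumes "1 \<le> n"
  shows "\<exists>i\<in>{1..n}. \<exists>j\<in>{1..n}. max_path_length n x = card (min_path n x i j)"
proof -
  let ?S = "{card (min_path n x i j) | i j. i \<in> {1..n} \<and> j \<in> {1..n}}"
  have "?S = (\<lambda>(i, j). card (min_path n x i j)) ` ({1..n} \<times> {1..n})" by (auto; blast)
  then have "finite ?S" "?S \<noteq> {}" using assms by auto
  then have "Max ?S \<in> ?S" by (rule Max_in)
  then show ?thesis unfolding max_path_length_def by blast
qed

lemma card_min_path_le_max_path_length:
  assumes "i \<in> {1..n}" "j \<in> {1..n}"
  shows "card (min_path n x i j) \<le> max_path_length n x"
proof -
  let ?S = "{card (min_path n x i j) | i j. i \<in> {1..n} \<and> j \<in> {1..n}}"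
  have "?S = (\<lambda>(i, j). card (min_path n x i j)) ` ({1..n} \<times> {1..n})" by (auto; blast)
  then have "finite ?S" by simp
  then show ?thesis
    unfolding max_path_length_def by (rule Max_ge) (use assms in auto)
qed

lemma max_path_length_le:
  assumes n: "1 \<le> n"
  shows "max_path_length n x \<le> card (complete_edges n)"
proof -
  obtain i j where ij: "i \<in> {1..n}" "j \<in> {1..n}" "max_path_length n x = card (min_path n x i j)"
    using max_path_length_attained[OF n] by blast
  \<comment> \<open>The one-edge path (or the empty one for \<open>i = j\<close>) shows that there
    are paths to minimise over.\<close>
  define vs where "vs = (if i = j then [i] else [i, j])"
  have "list_edges vs \<in> paths n i j"
    unfolding paths_def using ij by (auto simp: vs_def intro!: exI[of _ vs])
  then have "min_path n x i j \<in> paths n i j"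
    unfolding min_path_def by (intro arg_min_if_finite(1)) auto
  then have "card (min_path n x i j) \<le> card (complete_edges n)"
    by (intro card_mono paths_subset) auto
  then show ?thesis using ij by simp
qed

lemma prod_one_plus_le:
  assumes "0 \<le> (z::real)" "1 \<le> n"
  shows "(\<Prod>k=1..n - 1. 1 + z / real k) \<le> exp z * real n powr z"
proof -
  have "(\<Prod>k=1..n - 1. 1 + z / real k) \<le> (\<Prod>k=1..n - 1. exp (z / real k))"
    using assms by (intro prod_mono) (auto intro: exp_ge_add_one_self)
  also have "\<dots> = exp (z * harm (n - 1))"
    by (simp add: harm_def exp_sum sum_distrib_left divide_inverse)
  also have "harm (n - 1) \<le> 1 + ln (real n)"
  proof (cases "n = 1")
    case True then show ?thesis by (simp add: harm_def)
  next
    case False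
    then obtain k where k: "n - 1 = Suc k"
      using assms by (cases "n - 1") auto
    have "harm (Suc k) - ln (Suc k) \<le> harm (Suc 0) - ln (Suc 0)"
      using decseqD[OF decseq_harm_diff_ln, of 0 k] by simp
    then have "harm (n - 1) \<le> ln (real (n - 1)) + (1::real)"
      unfolding k by (simp add: harm_def)
    also have "ln (real (n - 1)) \<le> ln (real n)" using False assms by simp
    finally show ?thesis by simp
  qed
  also have "exp (z * (1 + ln (real n))) = exp z * real n powr z"
    using assms by (simp add: powr_def ring_distribs exp_add mult.commute)
  finally show ?thesis using assms by (simp add: mult_left_mono)
qed

text \<open>The maximum is replaced by a sum over sources and targets. The targets are already
  counted by the tree potential, so only the sources cost an extra factor
  \<open>real n\<close>.\<close>

lemma (in exp_rate) expectation_power_max_path_length: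
  fixes n z
  defines "W \<equiv> edge_weights l n"
  assumes n: "1 \<le> n" and z: "0 \<le> z"
  shows "(\<integral>x. z ^ max_path_length n x \<partial>W) \<le> real n * (exp z * real n powr z)"
proof -
  interpret W: prob_space W unfolding W_def by (rule prob_space_exp_product)
  let ?f = "\<lambda>x. \<Sum>i=1..n. \<Sum>h\<in>histories n i (n - 1). indicator {x \<in> space W. greedy n i x h} x * tree_potential z i h"
  have meas: "{x \<in> space W. greedy n i x h} \<in> sets W" if "h \<in> histories n i (n - 1)" "i \<in> {1..n}" for i h
    unfolding W_def using tree_dist_measurable(4)[OF that] by measurable
  have int: "integrable W (\<lambda>x. indicator {x \<in> space W. greedy n i x h} x * tree_potential z i h)"
    if "h \<in> histories n i (n - 1)" "i \<in> {1..n}" for i h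
    using meas[OF that] by (intro integrable_mult_left integrable_real_indicator) (auto simp: less_top[symmetric])
  have intf: "integrable W ?f"
    by (intro Bochner_Integration.integrable_sum int)
  have nonneg: "AE x in W. \<forall>e\<in>complete_edges n. 0 \<le> x e"
    unfolding W_def by (rule AE_exp_product_nonneg) simp
  have ties: "AE x in W. \<forall>A\<in>Pow (complete_edges n). \<forall>B\<in>Pow (complete_edges n). A \<noteq> B \<longrightarrow> weight x A \<noteq> weight x B"
  proof (intro AE_finite_allI)
    fix A B assume "A \<in> Pow (complete_edges n)" "B \<in> Pow (complete_edges n)"
    then show "AE x in W. A \<noteq> B \<longrightarrow> weight x A \<noteq> weight x B"
      unfolding W_def weight_def using AE_exp_product_sum_neq[of "complete_edges n" A B]
      by (cases "A = B") auto
  qed auto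
  have mpl: "max_path_length n \<in> W \<rightarrow>\<^sub>M count_space UNIV"
    unfolding W_def by (rule measurable_max_path_length)
  have "(\<integral>x. z ^ max_path_length n x \<partial>W) \<le> (\<integral>x. ?f x \<partial>W)"
  proof (rule integral_mono_AE[OF _ intf])
    have "(\<lambda>x. z ^ max_path_length n x) \<in> borel_measurable W"
      using measurable_compose[OF mpl, of "\<lambda>k. z ^ k" borel] by simp
    moreover have "norm (z ^ max_path_length n x) \<le> (max 1 z) ^ card (complete_edges n)" for x
    proof -
      have "z ^ max_path_length n x \<le> max 1 z ^ max_path_length n x"
        using z by (intro power_mono) auto
      also have "\<dots> \<le> max 1 z ^ card (complete_edges n)"
        using max_path_length_le[OF n] by (intro power_increasing) auto
      finally show ?thesis using z by simp
    qed
    ultimately show "integrable W (\<lambda>x. z ^ max_path_length n x)"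
      by (intro W.integrable_const_bound) auto
    show "AE x in W. z ^ max_path_length n x \<le> ?f x"
      using nonneg ties AE_space
    proof eventually_elim
      fix x
      assume x: "\<forall>e\<in>complete_edges n. 0 \<le> x e" "x \<in> space W"
        and ties: "\<forall>A\<in>Pow (complete_edges n). \<forall>B\<in>Pow (complete_edges n). A \<noteq> B \<longrightarrow> weight x A \<noteq> weight x B"
      obtain i j where ij: "i \<in> {1..n}" "j \<in> {1..n}" "max_path_length n x = card (min_path n x i j)"
        using max_path_length_attained[OF n] by blast
      have "z ^ card (min_path n x i j) \<le> (\<Sum>j=1..n. z ^ card (min_path n x i j))"
        using ij z by (intro member_le_sum) auto
      also have "\<dots> \<le> (\<Sum>h\<in>histories n i (n - 1). indicator {h. greedy n i x h} h * tree_potential z i h)"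
        using x ties by (intro sum_power_min_path_le ij z) auto
      also have "\<dots> = (\<Sum>h\<in>histories n i (n - 1). indicator {x \<in> space W. greedy n i x h} x * tree_potential z i h)"
        using x by (intro sum.cong) (auto simp: indicator_def)
      also have "\<dots> \<le> ?f x"
        using ij z by (intro member_le_sum[of i "{1..n}"] sum_nonneg) (auto intro!: mult_nonneg_nonneg tree_potential_nonneg)
      finally show "z ^ max_path_length n x \<le> ?f x" using ij by simp
    qed
  qed
  also have "\<dots> = (\<Sum>i=1..n. \<Sum>h\<in>histories n i (n - 1). \<P>(x in W. greedy n i x h) * tree_potential z i h)"
  proof -
    have "(\<integral>x. ?f x \<partial>W) = (\<Sum>i=1..n. \<Sum>h\<in>histories n i (n - 1).
        \<integral>x. indicator {x \<in> space W. greedy n i x h} x * tree_potential z i h \<partial>W)"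
      by (subst Bochner_Integration.integral_sum)
        (intro sum.cong refl Bochner_Integration.integral_sum Bochner_Integration.integrable_sum int; assumption)+
    also have "\<dots> = (\<Sum>i=1..n. \<Sum>h\<in>histories n i (n - 1).
        \<P>(x in W. greedy n i x h) * tree_potential z i h)"
      by (intro sum.cong refl) (simp, intro disjI2 arg_cong[where f = "measure W"], blast)
    finally show ?thesis .
  qed
  also have "\<dots> \<le> (\<Sum>i=1..n. exp z * real n powr z)"
  proof (rule sum_mono)
    fix i assume "i \<in> {1..n}"
    then have "(\<Sum>h\<in>histories n i (n - 1). \<P>(x in W. greedy n i x h) * tree_potential z i h)
        \<le> (\<Prod>k=1..n - 1. 1 + z / real k)"
      unfolding W_def using z by (intro expected_tree_potential) auto
    also have "\<dots> \<le> exp z * real n powr z"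
      using z n by (rule prod_one_plus_le)
    finally show "(\<Sum>h\<in>histories n i (n - 1). \<P>(x in W. greedy n i x h) * tree_potential z i h)
        \<le> exp z * real n powr z" .
  qed
  finally show ?thesis by simp
qed

section \<open>Overlaps of light paths\<close>

definition slice :: "'a list \<Rightarrow> nat \<Rightarrow> nat \<Rightarrow> 'a list" where
  "slice xs p q = take (Suc (q - p)) (drop p xs)"

lemma length_slice [simp]: "p \<le> q \<Longrightarrow> q < length xs \<Longrightarrow> length (slice xs p q) = Suc (q - p)"
  by (simp add: slice_def)

lemma nth_slice [simp]: "q < length xs \<Longrightarrow> t \<le> q - p \<Longrightarrow> p \<le> q \<Longrightarrow> slice xs p q ! t = xs ! (p + t)"
  by (simp add: slice_def)

lemma distinct_slice: "distinct xs \<Longrightarrow> distinct (slice xs p q)"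
  by (simp add: slice_def)

lemma set_slice_subset: "set (slice xs p q) \<subseteq> set xs"
  unfolding slice_def using set_take_subset set_drop_subset by fastforce

text \<open>Interior vertices of an excursion may lie on \<open>vs\<close>; only the edges have to be new.\<close>

definition excursions :: "nat \<Rightarrow> nat list \<Rightarrow> nat list set" where
  "excursions n vs = {us. 2 \<le> length us \<and> distinct us \<and> set us \<subseteq> {1..n} \<and>
     hd us \<in> set vs \<and> last us \<in> set vs \<and> list_edges us \<inter> list_edges vs = {}}"

text \<open>A single excursion is compared with the whole budget \<open>s\<close>: a path of weight
  at most \<open>s\<close> that leaves \<open>vs\<close> and comes back would contain one that is
  too light.\<close>

definition excursions_heavy :: "nat \<Rightarrow> (nat set \<Rightarrow> real) \<Rightarrow> real \<Rightarrow> nat list \<Rightarrow> bool" where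
  "excursions_heavy n x s vs \<longleftrightarrow> (\<forall>us\<in>excursions n vs. s < weight x (list_edges us))"

lemma weight_slice:
  assumes "distinct us" "p \<le> q" "q < length us"
  shows "weight x (list_edges (slice us p q)) = (\<Sum>t\<in>{p..<q}. x {us ! t, us ! Suc t})"
proof -
  have "weight x (list_edges (slice us p q)) = (\<Sum>t<q - p. x {us ! (p + t), us ! Suc (p + t)})"
    using assms by (simp add: weight_list_edges distinct_slice)
  also have "\<dots> = (\<Sum>t\<in>{p..<q}. x {us ! t, us ! Suc t})"
    using assms by (intro sum.reindex_bij_witness[of _ "\<lambda>t. t - p" "\<lambda>t. p + t"]) auto
  finally show ?thesis .
qed

text \<open>The part of \<open>us\<close> between two consecutive visits to \<open>vs\<close> is
  either a single edge of \<open>vs\<close> or an excursion. As a subpath of \<open>us\<close> it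
  weighs at most \<open>s\<close>, which rules out the excursion.\<close>

lemma consecutive_visits:
  assumes us: "distinct us" "set us \<subseteq> {1..n}" and x: "\<And>e. e \<in> complete_edges n \<Longrightarrow> 0 \<le> x e"
    and w: "weight x (list_edges us) \<le> s" and heavy: "excursions_heavy n x s vs"
    and pq: "p < q" "q < length us" "us ! p \<in> set vs" "us ! q \<in> set vs"
    and between: "\<And>t. p < t \<Longrightarrow> t < q \<Longrightarrow> us ! t \<notin> set vs"
  shows "q = Suc p \<and> {us ! p, us ! q} \<in> list_edges vs"
proof (rule ccontr)
  assume contra: "\<not> ?thesis"
  let ?e = "slice us p q"
  have len: "length ?e = Suc (q - p)" using pq by simp
  have ends: "hd ?e = us ! p" "last ?e = us ! q"
    using pq len by (auto simp: hd_conv_nth last_conv_nth simp flip: length_greater_0_conv)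
  have "list_edges ?e \<inter> list_edges vs = {}"
  proof (rule ccontr)
    assume "list_edges ?e \<inter> list_edges vs \<noteq> {}"
    then obtain t where t: "t < q - p" "{us ! (p + t), us ! Suc (p + t)} \<in> list_edges vs"
      using pq by (auto simp: list_edges_conv_image[of ?e])
    then have "us ! (p + t) \<in> set vs" "us ! Suc (p + t) \<in> set vs"
      using list_edges_Union by blast+
    with between[of "p + t"] between[of "Suc (p + t)"] t have "t = 0" "q = Suc p"
      by (cases "t = 0"; force)+
    with t contra show False by simp
  qed
  then have "?e \<in> excursions n vs"
    using us pq len ends set_slice_subset[of us p q] by (auto simp: excursions_def distinct_slice)
  then have "s < weight x (list_edges ?e)"
    using heavy by (simp add: excursions_heavy_def)
  also have "\<dots> \<le> weight x (list_edges us)"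
  proof -
    have "(\<Sum>t\<in>{p..<q}. x {us ! t, us ! Suc t}) \<le> (\<Sum>t<length us - 1. x {us ! t, us ! Suc t})"
    proof (rule sum_mono2)
      fix t assume "t \<in> {..<length us - 1} - {p..<q}"
      then have "{us ! t, us ! Suc t} \<in> list_edges us"
        by (auto simp: list_edges_conv_image)
      then show "0 \<le> x {us ! t, us ! Suc t}"
        using list_edges_subset[OF us] x by blast
    qed (use pq in auto)
    then show ?thesis
      using us pq by (simp add: weight_slice weight_list_edges)
  qed
  finally show False using w by simp
qed

text \<open>Splitting at an intermediate visit reduces the claim to consecutive visits, so between
  any two visits \<open>us\<close> runs along edges of \<open>vs\<close> only.\<close>

lemma visits_follow_path:
  assumes us: "distinct us" "set us \<subseteq> {1..n}" and x: "\<And>e. e \<in> complete_edges n \<Longrightarrow> 0 \<le> x e"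
    and w: "weight x (list_edges us) \<le> s" and heavy: "excursions_heavy n x s vs"
    and pq: "p < q" "q < length us" "us ! p \<in> set vs" "us ! q \<in> set vs"
    and t: "p \<le> t" "t < q"
  shows "{us ! t, us ! Suc t} \<in> list_edges vs"
  using pq t
proof (induction "q - p" arbitrary: p q rule: less_induct)
  case less
  show ?case
  proof (cases "\<exists>m. p < m \<and> m < q \<and> us ! m \<in> set vs")
    case True
    then obtain m where m: "p < m" "m < q" "us ! m \<in> set vs" by blast
    show ?thesis
    proof (cases "t < m")
      case True
      show ?thesis by (rule less.hyps[of m p]) (use m less.prems True in auto)
    next
      case False
      show ?thesis by (rule less.hyps[of q m]) (use m less.prems False in auto)
    qed
  next
    case False
    then have "q = Suc p \<and> {us ! p, us ! q} \<in> list_edges vs"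
      using less.prems by (intro consecutive_visits[OF us x w heavy]) auto
    then show ?thesis using less.prems by (auto simp: le_less_Suc_eq)
  qed
qed

text \<open>A walk on the integers with unit steps that never repeats a position cannot turn
  around.\<close>

lemma unit_steps_monotone:
  fixes f :: "nat \<Rightarrow> nat"
  assumes "inj_on f {..r}" "\<And>t. t < r \<Longrightarrow> f (Suc t) = Suc (f t) \<or> f t = Suc (f (Suc t))"
  shows "(\<forall>t\<le>r. f t = f 0 + t) \<or> (\<forall>t\<le>r. f t + t = f 0)"
  using assms
proof (induction r)
  case (Suc r)
  have inj: "inj_on f {..r}" using Suc.prems(1) by (rule inj_on_subset) auto
  have IH: "(\<forall>t\<le>r. f t = f 0 + t) \<or> (\<forall>t\<le>r. f t + t = f 0)"
    using Suc.IH[OF inj] Suc.prems(2) by simp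
  have step: "f (Suc r) = Suc (f r) \<or> f r = Suc (f (Suc r))" using Suc.prems(2) by simp
  show ?case
  proof (cases r)
    case 0
    then show ?thesis using step by (auto simp: le_Suc_eq)
  next
    case (Suc r')
    have ne: "f (Suc r) \<noteq> f r'"
      using inj_onD[OF Suc.prems(1), of "Suc r" r'] Suc by auto
    from IH show ?thesis
    proof
      assume A: "\<forall>t\<le>r. f t = f 0 + t"
      have "f r' = f 0 + r'" "f r = f 0 + r" using A[rule_format, of r'] A[rule_format, of r] Suc by linarith+
      with step ne Suc have "f (Suc r) = f 0 + Suc r" by linarith
      then have "f t = f 0 + t" if "t \<le> Suc r" for t
        using A[rule_format, of t] that le_Suc_eq by metis
      then show ?thesis by blast
    next
      assume A: "\<forall>t\<le>r. f t + t = f 0"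
      have "f r' + r' = f 0" "f r + r = f 0" using A[rule_format, of r'] A[rule_format, of r] Suc by linarith+
      with step ne Suc have "f (Suc r) + Suc r = f 0" by linarith
      then have "f t + t = f 0" if "t \<le> Suc r" for t
        using A[rule_format, of t] that le_Suc_eq by metis
      then show ?thesis by blast
    qed
  qed
qed auto

text \<open>Edges are undirected, so another path may traverse the common segment in either
  direction; \<open>d\<close> records which.\<close>

definition path_segment :: "nat list \<Rightarrow> nat \<Rightarrow> nat \<Rightarrow> bool \<Rightarrow> nat list" where
  "path_segment vs a r d = (if d then slice vs a (a + r) else rev (slice vs a (a + r)))"

lemma length_path_segment [simp]: "a + r < length vs \<Longrightarrow> length (path_segment vs a r d) = Suc r"
  by (simp add: path_segment_def)

lemma nth_path_segment:
  "a + r < length vs \<Longrightarrow> t \<le> r \<Longrightarrow>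
    path_segment vs a r d ! t = vs ! (if d then a + t else a + (r - t))"
  by (simp add: path_segment_def rev_nth)

text \<open>The common segment starts at position \<open>a\<close> in \<open>vs\<close> and at
  position \<open>b\<close> in the other path, and has \<open>r\<close> edges. The lengths
  \<open>b\<close>, \<open>Suc r\<close> and \<open>k - r - b\<close> add up to \<open>Suc k\<close>
  vertices, where \<open>b + r \<le> k\<close> keeps the subtraction from truncating. The other
  vertices avoid \<open>vs\<close> altogether, so nothing beyond the segment is shared.\<close>

definition overlapping :: "nat \<Rightarrow> nat list \<Rightarrow> nat \<Rightarrow> nat \<Rightarrow> nat \<Rightarrow> nat \<Rightarrow> bool \<Rightarrow> nat list set" where
  "overlapping n vs k a b r d = {ps @ path_segment vs a r d @ qs | ps qs.
     length ps = b \<and> length qs = k - r - b \<and> b + r \<le> k \<and>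
     set ps \<subseteq> {1..n} - set vs \<and> set qs \<subseteq> {1..n} - set vs \<and>
     distinct (ps @ path_segment vs a r d @ qs)}"

text \<open>Between its first and its last visit \<open>us\<close> follows edges of
  \<open>vs\<close>. Its positions in \<open>vs\<close> therefore form a repetition-free walk with
  unit steps, which must be monotone. The conclusion also places \<open>p\<close> and
  \<open>q\<close> inside the segment; this is what later identifies a minimum path with
  \<open>vs\<close> itself.\<close>

lemma intersection_is_segment:
  assumes vs: "distinct vs" and us: "distinct us" "set us \<subseteq> {1..n}" "length us = Suc k"
    and x: "\<And>e. e \<in> complete_edges n \<Longrightarrow> 0 \<le> x e"
    and w: "weight x (list_edges us) \<le> s" and heavy: "excursions_heavy n x s vs"
    and pq: "p < q" "q \<le> k" "us ! p \<in> set vs" "us ! q \<in> set vs"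
  shows "\<exists>a b r d. 1 \<le> r \<and> a + r < length vs \<and> b \<le> p \<and> q \<le> b + r \<and> us \<in> overlapping n vs k a b r d"
proof -
  define J where "J = {t. t \<le> k \<and> us ! t \<in> set vs}"
  have J: "finite J" "p \<in> J" "q \<in> J" using pq by (auto simp: J_def)
  define b e where "b = Min J" and "e = Max J"
  have be: "b \<in> J" "e \<in> J" "b \<le> p" "q \<le> e" "\<And>t. t \<in> J \<Longrightarrow> b \<le> t \<and> t \<le> e"
    using J unfolding b_def e_def by (auto intro: Min_in Max_in)
  then have "b < e" using pq(1) by linarith
  have "e \<le> k" using be(2) by (simp add: J_def)
  define r where "r = e - b"
  have r: "1 \<le> r" "b + r = e" "b + r \<le> k" using \<open>b < e\<close> \<open>e \<le> k\<close> by (auto simp: r_def)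
  have edge: "{us ! (b + t), us ! Suc (b + t)} \<in> list_edges vs" if "t < r" for t
    using that be r us \<open>b < e\<close> \<open>e \<le> k\<close>
    by (intro visits_follow_path[OF us(1,2) x w heavy, of b e]) (auto simp: J_def)
  have mem: "us ! (b + t) \<in> set vs" if "t \<le> r" for t
  proof (cases "t < r")
    case True then show ?thesis using edge list_edges_Union by blast
  next
    case False then show ?thesis using that r be by (auto simp: J_def)
  qed
  \<comment> \<open>\<open>f t\<close> is the position in \<open>vs\<close> of the vertex visited
    \<open>t\<close> steps after the first visit.\<close>
  define f where "f t = (THE j. j < length vs \<and> vs ! j = us ! (b + t))" for t
  have f: "f t < length vs" "vs ! f t = us ! (b + t)" if "t \<le> r" for t
    using theI'[OF distinct_Ex1[OF vs mem[OF that]]] by (auto simp: f_def)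
  have inj: "inj_on f {..r}"
  proof (rule inj_onI)
    fix t t' assume tt: "t \<in> {..r}" "t' \<in> {..r}" "f t = f t'"
    then have "us ! (b + t) = us ! (b + t')" using f by (metis atMost_iff)
    then show "t = t'"
      using tt us r by (simp add: nth_eq_iff_index_eq)
  qed
  have steps: "f (Suc t) = Suc (f t) \<or> f t = Suc (f (Suc t))" if "t < r" for t
  proof -
    obtain j where j: "Suc j < length vs" "{us ! (b + t), us ! Suc (b + t)} = {vs ! j, vs ! Suc j}"
      using edge[OF \<open>t < r\<close>] by (auto simp: list_edges_def)
    have ft: "f t < length vs" "vs ! f t = us ! (b + t)" "f (Suc t) < length vs" "vs ! f (Suc t) = us ! Suc (b + t)"
      using f[of t] f[of "Suc t"] that by auto
    from j(2) have "(vs ! f t = vs ! j \<and> vs ! f (Suc t) = vs ! Suc j) \<or> (vs ! f t = vs ! Suc j \<and> vs ! f (Suc t) = vs ! j)"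
      by (simp add: ft doubleton_eq_iff)
    then show ?thesis
      using ft j vs by (auto simp: nth_eq_iff_index_eq)
  qed
  obtain a d where ad: "a + r < length vs" "path_segment vs a r d = slice us b (b + r)"
  proof -
    consider "\<forall>t\<le>r. f t = f 0 + t" | "\<forall>t\<le>r. f t + t = f 0"
      using unit_steps_monotone[OF inj steps] by blast
    then show ?thesis
    proof cases
      case 1
      have ft: "vs ! (f 0 + t) = us ! (b + t) \<and> f 0 + t < length vs" if "t \<le> r" for t
        using f[OF that] 1[rule_format, OF that] by argo
      then have len: "f 0 + r < length vs" by blast
      have "path_segment vs (f 0) r True = slice us b (b + r)"
      proof (rule nth_equalityI)
        fix t assume "t < length (path_segment vs (f 0) r True)"
        then have "t \<le> r" using len by simp
        then show "path_segment vs (f 0) r True ! t = slice us b (b + r) ! t"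
          using ft[of t] len r us by (simp add: nth_path_segment)
      qed (use len r us in simp)
      then show ?thesis using that len by blast
    next
      case 2
      then have r0: "f r + r = f 0" by simp
      then have len: "f r + r < length vs" using f(1)[of 0] by simp
      have "path_segment vs (f r) r False = slice us b (b + r)"
      proof (rule nth_equalityI)
        fix t assume "t < length (path_segment vs (f r) r False)"
        then have t: "t \<le> r" using len by simp
        then have "f r + (r - t) = f t" using 2[rule_format, OF t] r0 by simp
        then show "path_segment vs (f r) r False ! t = slice us b (b + r) ! t"
          using f[of t] t len r us by (simp add: nth_path_segment)
      qed (use len r us in simp)
      then show ?thesis using that len by blast
    qed
  qed
  have split: "us = take b us @ slice us b (b + r) @ drop (Suc (b + r)) us"
  proof -
    have "slice us b (b + r) @ drop (Suc (b + r)) us = drop b us"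
      unfolding slice_def using append_take_drop_id[of "Suc r" "drop b us"] by (simp add: add.commute)
    then show ?thesis by simp
  qed
  have notin: "us ! t \<notin> set vs" if "t \<le> k" "t < b \<or> b + r < t" for t
    using be(5)[of t] that r by (auto simp: J_def)
  have "us \<in> overlapping n vs k a b r d"
    unfolding overlapping_def
  proof (intro CollectI exI conjI)
    show "us = take b us @ path_segment vs a r d @ drop (Suc (b + r)) us"
      using split ad by simp
    then show "distinct (take b us @ path_segment vs a r d @ drop (Suc (b + r)) us)"
      using us by simp
    show "set (take b us) \<subseteq> {1..n} - set vs"
    proof
      fix v assume v: "v \<in> set (take b us)"
      then obtain t where "t < b" "v = us ! t" using us r by (auto simp: in_set_conv_nth)
      then show "v \<in> {1..n} - set vs"
        using notin[of t] r subsetD[OF us(2) in_set_takeD[OF v]] by simp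
    qed
    show "set (drop (Suc (b + r)) us) \<subseteq> {1..n} - set vs"
    proof
      fix v assume v: "v \<in> set (drop (Suc (b + r)) us)"
      then obtain t where "t < length us - Suc (b + r)" "v = us ! (Suc (b + r) + t)"
        by (auto simp: in_set_conv_nth)
      then show "v \<in> {1..n} - set vs"
        using notin[of "Suc (b + r) + t"] us(3) subsetD[OF us(2) in_set_dropD[OF v]] by simp
    qed
  qed (use us r in auto)
  then show ?thesis using ad r be by blast
qed

text \<open>Both paths contain the segment, so \<open>us\<close> has \<open>k - r\<close> edges that
  are independent of \<open>vs\<close>. Splitting the weight accordingly turns a lower bound on the
  segment into an upper bound on the new edges.\<close>

lemma overlapping_weight:
  assumes vs: "distinct vs" "length vs = Suc k" and ar: "a + r \<le> k"
    and us: "us \<in> overlapping n vs k a b r d"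
  shows "card (list_edges us - list_edges vs) = k - r"
    and "weight x (list_edges us)
      = weight x (list_edges us - list_edges vs) + (\<Sum>j\<in>{a..<a + r}. x {vs ! j, vs ! Suc j})"
proof -
  obtain ps qs where p: "us = ps @ path_segment vs a r d @ qs" "length ps = b" "length qs = k - r - b"
      "b + r \<le> k" "set ps \<subseteq> {1..n} - set vs" "set qs \<subseteq> {1..n} - set vs" "distinct us"
    using us by (auto simp: overlapping_def)
  have len: "length us = Suc k" "length (path_segment vs a r d) = Suc r"
    using p ar vs by auto
  let ?e = "\<lambda>j. {us ! j, us ! Suc j}"
  have inj: "inj_on ?e {..<k}" using inj_on_nth_edge[OF p(7)] len by simp
  have edges: "list_edges us = ?e ` {..<k}" using len by (simp add: list_edges_conv_image)
  have mid: "us ! (b + t) = vs ! (if d then a + t else a + (r - t))" if "t \<le> r" for t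
    using that len p ar vs by (simp add: nth_append nth_path_segment)
  have left: "us ! j \<notin> set vs" if "j < b" for j
    using that p(1,2) subsetD[OF p(5) nth_mem[of j ps]] by (auto simp: nth_append)
  have right: "us ! j \<notin> set vs" if "b + r < j" "j \<le> k" for j
  proof -
    have "j - b - Suc r < length qs" using that p by auto
    moreover have "us ! j = qs ! (j - b - Suc r)"
      using that p len by (auto simp: nth_append)
    ultimately show ?thesis using subsetD[OF p(6) nth_mem[of "j - b - Suc r" qs]] by auto
  qed
  \<comment> \<open>An edge of \<open>vs\<close> is indexed by its lower end, hence the additional
    \<open>Suc\<close> when the segment is traversed backwards.\<close>
  define \<tau> where "\<tau> t = (if d then a + t else a + (r - Suc t))" for t
  have mid_edge: "?e (b + t) = {vs ! \<tau> t, vs ! Suc (\<tau> t)}" "\<tau> t < a + r" if "t < r" for t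
  proof -
    have "Suc (a + (r - Suc t)) = a + (r - t)" using that by auto
    then show "?e (b + t) = {vs ! \<tau> t, vs ! Suc (\<tau> t)}"
      using mid[of t] mid[of "Suc t"] that by (auto simp: \<tau>_def)
    show "\<tau> t < a + r" using that by (auto simp: \<tau>_def)
  qed
  have outer: "?e j \<notin> list_edges vs" if "j < k" "j < b \<or> b + r \<le> j" for j
    using left[of j] right[of "Suc j"] that list_edges_Union[of "?e j" vs] by auto
  have inner: "?e j \<in> list_edges vs" if j: "b \<le> j" "j < b + r" for j
  proof -
    have "?e (b + (j - b)) = {vs ! \<tau> (j - b), vs ! Suc (\<tau> (j - b))}" "\<tau> (j - b) < a + r"
      using mid_edge[of "j - b"] j by auto
    then show ?thesis
      using j ar vs by (auto simp: list_edges_def intro!: exI[of _ "\<tau> (j - b)"])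
  qed
  have diff: "list_edges us - list_edges vs = ?e ` ({..<k} - {b..<b + r})"
    unfolding edges using outer inner by (auto simp: not_less)
  have sub: "{b..<b + r} \<subseteq> {..<k}" using p by auto
  have inj': "inj_on ?e ({..<k} - {b..<b + r})" using inj by (rule inj_on_subset) simp
  have "card ({..<k} - {b..<b + r}) = k - r" using sub by (simp add: card_Diff_subset)
  then show "card (list_edges us - list_edges vs) = k - r"
    unfolding diff by (simp only: card_image[OF inj'])
  have "weight x (list_edges us) = (\<Sum>j<k. x (?e j))"
    using weight_list_edges[OF p(7)] len by simp
  also have "\<dots> = (\<Sum>j\<in>{..<k} - {b..<b + r}. x (?e j)) + (\<Sum>j\<in>{b..<b + r}. x (?e j))"
    by (rule sum.subset_diff[OF sub]) simp
  also have "(\<Sum>j\<in>{..<k} - {b..<b + r}. x (?e j)) = weight x (list_edges us - list_edges vs)"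
    unfolding diff weight_def by (simp only: sum.reindex[OF inj'] o_def)
  also have "(\<Sum>j\<in>{b..<b + r}. x (?e j)) = (\<Sum>t<r. x (?e (b + t)))"
    by (intro sum.reindex_bij_witness[of _ "\<lambda>t. b + t" "\<lambda>t. t - b"]) auto
  also have "\<dots> = (\<Sum>t<r. x {vs ! \<tau> t, vs ! Suc (\<tau> t)})"
    by (intro sum.cong refl arg_cong[where f = x] mid_edge) auto
  also have "\<dots> = (\<Sum>t<r. x {vs ! (a + t), vs ! Suc (a + t)})"
    using sum.nat_diff_reindex[of "\<lambda>t. x {vs ! (a + t), vs ! Suc (a + t)}" r]
    by (cases d) (simp_all add: \<tau>_def)
  also have "\<dots> = (\<Sum>j\<in>{a..<a + r}. x {vs ! j, vs ! Suc j})"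
    by (intro sum.reindex_bij_witness[of _ "\<lambda>j. j - a" "\<lambda>t. a + t"]) auto
  finally show "weight x (list_edges us)
      = weight x (list_edges us - list_edges vs) + (\<Sum>j\<in>{a..<a + r}. x {vs ! j, vs ! Suc j})" .
qed

text \<open>The segment fixes \<open>Suc r\<close> of the \<open>Suc k\<close> vertices. The
  remaining \<open>k - r\<close> free vertices match the \<open>k - r\<close> new edges, so at rate
  1/n the two powers cancel.\<close>

lemma card_overlapping:
  assumes "b + r \<le> k"
  shows "finite (overlapping n vs k a b r d)" "card (overlapping n vs k a b r d) \<le> n ^ (k - r)"
proof -
  let ?L = "\<lambda>m. {ps. set ps \<subseteq> {1..n} \<and> length ps = m}"
  let ?f = "\<lambda>(ps, qs). ps @ path_segment vs a r d @ qs"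
  have sub: "overlapping n vs k a b r d \<subseteq> ?f ` (?L b \<times> ?L (k - r - b))"
    by (auto simp: overlapping_def image_iff)
  have fin: "finite (?L m)" for m by (rule finite_lists_length_eq) simp
  show "finite (overlapping n vs k a b r d)"
    by (rule finite_subset[OF sub]) (use fin in auto)
  have "card (overlapping n vs k a b r d) \<le> card (?f ` (?L b \<times> ?L (k - r - b)))"
    by (rule card_mono[OF _ sub]) (use fin in auto)
  also have "\<dots> \<le> card (?L b \<times> ?L (k - r - b))"
    by (rule card_image_le) (use fin in auto)
  also have "\<dots> = n ^ b * n ^ (k - r - b)"
    by (simp add: card_cartesian_product card_lists_length_eq)
  also have "\<dots> = n ^ (k - r)"
    using assms by (simp flip: power_add)
  finally show "card (overlapping n vs k a b r d) \<le> n ^ (k - r)" .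
qed

text \<open>The minimum path between the ends of \<open>vs\<close> also weighs at most
  \<open>s\<close>, so it meets \<open>vs\<close> in one segment. Its own first and last vertices
  are visits, hence it is entirely a segment of \<open>vs\<close>, and having the same ends it has
  all \<open>k\<close> edges.\<close>

lemma max_path_length_ge:
  assumes vs: "distinct vs" "set vs \<subseteq> {1..n}" "length vs = Suc k" "1 \<le> k"
    and x: "\<And>e. e \<in> complete_edges n \<Longrightarrow> 0 \<le> x e"
    and w: "weight x (list_edges vs) \<le> s" and heavy: "excursions_heavy n x s vs"
  shows "k \<le> max_path_length n x"
proof -
  define i j where "i = hd vs" and "j = last vs"
  have ne: "vs \<noteq> []" using vs by auto
  have ij: "i \<in> {1..n}" "j \<in> {1..n}"
    unfolding i_def j_def
    by (fact subsetD[OF vs(2) hd_in_set[OF ne]], fact subsetD[OF vs(2) last_in_set[OF ne]])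
  have path: "list_edges vs \<in> paths n i j"
    unfolding paths_def i_def j_def using vs ne by blast
  then have pne: "paths n i j \<noteq> {}" by auto
  have "min_path n x i j \<in> paths n i j"
    unfolding min_path_def by (rule arg_min_if_finite(1)) (use pne in auto)
  then obtain us where us: "min_path n x i j = list_edges us" "us \<noteq> []" "distinct us"
      "set us \<subseteq> {1..n}" "hd us = i" "last us = j"
    by (auto simp: paths_def)
  have "\<not> weight x (list_edges vs) < weight x (min_path n x i j)"
    using arg_min_if_finite(2)[OF _ pne, of "weight x"] path unfolding min_path_def by auto
  then have wus: "weight x (list_edges us) \<le> s" using w us by simp
  define m where "m = length us - 1"
  have m: "length us = Suc m" using us by (simp add: m_def)
  have ends: "us ! 0 = vs ! 0" "us ! m = vs ! k"
    using us ne vs m by (auto simp: i_def j_def hd_conv_nth last_conv_nth)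
  have "vs ! 0 \<noteq> vs ! k" using vs by (simp add: nth_eq_iff_index_eq)
  then have "0 < m" using ends by (cases m) auto
  have "\<exists>a b r d. 1 \<le> r \<and> a + r < length vs \<and> b \<le> 0 \<and> m \<le> b + r \<and> us \<in> overlapping n vs m a b r d"
    by (rule intersection_is_segment[OF vs(1) us(3,4) m x wus heavy]) (use \<open>0 < m\<close> ends vs in auto)
  then obtain a r d where o: "1 \<le> r" "a + r < length vs" "m \<le> r" "us \<in> overlapping n vs m a 0 r d"
    by auto
  then have "m = r" and seg: "us = path_segment vs a r d"
    by (auto simp: overlapping_def)
  have ends': "path_segment vs a r d ! 0 = vs ! 0" "path_segment vs a r d ! r = vs ! k"
    using ends unfolding seg \<open>m = r\<close> by blast+
  have "r = k"
  proof (cases d)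
    case True
    then have "vs ! a = vs ! 0" "vs ! (a + r) = vs ! k"
      using ends' o(2) by (simp_all add: nth_path_segment)
    then show ?thesis
      using vs o(2) by (simp add: nth_eq_iff_index_eq)
  next
    case False
    \<comment> \<open>A reversed segment would start at index 0 of \<open>vs\<close>, forcing
      \<open>a + r = 0\<close> against \<open>1 \<le> r\<close>.\<close>
    then have "vs ! (a + r) = vs ! 0"
      using ends' o(2) by (simp add: nth_path_segment)
    then show ?thesis
      using vs o(1,2) by (simp add: nth_eq_iff_index_eq)
  qed
  then have "card (min_path n x i j) = k"
    using us m \<open>m = r\<close> by (simp add: card_list_edges)
  then show ?thesis
    using card_min_path_le_max_path_length[OF ij, of x] by simp
qed

section \<open>Probabilities of light paths\<close>

lemma alpha_star: "0 < alpha_star" "alpha_star * ln alpha_star = 1 + alpha_star"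
proof -
  have "alpha_star > 0 \<and> alpha_star * ln alpha_star - alpha_star = 1"
    unfolding alpha_star_def by (rule theI'[OF alpha_star_ex1])
  then show "0 < alpha_star" "alpha_star * ln alpha_star = 1 + alpha_star" by auto
qed

lemma alpha_star_bounds: "1 < alpha_star" "alpha_star \<le> 4"
proof -
  show "1 < alpha_star"
  proof (rule ccontr)
    assume "\<not> 1 < alpha_star"
    then have "alpha_star * ln alpha_star \<le> 0"
      using alpha_star(1) by (intro mult_nonneg_nonpos) auto
    then show False using alpha_star by linarith
  qed
  show "alpha_star \<le> 4"
  proof (rule ccontr)
    assume *: "\<not> alpha_star \<le> 4"
    have "ln (4::real) = 2 * ln 2" using ln_realpow[of 2 2] by simp
    moreover have "2/3 \<le> ln (2::real)" by (rule ln2_ge_two_thirds)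
    \<comment> \<open>The defining equation reads \<open>ln a = (1 + a) / a\<close>, and 5/4 is the
      right-hand side at 4.\<close>
    ultimately have "5/4 \<le> ln (4::real)" by linarith
    also have "ln 4 \<le> ln alpha_star" using * by simp
    finally have "alpha_star * (5/4) \<le> alpha_star * ln alpha_star"
      using alpha_star(1) by (intro mult_left_mono) auto
    then show False using * alpha_star(2) by linarith
  qed
qed

lemma exp_ln_alpha_star: "exp (alpha_star * (ln alpha_star / alpha_star)) = alpha_star"
  using alpha_star(1) by simp

definition segment_weight :: "(nat set \<Rightarrow> real) \<Rightarrow> nat list \<Rightarrow> nat \<Rightarrow> nat \<Rightarrow> real" where
  "segment_weight x vs a r = (\<Sum>j\<in>{a..<a + r}. x {vs ! j, vs ! Suc j})"

text \<open>For positive \<open>k\<close> every path is listed twice, once per orientation. In the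
  second moment the list itself and its reversal are overlaps with \<open>r = k\<close>, so they
  need no separate treatment.\<close>

definition vertex_lists :: "nat \<Rightarrow> nat \<Rightarrow> nat list set" where
  "vertex_lists n k = {vs. distinct vs \<and> set vs \<subseteq> {1..n} \<and> length vs = Suc k}"

text \<open>For every segment of a balanced path, the weight outside the segment is at most a linear barrier.
  The slope \<open>ln \<alpha> / \<alpha>\<close> exceeds the mean slope \<open>1 / \<alpha>\<close>, so the barrier is rarely crossed, yet it is small
  enough that the expected number of other light paths sharing a given segment stays polylogarithmic.\<close>

definition balanced :: "nat \<Rightarrow> real \<Rightarrow> real \<Rightarrow> (nat set \<Rightarrow> real) \<Rightarrow> nat list \<Rightarrow> bool" where
  "balanced k s c x vs \<longleftrightarrow> s - c \<le> weight x (list_edges vs) \<and> weight x (list_edges vs) \<le> s \<and>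
     (\<forall>(a, r)\<in>{..k} \<times> {1..k}. a + r \<le> k \<longrightarrow> weight x (list_edges vs) - segment_weight x vs a r
        \<le> real (k - r) * (ln alpha_star / alpha_star) + c)"

lemma finite_vertex_lists [simp]: "finite (vertex_lists n k)"
proof (rule finite_subset)
  show "vertex_lists n k \<subseteq> {vs. set vs \<subseteq> {1..n} \<and> length vs = Suc k}"
    by (auto simp: vertex_lists_def)
qed (rule finite_lists_length_eq, simp)

lemma vertex_listsD:
  assumes "vs \<in> vertex_lists n k"
  shows "distinct vs" "set vs \<subseteq> {1..n}" "length vs = Suc k" "list_edges vs \<subseteq> complete_edges n"
    "card (list_edges vs) = k"
  using assms list_edges_subset[of vs n] by (auto simp: vertex_lists_def card_list_edges)

lemma segment_edges:
  assumes "vs \<in> vertex_lists n k" "a + r \<le> k"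
  defines "S \<equiv> (\<lambda>j. {vs ! j, vs ! Suc j}) ` {a..<a + r}"
  shows "S \<subseteq> list_edges vs" "card S = r" "segment_weight x vs a r = weight x S"
proof -
  note v = vertex_listsD[OF assms(1)]
  have sub: "{a..<a + r} \<subseteq> {..<length vs - 1}" using assms(2) v by auto
  show "S \<subseteq> list_edges vs"
    unfolding S_def list_edges_conv_image by (rule image_mono[OF sub])
  have inj: "inj_on (\<lambda>j. {vs ! j, vs ! Suc j}) {a..<a + r}"
    using inj_on_nth_edge[OF v(1)] sub by (rule inj_on_subset)
  show "card S = r" unfolding S_def by (simp add: card_image[OF inj])
  show "segment_weight x vs a r = weight x S"
    unfolding S_def segment_weight_def weight_def by (simp add: sum.reindex[OF inj])
qed

lemma measurable_segment_weight:
  assumes "vs \<in> vertex_lists n k" "a + r \<le> k"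
  shows "(\<lambda>x. segment_weight x vs a r) \<in> borel_measurable (edge_weights l n)"
  unfolding segment_edges(3)[OF assms]
  using segment_edges(1)[OF assms] vertex_listsD(4)[OF assms(1)] by (intro measurable_weight) blast

lemma measurable_weight_le:
  assumes "A \<subseteq> complete_edges n"
  shows "Measurable.pred (edge_weights l n) (\<lambda>x. weight x A \<le> s)"
  unfolding pred_def by (intro borel_measurable_le measurable_weight assms borel_measurable_const)

lemma measurable_balanced:
  assumes vs: "vs \<in> vertex_lists n k"
  shows "Measurable.pred (edge_weights l n) (\<lambda>x. balanced k s c x vs)"
proof -
  let ?M = "edge_weights l n"
  have p: "Measurable.pred ?M (\<lambda>x. fst p + snd p \<le> k \<longrightarrow> weight x (list_edges vs) - segment_weight x vs (fst p) (snd p)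
      \<le> real (k - snd p) * (ln alpha_star / alpha_star) + c)" for p
  proof (cases "fst p + snd p \<le> k")
    case True
    then show ?thesis
      unfolding pred_def
      by (simp del: sets_PiM_cong, intro borel_measurable_le borel_measurable_diff measurable_weight
        vertex_listsD(4)[OF vs] measurable_segment_weight[OF vs] borel_measurable_const)
  qed simp
  have q: "Measurable.pred ?M (\<lambda>x. s - c \<le> weight x (list_edges vs))"
    unfolding pred_def by (intro borel_measurable_le measurable_weight vertex_listsD(4)[OF vs] borel_measurable_const)
  define R where "R x \<longleftrightarrow> (\<forall>p\<in>{..k} \<times> {1..k}. fst p + snd p \<le> k \<longrightarrow>
      weight x (list_edges vs) - segment_weight x vs (fst p) (snd p)
        \<le> real (k - snd p) * (ln alpha_star / alpha_star) + c)" for x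
  have "Measurable.pred ?M R"
    unfolding R_def[abs_def] by (rule pred_intros_finite(3), simp, rule p)
  moreover have "(\<lambda>x. balanced k s c x vs) = (\<lambda>x. s - c \<le> weight x (list_edges vs) \<and>
      (weight x (list_edges vs) \<le> s \<and> R x))"
    unfolding balanced_def R_def case_prod_beta by blast
  ultimately show ?thesis
    using q measurable_weight_le[OF vertex_listsD(4)[OF vs]] by (simp only: pred_intros_logic(3))
qed

lemma depends_on_weight: "A \<subseteq> B \<Longrightarrow> depends_on B (\<lambda>x. weight x A \<le> s)"
  unfolding depends_on_def weight_def by (metis (no_types, lifting) subsetD sum.cong)

lemma depends_on_balanced:
  assumes vs: "vs \<in> vertex_lists n k"
  shows "depends_on (list_edges vs) (\<lambda>x. balanced k s c x vs)"
  unfolding depends_on_def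
proof (intro allI impI)
  fix x y :: "nat set \<Rightarrow> real" assume xy: "\<forall>e\<in>list_edges vs. x e = y e"
  then have "weight x (list_edges vs) = weight y (list_edges vs)"
    by (intro weight_cong) auto
  moreover have "segment_weight x vs a r = segment_weight y vs a r" if "a + r \<le> k" for a r
    unfolding segment_edges(3)[OF vs that] using segment_edges(1)[OF vs that] xy
    by (intro weight_cong) auto
  ultimately show "balanced k s c x vs = balanced k s c y vs"
    unfolding balanced_def by auto
qed

context exp_rate
begin

lemma weight_lower_tail:
  assumes "A \<subseteq> complete_edges n" "0 < c"
  shows "\<P>(x in edge_weights l n. weight x A \<le> s)
    \<le> exp (c * s) * (l / c) ^ card A"
proof -
  have "(\<Sum>e\<in>A. c * x e) \<le> c * s" if "weight x A \<le> s" for x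
    using that assms(2) by (simp add: weight_def flip: sum_distrib_left)
  from chernoff[OF finite_complete_edges assms(1) _ this] show ?thesis
    using assms(2) by simp
qed

text \<open>The sum of \<open>k\<close> exponentials is at most \<open>s\<close> exactly when a
  Poisson variable of mean \<open>l * s\<close> is at least \<open>k\<close>; the bound keeps only
  the probability of the value \<open>k\<close>.\<close>

lemma erlang_CDF_ge:
  assumes "1 \<le> k" "0 \<le> s"
  shows "exp (- (l * s)) * (l * s) ^ k / fact k \<le> erlang_CDF (k - 1) l s"
proof -
  let ?y = "l * s"
  have y: "0 \<le> ?y" using assms rate_pos by simp
  have "(\<Sum>n\<le>k. ?y ^ n / fact n) \<le> exp ?y"
  proof -
    have "(\<lambda>n. ?y ^ n /\<^sub>R fact n) sums exp ?y" by (rule exp_converges)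
    then have s: "(\<lambda>n. ?y ^ n / fact n) sums exp ?y" by (simp add: field_simps)
    then have "(\<Sum>n\<in>{..k}. ?y ^ n / fact n) \<le> (\<Sum>n. ?y ^ n / fact n)"
      using y by (intro sum_le_suminf) (auto simp: sums_iff)
    then show ?thesis using s by (simp add: sums_iff)
  qed
  moreover have "{..k} = insert k {..k - 1}" using assms by auto
  ultimately have "?y ^ k / fact k \<le> exp ?y - (\<Sum>n\<le>k - 1. ?y ^ n / fact n)"
    using assms by (simp add: not_le)
  then have "exp (- ?y) * (?y ^ k / fact k) \<le> exp (- ?y) * (exp ?y - (\<Sum>n\<le>k - 1. ?y ^ n / fact n))"
    by (intro mult_left_mono) auto
  also have "\<dots> = erlang_CDF (k - 1) l s"
    using assms by (simp add: erlang_CDF_def right_diff_distrib exp_minus sum_distrib_left field_simps)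
  finally show ?thesis by simp
qed

lemma prob_light_path:
  assumes "vs \<in> vertex_lists n k" "1 \<le> k" "0 \<le> s"
  shows "\<P>(x in edge_weights l n. weight x (list_edges vs) \<le> s) = erlang_CDF (k - 1) l s"
proof -
  note v = vertex_listsD[OF assms(1)]
  have "list_edges vs \<noteq> {}" using v(5) assms(2) by auto
  from prob_sum_le_erlang[OF finite_complete_edges v(4) this assms(3)] show ?thesis
    using v(5) by (simp add: weight_def)
qed

text \<open>The right-hand side is the Chernoff estimate of lightness times a correction. Failure
  means a total below \<open>s - c\<close> or one of at most \<open>Suc k ^ 2\<close> segments
  violating the barrier, and each costs \<open>exp (- (c / 2))\<close>. With \<open>c\<close> a
  multiple of log log n this beats the polynomial factors in \<open>k\<close>.\<close>

lemma prob_light_unbalanced: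
  fixes n k s c vs
  defines "W \<equiv> edge_weights l n"
  assumes vs: "vs \<in> vertex_lists n k" and c: "0 \<le> c"
  shows "\<P>(x in W. weight x (list_edges vs) \<le> s \<and> \<not> balanced k s c x vs)
    \<le> exp (alpha_star * s) * (l / alpha_star) ^ k * (2 * real (Suc k) ^ 2 * exp (- (c / 2)))"
proof -
  interpret W: prob_space W unfolding W_def by (rule prob_space_exp_product)
  note v = vertex_listsD[OF vs]
  let ?a = "alpha_star" and ?T = "\<lambda>x. weight x (list_edges vs)"
  let ?th = "ln alpha_star / alpha_star"
  define Q where "Q = exp (?a * s) * (l / ?a) ^ k"
  have Q: "0 \<le> Q" using rate_pos alpha_star(1) by (simp add: Q_def)
  define I where "I = {(a, r). a \<le> k \<and> 1 \<le> r \<and> a + r \<le> k}"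
  have I: "I \<subseteq> {..k} \<times> {..k}" by (auto simp: I_def)
  have finI: "finite I" by (rule finite_subset[OF I]) simp
  let ?A = "{x \<in> space W. ?T x \<le> s - c}"
  let ?B = "\<lambda>(a, r). {x \<in> space W. ?T x \<le> s \<and> real (k - r) * ?th + c \<le> ?T x - segment_weight x vs a r}"
  have mA: "?A \<in> sets W" unfolding W_def using measurable_weight_le[OF v(4)] by measurable
  have mB: "?B p \<in> sets W" if "p \<in> I" for p
  proof -
    obtain a r where p: "p = (a, r)" "a + r \<le> k" using \<open>p \<in> I\<close> by (auto simp: I_def)
    have [measurable]: "?T \<in> borel_measurable W" "(\<lambda>x. segment_weight x vs a r) \<in> borel_measurable W"
      unfolding W_def by (intro measurable_weight v measurable_segment_weight[OF vs p(2)])+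
    show ?thesis unfolding p by simp
  qed
  have A: "measure W ?A \<le> Q * exp (- (c / 2))"
  proof -
    have "measure W ?A \<le> exp (?a * (s - c)) * (l / ?a) ^ k"
      unfolding W_def using weight_lower_tail[OF v(4) alpha_star(1), of "s - c"] v(5) by simp
    also have "\<dots> = Q * exp (- (?a * c))"
      by (simp add: Q_def right_diff_distrib exp_diff exp_minus field_simps)
    also have "\<dots> \<le> Q * exp (- (c / 2))"
    proof -
      have "1 / 2 * c \<le> ?a * c" using alpha_star_bounds(1) c by (intro mult_right_mono) auto
      then show ?thesis using Q by (intro mult_left_mono) auto
    qed
    finally show ?thesis .
  qed
  have B: "measure W (?B p) \<le> Q * exp (- (c / 2))" if pI: "p \<in> I" for p
  proof -
    obtain a r where p: "p = (a, r)" "1 \<le> r" "a + r \<le> k" using pI by (auto simp: I_def)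
    define S where "S = (\<lambda>j. {vs ! j, vs ! Suc j}) ` {a..<a + r}"
    note S = segment_edges[OF vs p(3), folded S_def]
    \<comment> \<open>Tilting the edges outside the segment by \<open>\<alpha> - \<kappa>\<close> instead of \<open>\<alpha>\<close>; this choice of
      \<open>\<kappa>\<close> makes the cost of each outer edge \<open>exp (-1/\<alpha>) (1 + 1/\<alpha>) \<le> 1\<close>.\<close>
    define \<kappa> where "\<kappa> = ?a / (1 + ?a)"
    define c' where "c' e = (if e \<in> S then ?a else ?a - \<kappa>)" for e
    have al: "0 < ?a" "1 < ?a" using alpha_star_bounds by auto
    have \<kappa>: "1 / 2 \<le> \<kappa>" "?a - \<kappa> = ?a * (?a / (1 + ?a))" "0 < ?a - \<kappa>"
      using al by (auto simp: \<kappa>_def field_simps)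
    have sum_c: "(\<Sum>e\<in>list_edges vs. c' e * x e) = ?a * ?T x - \<kappa> * (?T x - segment_weight x vs a r)" for x
    proof -
      have "(\<Sum>e\<in>list_edges vs. c' e * x e) = (\<Sum>e\<in>list_edges vs - S. c' e * x e) + (\<Sum>e\<in>S. c' e * x e)"
        using S(1) by (intro sum.subset_diff) auto
      also have "\<dots> = (?a - \<kappa>) * weight x (list_edges vs - S) + ?a * weight x S"
        unfolding weight_def sum_distrib_left
        by (intro arg_cong2[where f = "(+)"] sum.cong) (auto simp: c'_def)
      also have "weight x (list_edges vs - S) = ?T x - weight x S"
        using S(1) by (simp add: weight_def sum_diff)
      finally show ?thesis unfolding S(3) by (simp add: algebra_simps)
    qed
    have "measure W (?B p) \<le> exp (?a * s - \<kappa> * (real (k - r) * ?th + c)) * (\<Prod>e\<in>list_edges vs. l / c' e)"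
      unfolding W_def p prod.case
    proof (rule chernoff[OF finite_complete_edges v(4)])
      show "0 < c' e" for e using al \<kappa> by (simp add: c'_def)
      fix x assume "?T x \<le> s \<and> real (k - r) * ?th + c \<le> ?T x - segment_weight x vs a r"
      then have "?a * ?T x \<le> ?a * s" "\<kappa> * (real (k - r) * ?th + c) \<le> \<kappa> * (?T x - segment_weight x vs a r)"
        using al \<kappa> by (auto intro!: mult_left_mono)
      then show "(\<Sum>e\<in>list_edges vs. c' e * x e) \<le> ?a * s - \<kappa> * (real (k - r) * ?th + c)"
        unfolding sum_c by linarith
    qed
    also have "(\<Prod>e\<in>list_edges vs. l / c' e) = (l / ?a) ^ k * (1 + 1 / ?a) ^ (k - r)"
    proof -
      have "(\<Prod>e\<in>list_edges vs. l / c' e) = (\<Prod>e\<in>list_edges vs - S. l / c' e) * (\<Prod>e\<in>S. l / c' e)"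
        using S(1) by (intro prod.subset_diff) auto
      also have "\<dots> = (l / (?a - \<kappa>)) ^ (k - r) * (l / ?a) ^ r"
      proof -
        have "(\<Prod>e\<in>list_edges vs - S. l / c' e) = (\<Prod>e\<in>list_edges vs - S. l / (?a - \<kappa>))"
          by (intro prod.cong) (auto simp: c'_def)
        moreover have "card (list_edges vs - S) = k - r"
          using S v(5) by (simp add: card_Diff_subset finite_subset[OF S(1)])
        ultimately show ?thesis using S by (simp add: c'_def)
      qed
      also have "l / (?a - \<kappa>) = l / ?a * (1 + 1 / ?a)"
        unfolding \<kappa>(2) using al by (simp add: field_simps)
      also have "(l / ?a * (1 + 1 / ?a)) ^ (k - r) * (l / ?a) ^ r = (l / ?a) ^ (k - r + r) * (1 + 1 / ?a) ^ (k - r)"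
        by (simp only: power_mult_distrib power_add mult_ac)
      also have "k - r + r = k" using p by simp
      finally show ?thesis .
    qed
    also have "exp (?a * s - \<kappa> * (real (k - r) * ?th + c)) * ((l / ?a) ^ k * (1 + 1 / ?a) ^ (k - r))
        = Q * exp (- (\<kappa> * c)) * (exp (- (\<kappa> * ?th)) * (1 + 1 / ?a)) ^ (k - r)"
    proof -
      have E: "exp (A - \<kappa> * (real m * th + c)) = exp A * exp (- (\<kappa> * c)) * exp (- (\<kappa> * th)) ^ m"
        for A th and m :: nat
        by (simp add: exp_of_nat_mult[symmetric] algebra_simps flip: exp_add)
      show ?thesis
        unfolding E Q_def power_mult_distrib by (simp only: mult_ac)
    qed
    \<comment> \<open>Here the defining equation of \<open>alpha_star\<close> enters, as
      \<open>1 + \<alpha> = \<alpha> ln \<alpha>\<close>.\<close>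
    also have "\<kappa> * ?th = 1 / ?a"
    proof -
      have "\<kappa> * ?th = ln ?a / (1 + ?a)" using al by (simp add: \<kappa>_def)
      also have "\<dots> = ln ?a / (?a * ln ?a)" using alpha_star(2) by simp
      also have "\<dots> = 1 / ?a" using al by simp
      finally show ?thesis .
    qed
    also have "Q * exp (- (\<kappa> * c)) * (exp (- (1 / ?a)) * (1 + 1 / ?a)) ^ (k - r) \<le> Q * exp (- (c / 2)) * 1"
    proof (intro mult_mono)
      have "1 / 2 * c \<le> \<kappa> * c" using \<kappa> c by (intro mult_right_mono) auto
      then show "exp (- (\<kappa> * c)) \<le> exp (- (c / 2))" by simp
      have "1 + 1 / ?a \<le> exp (1 / ?a)" by (rule exp_ge_add_one_self)
      then have "exp (- (1 / ?a)) * (1 + 1 / ?a) \<le> exp (- (1 / ?a)) * exp (1 / ?a)"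
        by (intro mult_left_mono) auto
      also have "\<dots> = 1" by (simp flip: exp_add)
      finally show "(exp (- (1 / ?a)) * (1 + 1 / ?a)) ^ (k - r) \<le> 1"
        using al by (intro power_le_one) auto
    qed (use Q al in auto)
    finally show ?thesis by simp
  qed
  have "{x \<in> space W. ?T x \<le> s \<and> \<not> balanced k s c x vs} \<subseteq> ?A \<union> (\<Union>p\<in>I. ?B p)"
  proof
    fix x assume "x \<in> {x \<in> space W. ?T x \<le> s \<and> \<not> balanced k s c x vs}"
    then have x: "x \<in> space W" "?T x \<le> s" "\<not> balanced k s c x vs" by auto
    show "x \<in> ?A \<union> (\<Union>p\<in>I. ?B p)"
    proof (cases "s - c \<le> ?T x")
      case True
      let ?P = "\<lambda>(a, r). a + r \<le> k \<longrightarrow> ?T x - segment_weight x vs a r \<le> real (k - r) * ?th + c"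
      have "\<not> (\<forall>p\<in>{..k} \<times> {1..k}. ?P p)"
        using x(2,3) True by (simp only: balanced_def simp_thms)
      then obtain p where p: "p \<in> {..k} \<times> {1..k}" "\<not> ?P p"
        by meson
      obtain a r where ar: "p = (a, r)" by (cases p)
      have "x \<in> ?B (a, r)" "(a, r) \<in> I"
        using x(1,2) p unfolding ar I_def by simp_all
      then show ?thesis by (intro UnI2 UN_I)
    qed (use x in simp)
  qed
  then have "\<P>(x in W. ?T x \<le> s \<and> \<not> balanced k s c x vs) \<le> measure W (?A \<union> (\<Union>p\<in>I. ?B p))"
    using mA mB finI by (intro W.finite_measure_mono) auto
  also have "\<dots> \<le> measure W ?A + measure W (\<Union>p\<in>I. ?B p)"
    using mA mB finI by (intro measure_Un_le) auto
  also have "\<dots> \<le> measure W ?A + (\<Sum>p\<in>I. measure W (?B p))"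
    using mB finI by (intro add_left_mono measure_UNION_le) auto
  also have "\<dots> \<le> Q * exp (- (c / 2)) + (\<Sum>p\<in>I. Q * exp (- (c / 2)))"
    using A B by (intro add_mono sum_mono) auto
  also have "\<dots> = Q * exp (- (c / 2)) * (1 + real (card I))"
    by (simp add: algebra_simps)
  also have "\<dots> \<le> Q * exp (- (c / 2)) * (2 * real (Suc k) ^ 2)"
  proof (intro mult_left_mono)
    have "card I \<le> card ({..k} \<times> {..k})" using I by (intro card_mono) auto
    also have "\<dots> = Suc k ^ 2" by (simp add: card_cartesian_product power2_eq_square)
    finally have "1 + card I \<le> 2 * Suc k ^ 2" by (simp add: power2_eq_square)
    then have "real (1 + card I) \<le> real (2 * Suc k ^ 2)" by (rule of_nat_mono)
    then show "1 + real (card I) \<le> 2 * real (Suc k) ^ 2" by simp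
  qed (use Q in auto)
  finally show ?thesis by (simp add: Q_def mult_ac)
qed

end

text \<open>Cauchy-Schwarz for the number of events that occur and the indicator of their union,
  proved through the nonnegative quadratic \<open>E (S - t U)^2\<close> in \<open>t\<close>.\<close>

lemma (in prob_space) second_moment_union:
  fixes A :: "'i \<Rightarrow> 'a set"
  assumes G: "finite G" and A: "\<And>i. i \<in> G \<Longrightarrow> A i \<in> events"
  shows "(\<Sum>i\<in>G. prob (A i))\<^sup>2 \<le> prob (\<Union>i\<in>G. A i) * (\<Sum>i\<in>G. \<Sum>j\<in>G. prob (A i \<inter> A j))"
proof -
  let ?U = "\<Union>i\<in>G. A i"
  have U: "?U \<in> events" using G A by auto
  define a b u where "a = (\<Sum>i\<in>G. prob (A i))" and "b = (\<Sum>i\<in>G. \<Sum>j\<in>G. prob (A i \<inter> A j))"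
    and "u = prob ?U"
  have AA: "A i \<inter> A j \<in> events" if "i \<in> G" "j \<in> G" for i j using A that by auto
  have int: "integrable M (indicat_real B)" if "B \<in> events" for B
    using that by (intro integrable_real_indicator) (auto simp: less_top[symmetric])
  have quad: "0 \<le> b - 2 * t * a + t\<^sup>2 * u" for t
  proof -
    have sq: "((\<Sum>i\<in>G. indicat_real (A i) x) - t * indicat_real ?U x)\<^sup>2
        = (\<Sum>i\<in>G. \<Sum>j\<in>G. indicat_real (A i \<inter> A j) x) - 2 * t * (\<Sum>i\<in>G. indicat_real (A i) x)
          + t\<^sup>2 * indicat_real ?U x" for x
    proof (cases "x \<in> ?U")
      case True
      then show ?thesis
        by (simp add: power2_diff indicator_inter_arith power2_eq_square sum_product algebra_simps)
    next
      case False
      then have "indicat_real (A i) x = 0" if "i \<in> G" for i using that by (auto simp: indicator_def)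
      then show ?thesis using False by (simp add: indicator_inter_arith)
    qed
    have "0 \<le> (\<integral>x. ((\<Sum>i\<in>G. indicat_real (A i) x) - t * indicat_real ?U x)\<^sup>2 \<partial>M)"
      by (intro integral_nonneg_AE) auto
    also have "\<dots> = b - 2 * t * a + t\<^sup>2 * u"
    proof -
      have i1: "integrable M (\<lambda>x. \<Sum>i\<in>G. indicat_real (A i) x)"
        by (intro Bochner_Integration.integrable_sum int A)
      have i2: "integrable M (\<lambda>x. \<Sum>i\<in>G. \<Sum>j\<in>G. indicat_real (A i \<inter> A j) x)"
        by (intro Bochner_Integration.integrable_sum int AA)
      have e1: "(\<integral>x. (\<Sum>i\<in>G. indicat_real (A i) x) \<partial>M) = a"
        unfolding a_def using int A sets.sets_into_space[OF A]
        by (subst Bochner_Integration.integral_sum) (auto simp: Int_absorb1 intro!: sum.cong)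
      have "(\<integral>x. (\<Sum>i\<in>G. \<Sum>j\<in>G. indicat_real (A i \<inter> A j) x) \<partial>M)
          = (\<Sum>i\<in>G. \<integral>x. (\<Sum>j\<in>G. indicat_real (A i \<inter> A j) x) \<partial>M)"
        by (intro Bochner_Integration.integral_sum Bochner_Integration.integrable_sum int AA)
      also have "\<dots> = (\<Sum>i\<in>G. \<Sum>j\<in>G. \<integral>x. indicat_real (A i \<inter> A j) x \<partial>M)"
        by (intro sum.cong refl Bochner_Integration.integral_sum int AA)
      also have "\<dots> = b"
        unfolding b_def
      proof (intro sum.cong refl)
        fix i j assume "i \<in> G" "j \<in> G"
        then have "A i \<inter> A j \<subseteq> space M" using sets.sets_into_space[OF AA] by blast
        then show "(\<integral>x. indicat_real (A i \<inter> A j) x \<partial>M) = prob (A i \<inter> A j)"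
          by (simp add: Int_absorb2)
      qed
      finally have e2: "(\<integral>x. (\<Sum>i\<in>G. \<Sum>j\<in>G. indicat_real (A i \<inter> A j) x) \<partial>M) = b" .
      have e3: "(\<integral>x. indicat_real ?U x \<partial>M) = u"
        unfolding u_def using sets.sets_into_space[OF U] by (simp add: Int_absorb2)
      have i3: "integrable M (indicat_real ?U)" by (rule int[OF U])
      have "(\<integral>x. ((\<Sum>i\<in>G. indicat_real (A i) x) - t * indicat_real ?U x)\<^sup>2 \<partial>M)
        = (\<integral>x. ((\<Sum>i\<in>G. \<Sum>j\<in>G. indicat_real (A i \<inter> A j) x) - 2 * t * (\<Sum>i\<in>G. indicat_real (A i) x))
            + t\<^sup>2 * indicat_real ?U x \<partial>M)"
        by (intro Bochner_Integration.integral_cong refl sq)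
      also have "\<dots> = (\<integral>x. (\<Sum>i\<in>G. \<Sum>j\<in>G. indicat_real (A i \<inter> A j) x) \<partial>M)
          - (\<integral>x. 2 * t * (\<Sum>i\<in>G. indicat_real (A i) x) \<partial>M) + (\<integral>x. t\<^sup>2 * indicat_real ?U x \<partial>M)"
        by (subst Bochner_Integration.integral_add Bochner_Integration.integral_diff,
          intro Bochner_Integration.integrable_diff integrable_mult_right i1 i2,
          intro integrable_mult_right i3,
          subst Bochner_Integration.integral_diff, rule i2, intro integrable_mult_right i1, rule refl)
      also have "\<dots> = b - 2 * t * a + t\<^sup>2 * u"
        unfolding integral_mult_right_zero e1 e2 e3 ..
      finally show ?thesis .
    qed
    finally show ?thesis .
  qed
  show ?thesis
  proof (cases "u = 0")
    case True
    have "prob (A i) = 0" if "i \<in> G" for i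
    proof -
      have "prob (A i) \<le> u" unfolding u_def using U that by (intro finite_measure_mono) auto
      then show ?thesis using True measure_nonneg[of M "A i"] by linarith
    qed
    then show ?thesis using True by (simp add: u_def)
  next
    case False
    then have u: "0 < u" by (simp add: u_def less_le)
    \<comment> \<open>\<open>t = a / u\<close> minimises the quadratic; the factor \<open>u\<close>
      clears the denominator.\<close>
    have "0 \<le> u * (b - 2 * (a / u) * a + (a / u)\<^sup>2 * u)"
      by (rule mult_nonneg_nonneg[OF less_imp_le[OF u] quad])
    also have "\<dots> = u * b - a\<^sup>2"
      using u by (simp add: field_simps power2_eq_square)
    finally show ?thesis by (simp add: a_def b_def u_def)
  qed
qed

section \<open>Light excursions from a balanced path\<close>

lemma finite_excursions [simp]: "finite (excursions n vs)"
proof (rule finite_subset)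
  show "excursions n vs \<subseteq> {us. set us \<subseteq> {1..n} \<and> length us \<le> n}"
  proof (clarsimp simp: excursions_def)
    fix us assume "distinct us" "set us \<subseteq> {Suc 0..n}"
    then have "card (set us) \<le> card {Suc 0..n}" by (intro card_mono) auto
    then show "length us \<le> n" using \<open>distinct us\<close> by (simp add: distinct_card)
  qed
qed (rule finite_lists_length_le, simp)

lemma excursion_length:
  assumes "us \<in> excursions n vs"
  shows "length us \<le> n" "2 \<le> length us" "distinct us" "set us \<subseteq> {1..n}" "list_edges us \<subseteq> complete_edges n"
    "list_edges us \<inter> list_edges vs = {}"
proof -
  show *: "2 \<le> length us" "distinct us" "set us \<subseteq> {1..n}" "list_edges us \<inter> list_edges vs = {}"
    using assms by (auto simp: excursions_def)
  then have "card (set us) \<le> card {1..n}" by (intro card_mono) auto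
  then show "length us \<le> n" using * by (simp add: distinct_card)
  show "list_edges us \<subseteq> complete_edges n" using * by (intro list_edges_subset)
qed

text \<open>Both ends lie on \<open>vs\<close> and only the \<open>m - 1\<close> interior vertices
  are free. This is one vertex fewer than edges, and that missing vertex is the source of the factor
  1/n in the excursion estimate.\<close>

lemma card_excursions_of_length:
  assumes "1 \<le> m"
  shows "card {us \<in> excursions n vs. length us = Suc m} \<le> length vs ^ 2 * n ^ (m - 1)"
proof -
  let ?L = "{ms. set ms \<subseteq> {1..n} \<and> length ms = m - 1}"
  let ?f = "\<lambda>((u, v), ms). u # ms @ [v]"
  have fin: "finite ?L" by (rule finite_lists_length_eq) simp
  have "{us \<in> excursions n vs. length us = Suc m} \<subseteq> ?f ` ((set vs \<times> set vs) \<times> ?L)"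
  proof
    fix us assume us: "us \<in> {us \<in> excursions n vs. length us = Suc m}"
    then obtain u us' where 1: "us = u # us'" by (cases us) auto
    then have "us' \<noteq> []" using us assms by auto
    then obtain ms v where 2: "us' = ms @ [v]" by (metis rev_exhaust)
    have "((u, v), ms) \<in> (set vs \<times> set vs) \<times> ?L"
      using us unfolding 1 2 by (auto simp: excursions_def)
    then show "us \<in> ?f ` ((set vs \<times> set vs) \<times> ?L)"
      unfolding 1 2 by (intro image_eqI[of _ _ "((u, v), ms)"]) auto
  qed
  then have "card {us \<in> excursions n vs. length us = Suc m} \<le> card (?f ` ((set vs \<times> set vs) \<times> ?L))"
    using fin by (intro card_mono) auto
  also have "\<dots> \<le> card ((set vs \<times> set vs) \<times> ?L)"
    using fin by (intro card_image_le) auto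
  also have "\<dots> = card (set vs) ^ 2 * n ^ (m - 1)"
    by (simp add: card_cartesian_product card_lists_length_eq power2_eq_square)
  also have "\<dots> \<le> length vs ^ 2 * n ^ (m - 1)"
    by (intro mult_right_mono power_mono card_length) auto
  finally show ?thesis .
qed

lemma sum_inverse_powers_le:
  fixes q :: real
  assumes "1 < q"
  shows "(\<Sum>m=1..N. (1 / q) ^ m) \<le> 1 / (q - 1)"
proof -
  have "(\<Sum>m=1..N. (1 / q) ^ m) = (1 - (1 / q) ^ N) / (q - 1)"
  proof (induction N)
    case (Suc N)
    have "(1 - R) / (q - 1) + R / q = (1 - R / q) / (q - 1)" for R
      using assms by (simp add: field_simps)
    then show ?case using Suc.IH by simp
  qed simp
  also have "\<dots> \<le> 1 / (q - 1)"
    using assms by (intro divide_right_mono) auto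
  finally show ?thesis .
qed

lemma measurable_excursions_heavy:
  "Measurable.pred (edge_weights l n) (\<lambda>x. excursions_heavy n x s vs)"
proof -
  have "Measurable.pred (edge_weights l n) (\<lambda>x. s < weight x (list_edges us))"
    if "us \<in> excursions n vs" for us
    unfolding pred_def
    by (intro borel_measurable_less measurable_weight excursion_length[OF that] borel_measurable_const)
  then show ?thesis
    unfolding excursions_heavy_def by (intro pred_intros_finite(3)) auto
qed

context exp_rate
begin

text \<open>Being balanced concerns only the edges of \<open>vs\<close>, and an excursion uses none
  of them, so the two events are independent. Excursions with \<open>m\<close> edges contribute at
  most \<open>Suc k ^ 2 * exp (q * s) / n\<close> times \<open>(1 / q) ^ m\<close>; a tilt
  \<open>q\<close> above 1 makes the sum over \<open>m\<close> converge.\<close>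

lemma prob_balanced_not_heavy:
  fixes n k s c vs q
  defines "W \<equiv> edge_weights l n"
  assumes l: "l = 1 / real n" and vs: "vs \<in> vertex_lists n k" and q: "1 < q"
  shows "\<P>(x in W. balanced k s c x vs \<and> \<not> excursions_heavy n x s vs)
    \<le> \<P>(x in W. balanced k s c x vs) * (real (Suc k) ^ 2 * exp (q * s) / (real n * (q - 1)))"
proof -
  interpret W: prob_space W unfolding W_def by (rule prob_space_exp_product)
  have n: "0 < real n" using l rate_pos by simp
  note v = vertex_listsD[OF vs]
  let ?b = "\<P>(x in W. balanced k s c x vs)"
  let ?E = "excursions n vs"
  let ?S = "\<lambda>us. {x \<in> space W. balanced k s c x vs \<and> weight x (list_edges us) \<le> s}"
  have mb: "Measurable.pred W (\<lambda>x. balanced k s c x vs)"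
    unfolding W_def by (rule measurable_balanced[OF vs])
  have mw: "Measurable.pred W (\<lambda>x. weight x (list_edges us) \<le> s)" if "us \<in> ?E" for us
    unfolding W_def by (rule measurable_weight_le[OF excursion_length(5)[OF that]])
  have mS: "?S us \<in> sets W" if "us \<in> ?E" for us
    using pred_intros_logic(3)[OF mb mw[OF that]] by (simp add: pred_def)
  have S: "measure W (?S us) \<le> ?b * (exp (q * s) * (l / q) ^ (length us - 1))" if us: "us \<in> ?E" for us
  proof -
    note e = excursion_length[OF us]
    have "measure W (?S us) = ?b * \<P>(x in W. weight x (list_edges us) \<le> s)"
      unfolding W_def
      using e v mb mw[OF us] by (intro exp_product_indep[where A = "list_edges vs" and B = "list_edges us"]
          depends_on_balanced[OF vs] depends_on_weight) (auto simp: W_def)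
    also have "\<dots> \<le> ?b * (exp (q * s) * (l / q) ^ (length us - 1))"
      using weight_lower_tail[OF e(5), of q s] q e by (intro mult_left_mono) (auto simp: W_def card_list_edges)
    finally show ?thesis .
  qed
  have "\<P>(x in W. balanced k s c x vs \<and> \<not> excursions_heavy n x s vs) \<le> measure W (\<Union>us\<in>?E. ?S us)"
    using mS by (intro W.finite_measure_mono) (auto simp: excursions_heavy_def not_less)
  also have "\<dots> \<le> (\<Sum>us\<in>?E. measure W (?S us))"
    using mS by (intro measure_UNION_le) auto
  also have "\<dots> \<le> (\<Sum>us\<in>?E. ?b * (exp (q * s) * (l / q) ^ (length us - 1)))"
    by (intro sum_mono S)
  also have "\<dots> = (\<Sum>m\<in>{1..n}. \<Sum>us\<in>{us \<in> ?E. length us - 1 = m}. ?b * (exp (q * s) * (l / q) ^ (length us - 1)))"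
  proof (rule sum.group[symmetric])
    show "(\<lambda>us. length us - 1) ` ?E \<subseteq> {1..n}"
      using excursion_length by fastforce
  qed auto
  also have "\<dots> \<le> (\<Sum>m\<in>{1..n}. ?b * (real (Suc k) ^ 2 * exp (q * s) / real n) * (1 / q) ^ m)"
  proof (rule sum_mono)
    fix m assume m: "m \<in> {1..n}"
    have "{us \<in> ?E. length us - 1 = m} = {us \<in> ?E. length us = Suc m}"
      using m by auto
    then have "(\<Sum>us\<in>{us \<in> ?E. length us - 1 = m}. ?b * (exp (q * s) * (l / q) ^ (length us - 1)))
        = real (card {us \<in> ?E. length us = Suc m}) * (?b * (exp (q * s) * (l / q) ^ m))"
      by simp
    also have "\<dots> \<le> real (length vs ^ 2 * n ^ (m - 1)) * (?b * (exp (q * s) * (l / q) ^ m))"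
    proof (rule mult_right_mono)
      show "real (card {us \<in> ?E. length us = Suc m}) \<le> real (length vs ^ 2 * n ^ (m - 1))"
        using card_excursions_of_length[of m n vs] m by (intro of_nat_mono) auto
    qed (use rate_pos q in auto)
    also have "\<dots> = ?b * (real (Suc k) ^ 2 * exp (q * s) / real n) * (1 / q) ^ m"
    proof -
      have "real n ^ m = real n * real n ^ (m - 1)" using m by (simp flip: power_Suc)
      then have E: "real n ^ (m - 1) * (l / q) ^ m = 1 / real n * (1 / q) ^ m"
        using n q by (simp add: l power_divide field_simps)
      have "real (length vs ^ 2 * n ^ (m - 1)) * (?b * (exp (q * s) * (l / q) ^ m))
          = real (Suc k) ^ 2 * ?b * exp (q * s) * (real n ^ (m - 1) * (l / q) ^ m)"
        by (simp only: v(3) of_nat_mult of_nat_power mult_ac)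
      then show ?thesis unfolding E by simp
    qed
    finally show "(\<Sum>us\<in>{us \<in> ?E. length us - 1 = m}. ?b * (exp (q * s) * (l / q) ^ (length us - 1)))
        \<le> ?b * (real (Suc k) ^ 2 * exp (q * s) / real n) * (1 / q) ^ m" .
  qed
  also have "\<dots> = ?b * (real (Suc k) ^ 2 * exp (q * s) / real n) * (\<Sum>m=1..n. (1 / q) ^ m)"
    by (simp add: sum_distrib_left)
  also have "\<dots> \<le> ?b * (real (Suc k) ^ 2 * exp (q * s) / real n) * (1 / (q - 1))"
    using sum_inverse_powers_le[OF q, of n] n by (intro mult_left_mono) auto
  finally show ?thesis by simp
qed

end

section \<open>Second moment of the number of robust paths\<close>

definition robust_path :: "nat \<Rightarrow> nat \<Rightarrow> real \<Rightarrow> real \<Rightarrow> (nat set \<Rightarrow> real) \<Rightarrow> nat list \<Rightarrow> bool" where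
  "robust_path n k s c x vs \<longleftrightarrow> balanced k s c x vs \<and> excursions_heavy n x s vs"

lemma measurable_robust_path:
  assumes "vs \<in> vertex_lists n k"
  shows "Measurable.pred (edge_weights l n) (\<lambda>x. robust_path n k s c x vs)"
  unfolding robust_path_def
  by (intro pred_intros_logic(3) measurable_balanced[OF assms] measurable_excursions_heavy)

context exp_rate
begin

text \<open>Balance bounds the common segment from below by \<open>s\<close> minus the barrier and
  \<open>2 * c\<close>, so a light \<open>us\<close> has new edges of weight at most
  \<open>(k - r) * ln \<alpha> / \<alpha> + 2 * c\<close>. The Chernoff bound with tilt \<alpha>
  then gives a factor \<alpha> per edge from the slope and \<open>l / \<alpha>\<close> from the edge
  itself. The slope is exactly the one for which these leave \<open>l\<close> per edge.\<close>

lemma prob_balanced_overlap: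
  fixes n k s c vs us
  defines "W \<equiv> edge_weights l n"
  assumes vs: "vs \<in> vertex_lists n k" and us: "us \<in> vertex_lists n k"
    and o: "us \<in> overlapping n vs k a b r d" "1 \<le> r" "a + r \<le> k"
  shows "\<P>(x in W. balanced k s c x vs \<and> weight x (list_edges us) \<le> s)
    \<le> \<P>(x in W. balanced k s c x vs) * (l ^ (k - r) * exp (2 * alpha_star * c))"
proof -
  interpret W: prob_space W unfolding W_def by (rule prob_space_exp_product)
  note v = vertex_listsD[OF vs] and u = vertex_listsD[OF us]
  let ?a = "alpha_star" and ?th = "ln alpha_star / alpha_star"
  define F where "F = list_edges us - list_edges vs"
  define t where "t = real (k - r) * ?th + 2 * c"
  note ow = overlapping_weight[OF v(1,3) o(3,1), folded F_def]
  have F: "F \<subseteq> complete_edges n" using u by (auto simp: F_def)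
  have mb: "Measurable.pred W (\<lambda>x. balanced k s c x vs)"
    unfolding W_def by (rule measurable_balanced[OF vs])
  have mF: "Measurable.pred W (\<lambda>x. weight x F \<le> t)"
    unfolding W_def by (rule measurable_weight_le[OF F])
  have "\<P>(x in W. balanced k s c x vs \<and> weight x (list_edges us) \<le> s)
      \<le> \<P>(x in W. balanced k s c x vs \<and> weight x F \<le> t)"
  proof (rule W.finite_measure_mono)
    show "{x \<in> space W. balanced k s c x vs \<and> weight x F \<le> t} \<in> sets W"
      using pred_intros_logic(3)[OF mb mF] by (simp add: pred_def)
    have "weight x F \<le> t" if b: "balanced k s c x vs" and w: "weight x (list_edges us) \<le> s" for x
    proof -
      have "(a, r) \<in> {..k} \<times> {1..k}" using o by auto
      then have "weight x (list_edges vs) - segment_weight x vs a r \<le> real (k - r) * ?th + c"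
        "s - c \<le> weight x (list_edges vs)"
        using b o(3) unfolding balanced_def by auto
      moreover have "weight x (list_edges us) = weight x F + segment_weight x vs a r"
        unfolding segment_weight_def by (rule ow(2))
      ultimately show ?thesis using w by (simp add: t_def)
    qed
    then show "{x \<in> space W. balanced k s c x vs \<and> weight x (list_edges us) \<le> s}
      \<subseteq> {x \<in> space W. balanced k s c x vs \<and> weight x F \<le> t}" by blast
  qed
  also have "\<dots> = \<P>(x in W. balanced k s c x vs) * \<P>(x in W. weight x F \<le> t)"
    unfolding W_def
    using F v mb mF by (intro exp_product_indep[where A = "list_edges vs" and B = F]
        depends_on_balanced[OF vs] depends_on_weight) (auto simp: W_def F_def)
  also have "\<P>(x in W. weight x F \<le> t) \<le> l ^ (k - r) * exp (2 * alpha_star * c)"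
  proof -
    have "\<P>(x in W. weight x F \<le> t) \<le> exp (?a * t) * (l / ?a) ^ (k - r)"
      using weight_lower_tail[OF F alpha_star(1), of t] ow(1) by (simp add: W_def)
    also have "exp (?a * t) = exp (?a * ?th) ^ (k - r) * exp (2 * ?a * c)"
    proof -
      have "exp (?a * (real m * th + 2 * c)) = exp (?a * th) ^ m * exp (2 * ?a * c)" for m :: nat and th
        by (simp add: exp_of_nat_mult[symmetric] algebra_simps flip: exp_add)
      then show ?thesis unfolding t_def .
    qed
    also have "exp (?a * ?th) ^ (k - r) * exp (2 * ?a * c) * (l / ?a) ^ (k - r) = l ^ (k - r) * exp (2 * ?a * c)"
      unfolding exp_ln_alpha_star using alpha_star(1) by (simp add: power_divide)
    finally show ?thesis .
  qed
  finally show ?thesis by (simp add: mult_left_mono)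
qed

text \<open>Edge-disjoint pairs are independent and give the main term. Any other robust pair almost
  surely overlaps in a single segment; a class of overlaps contributes about \<open>p\<close>, as
  its \<open>n ^ (k - r)\<close> members each cost \<open>l ^ (k - r)\<close>, and there are at most
  \<open>2 * Suc k ^ 3\<close> classes. The diagonal pair is included with
  \<open>r = k\<close>.\<close>

lemma sum_prob_robust_pairs:
  fixes n k s c vs
  defines "W \<equiv> edge_weights l n"
  defines "p \<equiv> erlang_CDF (k - 1) l s"
  assumes l: "l = 1 / real n" and vs: "vs \<in> vertex_lists n k" and k: "1 \<le> k" and s: "0 \<le> s"
  shows "(\<Sum>us\<in>vertex_lists n k.
      \<P>(x in W. robust_path n k s c x vs \<and> robust_path n k s c x us))
    \<le> real (card (vertex_lists n k)) * p ^ 2 + p * (2 * real (Suc k) ^ 3 * exp (2 * alpha_star * c))"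
proof -
  interpret W: prob_space W unfolding W_def by (rule prob_space_exp_product)
  have n: "0 < real n" using l rate_pos by simp
  note v = vertex_listsD[OF vs]
  let ?G = "vertex_lists n k"
  let ?f = "\<lambda>us. \<P>(x in W. robust_path n k s c x vs \<and> robust_path n k s c x us)"
  define I where "I = {((a, b), r, d) | a b r d. a \<le> k \<and> b \<le> k \<and> 1 \<le> r \<and> r \<le> k \<and> a + r \<le> k \<and> b + r \<le> k \<and> (d::bool) \<in> UNIV}"
  define Ov where "Ov = (\<lambda>((a, b), r, d). overlapping n vs k a b r d)"
  define g where "g = (\<lambda>((a::nat, b::nat), r, d::bool). p * (l ^ (k - r) * exp (2 * alpha_star * c)))"
  have p0: "0 \<le> p" unfolding p_def using rate_pos by (rule erlang_CDF_nonneg)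
  have IS: "I \<subseteq> ({..k} \<times> {..k}) \<times> {..k} \<times> UNIV" by (auto simp: I_def)
  have finI: "finite I" by (rule finite_subset[OF IS]) auto
  have g0: "0 \<le> g i" for i using p0 rate_pos by (auto simp: g_def split: prod.split)
  have mT: "Measurable.pred W (\<lambda>x. weight x (list_edges us) \<le> s)" if "us \<in> ?G" for us
    unfolding W_def by (rule measurable_weight_le[OF vertex_listsD(4)[OF that]])
  have mr: "Measurable.pred W (\<lambda>x. robust_path n k s c x us)" if "us \<in> ?G" for us
    unfolding W_def by (rule measurable_robust_path[OF that])
  have mb: "Measurable.pred W (\<lambda>x. balanced k s c x vs)"
    unfolding W_def by (rule measurable_balanced[OF vs])
  have light: "\<P>(x in W. weight x (list_edges us) \<le> s) = p" if "us \<in> ?G" for us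
    unfolding W_def p_def by (rule prob_light_path[OF that k s])
  have bal: "\<P>(x in W. balanced k s c x vs) \<le> p"
  proof -
    have "\<P>(x in W. balanced k s c x vs) \<le> \<P>(x in W. weight x (list_edges vs) \<le> s)"
      using mT[OF vs] by (intro W.finite_measure_mono) (auto simp: balanced_def pred_def)
    then show ?thesis using light[OF vs] by simp
  qed
  have disjoint: "?f us \<le> p ^ 2" if us: "us \<in> ?G" and disj: "list_edges vs \<inter> list_edges us = {}" for us
  proof -
    have "?f us \<le> \<P>(x in W. weight x (list_edges vs) \<le> s \<and> weight x (list_edges us) \<le> s)"
    proof (rule W.finite_measure_mono)
      show "{x \<in> space W. weight x (list_edges vs) \<le> s \<and> weight x (list_edges us) \<le> s} \<in> sets W"
        using pred_intros_logic(3)[OF mT[OF vs] mT[OF us]] by (simp add: pred_def)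
    qed (auto simp: robust_path_def balanced_def)
    also have "\<dots> = \<P>(x in W. weight x (list_edges vs) \<le> s) *
        \<P>(x in W. weight x (list_edges us) \<le> s)"
      using disj v(4) vertex_listsD(4)[OF us] mT[OF vs] mT[OF us] unfolding W_def
      by (intro exp_product_indep[where A = "list_edges vs" and B = "list_edges us"] depends_on_weight) auto
    also have "\<dots> = p * p" by (simp only: light[OF vs] light[OF us])
    finally show ?thesis by (simp add: power2_eq_square)
  qed
  \<comment> \<open>Summing over all overlap classes instead of selecting one for \<open>us\<close>
    permits exchanging the sums afterwards. If no class contains \<open>us\<close>, the pair is
    robust with probability zero.\<close>
  have overlap: "?f us \<le> (\<Sum>i\<in>I. if us \<in> Ov i then g i else 0)"
    if us: "us \<in> ?G" and disj: "list_edges vs \<inter> list_edges us \<noteq> {}" for us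
  proof (cases "\<exists>i\<in>I. us \<in> Ov i")
    case True
    then obtain i where i: "i \<in> I" "us \<in> Ov i" by blast
    then obtain a b r d where abrd: "i = ((a, b), r, d)" "1 \<le> r" "a + r \<le> k" "us \<in> overlapping n vs k a b r d"
      by (auto simp: I_def Ov_def)
    have m: "{x \<in> space W. balanced k s c x vs \<and> weight x (list_edges us) \<le> s} \<in> sets W"
      using pred_intros_logic(3)[OF mb mT[OF us]] by (simp add: pred_def)
    have "?f us \<le> \<P>(x in W. balanced k s c x vs \<and> weight x (list_edges us) \<le> s)"
      by (rule W.finite_measure_mono[OF _ m]) (auto simp: robust_path_def balanced_def)
    also have "\<dots> \<le> \<P>(x in W. balanced k s c x vs) * (l ^ (k - r) * exp (2 * alpha_star * c))"
      unfolding W_def by (rule prob_balanced_overlap[OF vs us abrd(4,2,3)])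
    also have "\<dots> \<le> g i"
      unfolding g_def abrd(1) prod.case using bal rate_pos by (intro mult_right_mono) auto
    also have "\<dots> = (if us \<in> Ov i then g i else 0)" using i by simp
    also have "\<dots> \<le> (\<Sum>i\<in>I. if us \<in> Ov i then g i else 0)"
      using i finI g0 by (intro member_le_sum) auto
    finally show ?thesis .
  next
    case False
    have nonneg: "AE x in W. \<forall>e\<in>complete_edges n. 0 \<le> x e"
      unfolding W_def by (rule AE_exp_product_nonneg) simp
    note u = vertex_listsD[OF us]
    obtain j where j: "j < k" "{us ! j, us ! Suc j} \<in> list_edges vs"
      using disj u(3) by (auto simp: list_edges_conv_image[of us])
    then have jv: "us ! j \<in> set vs" "us ! Suc j \<in> set vs"
      using list_edges_Union by blast+
    have "AE x in W. x \<notin> {x \<in> space W. robust_path n k s c x vs \<and> robust_path n k s c x us}"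
      using nonneg
    proof eventually_elim
      fix x :: "nat set \<Rightarrow> real" assume x: "\<forall>e\<in>complete_edges n. 0 \<le> x e"
      show "x \<notin> {x \<in> space W. robust_path n k s c x vs \<and> robust_path n k s c x us}"
      proof
        assume "x \<in> {x \<in> space W. robust_path n k s c x vs \<and> robust_path n k s c x us}"
        then have r: "excursions_heavy n x s vs" "weight x (list_edges us) \<le> s"
          by (auto simp: robust_path_def balanced_def)
        have "\<exists>a b r d. 1 \<le> r \<and> a + r < length vs \<and> b \<le> j \<and> Suc j \<le> b + r \<and> us \<in> overlapping n vs k a b r d"
          by (rule intersection_is_segment[OF v(1) u(1,2,3) _ r(2,1)]) (use x j jv in auto)
        then obtain a b r d where o: "1 \<le> r" "a + r < length vs" "us \<in> overlapping n vs k a b r d"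
          by blast
        then have "b + r \<le> k" by (auto simp: overlapping_def)
        then have "((a, b), r, d) \<in> I" using o v(3) by (auto simp: I_def)
        moreover have "us \<in> Ov ((a, b), r, d)" using o by (simp add: Ov_def)
        ultimately show False using False by blast
      qed
    qed
    then have "?f us = 0"
      by (intro W.prob_eq_0[THEN iffD2]) (use pred_intros_logic(3)[OF mr[OF vs] mr[OF us]] in \<open>auto simp: pred_def\<close>)
    then show ?thesis using g0 by (simp add: sum_nonneg)
  qed
  have "(\<Sum>us\<in>?G. ?f us) \<le> (\<Sum>us\<in>?G. p ^ 2 + (\<Sum>i\<in>I. if us \<in> Ov i then g i else 0))"
  proof (rule sum_mono)
    fix us assume us: "us \<in> ?G"
    have "0 \<le> (\<Sum>i\<in>I. if us \<in> Ov i then g i else 0)" using g0 by (simp add: sum_nonneg)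
    then show "?f us \<le> p ^ 2 + (\<Sum>i\<in>I. if us \<in> Ov i then g i else 0)"
      using disjoint[OF us] overlap[OF us] zero_le_power2[of p]
      by (cases "list_edges vs \<inter> list_edges us = {}") linarith+
  qed
  also have "\<dots> = real (card ?G) * p ^ 2 + (\<Sum>i\<in>I. \<Sum>us\<in>?G. if us \<in> Ov i then g i else 0)"
    by (simp only: sum.distrib sum_constant sum.swap[of _ I])
  also have "(\<Sum>i\<in>I. \<Sum>us\<in>?G. if us \<in> Ov i then g i else 0) \<le> (\<Sum>i\<in>I. p * exp (2 * alpha_star * c))"
  proof (rule sum_mono)
    fix i assume i: "i \<in> I"
    then obtain a b r d where abrd: "i = ((a, b), r, d)" "b + r \<le> k"
      by (auto simp: I_def)
    note co = card_overlapping[OF abrd(2), of n vs a d]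
    have "(\<Sum>us\<in>?G. if us \<in> Ov i then g i else 0) = real (card (?G \<inter> Ov i)) * g i"
      by (simp add: sum.If_cases Int_def)
    also have "\<dots> \<le> real (n ^ (k - r)) * g i"
    proof (rule mult_right_mono)
      have "card (?G \<inter> Ov i) \<le> card (Ov i)"
        using co by (intro card_mono) (auto simp: Ov_def abrd)
      also have "\<dots> \<le> n ^ (k - r)" using co by (simp add: Ov_def abrd)
      finally show "real (card (?G \<inter> Ov i)) \<le> real (n ^ (k - r))" by (rule of_nat_mono)
    qed (rule g0)
    also have "\<dots> = (real n * l) ^ (k - r) * (p * exp (2 * alpha_star * c))"
      by (simp add: g_def abrd power_mult_distrib)
    also have "real n * l = 1" using n by (simp add: l)
    finally show "(\<Sum>us\<in>?G. if us \<in> Ov i then g i else 0) \<le> p * exp (2 * alpha_star * c)" by simp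
  qed
  also have "\<dots> = real (card I) * (p * exp (2 * alpha_star * c))" by simp
  also have "\<dots> \<le> (2 * real (Suc k) ^ 3) * (p * exp (2 * alpha_star * c))"
  proof (rule mult_right_mono)
    have "card I \<le> card ((({..k} \<times> {..k}) \<times> {..k} \<times> UNIV) :: ((nat \<times> nat) \<times> nat \<times> bool) set)"
      by (rule card_mono[OF _ IS]) auto
    also have "\<dots> = 2 * Suc k ^ 3"
      by (simp add: card_cartesian_product power3_eq_cube)
    finally have "real (card I) \<le> real (2 * Suc k ^ 3)" by (rule of_nat_mono)
    then show "real (card I) \<le> 2 * real (Suc k) ^ 3" by simp
  qed (use p0 in auto)
  finally show ?thesis by (simp add: mult_ac)
qed

text \<open>\<open>N * p\<close> is the expected number of light paths. The relative losses \<delta>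
  and \<epsilon> account for unbalanced paths and for light excursions, and \<Lambda> bounds the
  overlapping partners of one path. The second moment method gives \<open>((1 - \<delta>) * (1 -
  \<epsilon>))^2 / (1 + \<Lambda> / (N * p))\<close>, which is linearised here.\<close>

lemma prob_max_path_length_ge:
  fixes n k s c q
  defines "W \<equiv> edge_weights l n"
  defines "p \<equiv> erlang_CDF (k - 1) l s" and "N \<equiv> real (card (vertex_lists n k))"
  defines "\<delta> \<equiv> exp (alpha_star * s) * (l / alpha_star) ^ k * (2 * real (Suc k) ^ 2 * exp (- (c / 2))) / p"
  defines "\<epsilon> \<equiv> real (Suc k) ^ 2 * exp (q * s) / (real n * (q - 1))"
  defines "\<Lambda> \<equiv> 2 * real (Suc k) ^ 3 * exp (2 * alpha_star * c)"
  assumes l: "l = 1 / real n" and k: "1 \<le> k" and s: "0 \<le> s" and c: "0 \<le> c" and q: "1 < q"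
    and p: "0 < p" and N: "0 < N" and le1: "\<delta> \<le> 1" "\<epsilon> \<le> 1"
  shows "1 - 2 * \<delta> - 2 * \<epsilon> - \<Lambda> / (N * p) \<le> \<P>(x in W. k \<le> max_path_length n x)"
proof -
  interpret W: prob_space W unfolding W_def by (rule prob_space_exp_product)
  have n: "0 < real n" using l rate_pos by simp
  let ?G = "vertex_lists n k"
  let ?A = "\<lambda>vs. {x \<in> space W. robust_path n k s c x vs}"
  have mA: "?A vs \<in> sets W" if "vs \<in> ?G" for vs
    unfolding W_def using measurable_robust_path[OF that] by (simp add: pred_def)
  have \<Lambda>0: "0 \<le> \<Lambda>" by (simp add: \<Lambda>_def)
  have \<delta>0: "0 \<le> \<delta>" using p rate_pos alpha_star(1) by (simp add: \<delta>_def)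
  have \<epsilon>0: "0 \<le> \<epsilon>" using q n by (simp add: \<epsilon>_def)
  have A: "p * (1 - \<delta>) * (1 - \<epsilon>) \<le> measure W (?A vs)" if vs: "vs \<in> ?G" for vs
  proof -
    let ?T = "{x \<in> space W. weight x (list_edges vs) \<le> s}"
    let ?B = "{x \<in> space W. balanced k s c x vs}"
    let ?B' = "{x \<in> space W. weight x (list_edges vs) \<le> s \<and> \<not> balanced k s c x vs}"
    let ?C = "{x \<in> space W. balanced k s c x vs \<and> \<not> excursions_heavy n x s vs}"
    have mT: "Measurable.pred W (\<lambda>x. weight x (list_edges vs) \<le> s)"
      unfolding W_def by (rule measurable_weight_le[OF vertex_listsD(4)[OF vs]])
    have mb: "Measurable.pred W (\<lambda>x. balanced k s c x vs)"
      unfolding W_def by (rule measurable_balanced[OF vs])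
    have mh: "Measurable.pred W (\<lambda>x. excursions_heavy n x s vs)"
      unfolding W_def by (rule measurable_excursions_heavy)
    have sets: "?T \<in> sets W" "?B \<in> sets W" "?B' \<in> sets W" "?C \<in> sets W"
      using mT mb pred_intros_logic(3)[OF mT pred_intros_logic(2)[OF mb]]
        pred_intros_logic(3)[OF mb pred_intros_logic(2)[OF mh]] by (auto simp: pred_def)
    have "p = measure W ?T"
      unfolding W_def p_def by (rule prob_light_path[OF vs k s, symmetric])
    also have "\<dots> \<le> measure W (?B \<union> ?B')"
      using sets by (intro W.finite_measure_mono) auto
    also have "\<dots> \<le> measure W ?B + measure W ?B'"
      using sets by (intro measure_Un_le) auto
    also have "measure W ?B' \<le> p * \<delta>"
      using prob_light_unbalanced[OF vs c, of s] p by (simp add: W_def \<delta>_def)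
    finally have B: "p * (1 - \<delta>) \<le> measure W ?B" by (simp add: algebra_simps)
    have "measure W ?B \<le> measure W (?A vs \<union> ?C)"
      using sets mA[OF vs] by (intro W.finite_measure_mono) (auto simp: robust_path_def)
    also have "\<dots> \<le> measure W (?A vs) + measure W ?C"
      using sets mA[OF vs] by (intro measure_Un_le) auto
    also have "measure W ?C \<le> measure W ?B * \<epsilon>"
      unfolding W_def \<epsilon>_def by (rule prob_balanced_not_heavy[OF l vs q])
    finally have "measure W ?B * (1 - \<epsilon>) \<le> measure W (?A vs)" by (simp add: algebra_simps)
    moreover have "p * (1 - \<delta>) * (1 - \<epsilon>) \<le> measure W ?B * (1 - \<epsilon>)"
      using B le1 by (intro mult_right_mono) auto
    ultimately show ?thesis by linarith
  qed
  define a b u where "a = (\<Sum>vs\<in>?G. measure W (?A vs))"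
    and "b = (\<Sum>vs\<in>?G. \<Sum>us\<in>?G. measure W (?A vs \<inter> ?A us))"
    and "u = measure W (\<Union>vs\<in>?G. ?A vs)"
  have "a\<^sup>2 \<le> u * b"
    unfolding a_def b_def u_def using mA by (intro W.second_moment_union) auto
  moreover have "N * p * ((1 - \<delta>) * (1 - \<epsilon>)) \<le> a"
  proof -
    have "(\<Sum>vs\<in>?G. p * (1 - \<delta>) * (1 - \<epsilon>)) \<le> a"
      unfolding a_def by (intro sum_mono A)
    then show ?thesis by (simp add: N_def mult_ac)
  qed
  then have "(N * p * ((1 - \<delta>) * (1 - \<epsilon>)))\<^sup>2 \<le> a\<^sup>2"
    using N p le1 by (intro power_mono mult_nonneg_nonneg) auto
  moreover have "b \<le> (N * p)\<^sup>2 * (1 + \<Lambda> / (N * p))"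
  proof -
    have "b \<le> (\<Sum>vs\<in>?G. N * p ^ 2 + p * \<Lambda>)"
      unfolding b_def
    proof (rule sum_mono)
      fix vs assume vs: "vs \<in> ?G"
      have "?A vs \<inter> ?A us = {x \<in> space W. robust_path n k s c x vs \<and> robust_path n k s c x us}" for us
        by auto
      then show "(\<Sum>us\<in>?G. measure W (?A vs \<inter> ?A us)) \<le> N * p ^ 2 + p * \<Lambda>"
        using sum_prob_robust_pairs[OF l vs k s, of c] by (simp add: W_def p_def N_def \<Lambda>_def)
    qed
    also have "\<dots> = (N * p)\<^sup>2 * (1 + \<Lambda> / (N * p))"
      using N p unfolding N_def[symmetric] by (simp add: N_def field_simps power2_eq_square)
    finally show ?thesis .
  qed
  then have "u * b \<le> u * ((N * p)\<^sup>2 * (1 + \<Lambda> / (N * p)))"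
    by (rule mult_left_mono) (simp only: u_def measure_nonneg)
  ultimately have "(N * p)\<^sup>2 * ((1 - \<delta>) * (1 - \<epsilon>))\<^sup>2 \<le> (N * p)\<^sup>2 * (u * (1 + \<Lambda> / (N * p)))"
    by (simp add: power_mult_distrib mult_ac)
  then have "((1 - \<delta>) * (1 - \<epsilon>))\<^sup>2 \<le> u * (1 + \<Lambda> / (N * p))"
    using N p by (simp add: mult_le_cancel_left_pos)
  also have "\<dots> \<le> u + \<Lambda> / (N * p)"
  proof -
    have "u * (\<Lambda> / (N * p)) \<le> 1 * (\<Lambda> / (N * p))"
      using N p \<Lambda>0 W.prob_le_1 by (intro mult_right_mono) (auto simp: u_def)
    then show ?thesis by (simp add: algebra_simps)
  qed
  finally have u: "((1 - \<delta>) * (1 - \<epsilon>))\<^sup>2 - \<Lambda> / (N * p) \<le> u" by simp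
  \<comment> \<open>Both factors are expanded with the tangent inequality
    \<open>1 - 2 * t \<le> (1 - t)^2\<close>, applied to the total loss.\<close>
  have "1 - 2 * \<delta> - 2 * \<epsilon> \<le> ((1 - \<delta>) * (1 - \<epsilon>))\<^sup>2"
  proof -
    have sq: "1 - 2 * t \<le> (1 - t)\<^sup>2" for t :: real by (simp add: power2_eq_square algebra_simps)
    have "1 - \<delta> - \<epsilon> \<le> (1 - \<delta>) * (1 - \<epsilon>)" using \<delta>0 \<epsilon>0 by (simp add: algebra_simps)
    then show ?thesis using sq[of "1 - (1 - \<delta>) * (1 - \<epsilon>)"] by simp
  qed
  moreover have "u \<le> \<P>(x in W. k \<le> max_path_length n x)"
    unfolding u_def
  proof (rule W.finite_measure_mono_AE)
    show "{x \<in> space W. k \<le> max_path_length n x} \<in> sets W"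
      unfolding W_def using measurable_max_path_length by measurable
    have "AE x in W. \<forall>e\<in>complete_edges n. 0 \<le> x e"
      unfolding W_def by (rule AE_exp_product_nonneg) simp
    then show "AE x in W. x \<in> (\<Union>vs\<in>?G. ?A vs) \<longrightarrow> x \<in> {x \<in> space W. k \<le> max_path_length n x}"
    proof eventually_elim
      fix x :: "nat set \<Rightarrow> real" assume x: "\<forall>e\<in>complete_edges n. 0 \<le> x e"
      show "x \<in> (\<Union>vs\<in>?G. ?A vs) \<longrightarrow> x \<in> {x \<in> space W. k \<le> max_path_length n x}"
      proof
        assume "x \<in> (\<Union>vs\<in>?G. ?A vs)"
        then obtain vs where vs: "vs \<in> ?G" "x \<in> space W" "robust_path n k s c x vs" by blast
        note v = vertex_listsD[OF vs(1)]
        have "k \<le> max_path_length n x"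
          using vs(3) x by (intro max_path_length_ge[OF v(1-3) k]) (auto simp: robust_path_def balanced_def)
        then show "x \<in> {x \<in> space W. k \<le> max_path_length n x}" using vs by simp
      qed
    qed
  qed
  ultimately show ?thesis using u by linarith
qed

end

section \<open>Tail bounds for the maximal path length\<close>

lemma ln_alpha_star: "1 \<le> ln alpha_star" "alpha_star powr alpha_star = exp (1 + alpha_star)"
proof -
  have "alpha_star * 1 \<le> alpha_star * ln alpha_star" using alpha_star by simp
  then show "1 \<le> ln alpha_star" using alpha_star(1) by simp
  show "alpha_star powr alpha_star = exp (1 + alpha_star)"
    using alpha_star by (simp add: powr_def)
qed

text \<open>By the defining equation, centring at \<open>\<alpha> ln n\<close> multiplies the moment
  by \<open>n\<close> to the power \<open>-(1 + \<alpha>)\<close>, which cancels the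
  \<open>n\<close> from the sources and the \<open>n\<close> to the power \<alpha> from the tree.
  The resulting bound is free of \<open>n\<close> and yields both the tail and the
  expectation.\<close>

lemma (in exp_rate) exponential_moment_max_path_length:
  fixes n
  defines "W \<equiv> edge_weights l n"
  defines "Y \<equiv> \<lambda>x. exp ((real (max_path_length n x) - alpha_star * ln (real n)) * ln alpha_star)"
  assumes n: "1 \<le> n"
  shows "integrable W Y" "(\<integral>x. Y x \<partial>W) \<le> exp alpha_star"
proof -
  interpret W: prob_space W unfolding W_def by (rule prob_space_exp_product)
  let ?a = "alpha_star"
  have mpl [measurable]: "max_path_length n \<in> W \<rightarrow>\<^sub>M count_space UNIV"
    unfolding W_def by (rule measurable_max_path_length)
  define K where "K = real n powr (- (1 + ?a))"
  have K: "0 \<le> K" by (simp add: K_def)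
  have Y: "Y x = K * ?a ^ max_path_length n x" for x
  proof -
    have "?a ^ max_path_length n x = exp (real (max_path_length n x) * ln ?a)"
      using alpha_star(1) by (simp add: exp_of_nat_mult)
    moreover have "K = exp (- (?a * ln ?a) * ln (real n))"
      using n alpha_star by (simp add: K_def powr_def)
    ultimately show ?thesis
      unfolding Y_def by (simp add: algebra_simps flip: exp_add)
  qed
  have "norm (?a ^ max_path_length n x) \<le> ?a ^ card (complete_edges n)" for x
    using max_path_length_le[OF n, of x] alpha_star_bounds by (auto intro!: power_increasing)
  moreover have "(\<lambda>x. ?a ^ max_path_length n x) \<in> borel_measurable W"
    using measurable_compose[OF mpl, of "\<lambda>k. ?a ^ k" borel] by simp
  ultimately have "integrable W (\<lambda>x. ?a ^ max_path_length n x)"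
    by (intro W.integrable_const_bound) auto
  then show "integrable W Y"
    unfolding Y[abs_def] by simp
  have "(\<integral>x. Y x \<partial>W) = K * (\<integral>x. ?a ^ max_path_length n x \<partial>W)"
    unfolding Y by simp
  also have "\<dots> \<le> K * (real n * (exp ?a * real n powr ?a))"
    using expectation_power_max_path_length[OF n, of ?a] K alpha_star(1)
    by (intro mult_left_mono) (auto simp: W_def)
  also have "\<dots> = exp ?a * (real n powr (- (1 + ?a)) * (real n powr 1 * real n powr ?a))"
    using n by (simp add: K_def)
  also have "\<dots> = exp ?a"
    using n by (simp only: flip: powr_add) simp
  finally show "(\<integral>x. Y x \<partial>W) \<le> exp ?a" .
qed

lemma (in exp_rate) max_path_length_upper_tail:
  fixes n t
  defines "W \<equiv> edge_weights l n"
  assumes n: "1 \<le> n"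
  shows "\<P>(x in W. alpha_star * ln (real n) + t < real (max_path_length n x))
    \<le> exp alpha_star * exp (- (t * ln alpha_star))"
proof -
  interpret W: prob_space W unfolding W_def by (rule prob_space_exp_product)
  let ?Y = "\<lambda>x. exp ((real (max_path_length n x) - alpha_star * ln (real n)) * ln alpha_star)"
  note Y = exponential_moment_max_path_length[OF n, folded W_def]
  have [measurable]: "max_path_length n \<in> W \<rightarrow>\<^sub>M count_space UNIV"
    unfolding W_def by (rule measurable_max_path_length)
  have "\<P>(x in W. alpha_star * ln (real n) + t < real (max_path_length n x))
      \<le> \<P>(x in W. exp (t * ln alpha_star) \<le> ?Y x)"
    using ln_alpha_star(1) by (intro W.finite_measure_mono) (auto intro!: mult_right_mono)
  also have "\<dots> \<le> (\<integral>x. ?Y x \<partial>W) / exp (t * ln alpha_star)"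
    by (rule integral_Markov_inequality_measure[OF Y(1), where A = "{}"]) auto
  also have "\<dots> \<le> exp alpha_star / exp (t * ln alpha_star)"
    using Y(2) by (intro divide_right_mono) auto
  finally show ?thesis by (simp add: exp_minus field_simps)
qed

lemma (in exp_rate) integrable_max_path_length:
  assumes "1 \<le> n"
  shows "integrable (edge_weights l n) (\<lambda>x. real (max_path_length n x))"
proof -
  let ?W = "edge_weights l n"
  interpret W: prob_space ?W by (rule prob_space_exp_product)
  have "(\<lambda>x. real (max_path_length n x)) \<in> borel_measurable ?W"
    using measurable_compose[OF measurable_max_path_length, of real borel] by simp
  then show ?thesis
    using max_path_length_le[OF assms]
    by (intro W.integrable_const_bound[of _ "real (card (complete_edges n))"]) auto
qed

lemma (in exp_rate) expectation_max_path_length_le: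
  fixes n
  assumes n: "1 \<le> n"
  shows "(\<integral>x. real (max_path_length n x) \<partial>edge_weights l n)
    \<le> alpha_star * ln (real n) + exp alpha_star"
proof -
  let ?W = "edge_weights l n"
  interpret W: prob_space ?W by (rule prob_space_exp_product)
  let ?Y = "\<lambda>x. exp ((real (max_path_length n x) - alpha_star * ln (real n)) * ln alpha_star)"
  note Y = exponential_moment_max_path_length[OF n]
  have "real (max_path_length n x) \<le> alpha_star * ln (real n) + ?Y x" for x
  proof -
    let ?d = "real (max_path_length n x) - alpha_star * ln (real n)"
    \<comment> \<open>Since \<open>ln \<alpha>\<close> is at least 1, the exponential dominates the
      linear excess, and a negative excess is trivially dominated.\<close>
    have "?d \<le> exp (?d * ln alpha_star)"
    proof (cases "0 \<le> ?d")
      case True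
      then have "?d * 1 \<le> ?d * ln alpha_star" using ln_alpha_star(1) by (intro mult_left_mono)
      also have "\<dots> \<le> exp (?d * ln alpha_star)"
        using exp_ge_add_one_self[of "?d * ln alpha_star"] by linarith
      finally show ?thesis by simp
    next
      case False
      then show ?thesis using exp_gt_zero[of "?d * ln alpha_star"] by linarith
    qed
    then show ?thesis by linarith
  qed
  then have "(\<integral>x. real (max_path_length n x) \<partial>?W) \<le> (\<integral>x. alpha_star * ln (real n) + ?Y x \<partial>?W)"
    using Y(1) integrable_max_path_length[OF n] by (intro integral_mono) auto
  also have "\<dots> = alpha_star * ln (real n) + (\<integral>x. ?Y x \<partial>?W)"
    using Y(1) by (simp add: W.prob_space)
  finally show ?thesis using Y(2) by simp
qed

section \<open>The lower tail at the scale of log n\<close>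

lemma fact_le_stirling:
  assumes "1 \<le> k"
  shows "fact k \<le> exp 1 * real k * (real k / exp 1) ^ k"
  using assms
proof (induction k rule: dec_induct)
  case base
  then show ?case by simp
next
  case (step k)
  let ?k = "real k"
  have k: "0 < ?k" using step by simp
  \<comment> \<open>The induction step needs that \<open>(1 + 1/k) ^ (k + 1)\<close> is at least
    e.\<close>
  have "1 / (?k + 1) \<le> ln (1 + 1 / ?k)"
    using ln_one_minus_pos_upper_bound[of "1 / (?k + 1)"] k
    by (simp add: ln_div field_simps)
  then have "1 \<le> (?k + 1) * ln (1 + 1 / ?k)"
    using k by (simp add: field_simps)
  then have "exp 1 \<le> exp (real (Suc k) * ln (1 + 1 / ?k))" by (simp add: add.commute)
  also have "\<dots> = (1 + 1 / ?k) ^ Suc k"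
    using k by (subst exp_of_nat_mult) (simp add: add_pos_pos)
  finally have e: "exp 1 * ?k ^ Suc k \<le> (1 + 1 / ?k) ^ Suc k * ?k ^ Suc k"
    by (intro mult_right_mono) auto
  also have "\<dots> = real (Suc k) ^ Suc k"
    using k by (simp add: field_simps flip: power_mult_distrib)
  finally have e: "exp 1 * ?k ^ Suc k \<le> real (Suc k) ^ Suc k" .
  have "fact (Suc k) = real (Suc k) * fact k" by simp
  also have "\<dots> \<le> real (Suc k) * (exp 1 * ?k * (?k / exp 1) ^ k)"
    using step by (intro mult_left_mono) auto
  also have "\<dots> = exp 1 * real (Suc k) * (exp 1 * ?k ^ Suc k) / exp 1 ^ Suc k"
    by (simp add: power_divide field_simps)
  also have "\<dots> \<le> exp 1 * real (Suc k) * real (Suc k) ^ Suc k / exp 1 ^ Suc k"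
    using e by (intro divide_right_mono mult_left_mono) auto
  finally show ?case by (simp add: power_divide)
qed

text \<open>When \<open>k\<close> is \<open>a * s\<close> rounded down, the Chernoff bound is sharp
  up to a factor linear in \<open>k\<close>. The three factors e come from
  \<open>exp (- (l * s))\<close>, from rounding, and from the factorial bound.\<close>

lemma (in exp_rate) erlang_CDF_ge_chernoff:
  assumes k: "1 \<le> k" "real k \<le> a * s" "a * s \<le> real k + 1" and a: "0 < a" and s: "0 < s" and ls: "l * s \<le> 1"
  shows "exp (a * s) * (l / a) ^ k / (exp 3 * real k) \<le> erlang_CDF (k - 1) l s"
proof -
  let ?k = "real k"
  have k0: "0 < ?k" using k by simp
  have "exp (a * s) * (l / a) ^ k / (exp 3 * ?k) = exp (- 1) * (l / a) ^ k * (exp (a * s - 2) / ?k)"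
    by (simp add: exp_diff exp_minus field_simps flip: exp_add)
  also have "\<dots> \<le> exp (- (l * s)) * (l * s / ?k) ^ k * (exp (?k - 1) / ?k)"
  proof (intro mult_mono divide_right_mono power_mono)
    have "?k * l \<le> a * s * l" using k rate_pos by (intro mult_right_mono) auto
    then show "l / a \<le> l * s / ?k" using a k0 by (simp add: field_simps)
  qed (use k a s rate_pos ls in auto)
  also have "\<dots> = exp (- (l * s)) * ((l * s) ^ k / (exp 1 * ?k * (?k / exp 1) ^ k))"
    by (simp add: power_divide exp_diff exp_of_nat_mult[symmetric] field_simps)
  also have "\<dots> \<le> exp (- (l * s)) * ((l * s) ^ k / fact k)"
    using fact_le_stirling[OF k(1)] rate_pos s k0
    by (intro mult_left_mono divide_left_mono mult_pos_pos) auto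
  also have "\<dots> \<le> erlang_CDF (k - 1) l s"
    using erlang_CDF_ge[OF k(1), of s] s by simp
  finally show ?thesis .
qed

text \<open>The falling factorial is at least \<open>(n - k) ^ Suc k\<close>, and Bernoulli's
  inequality shows that avoiding repetitions loses at most one half.\<close>

lemma card_vertex_lists_ge:
  assumes "2 * k * Suc k \<le> n" "1 \<le> n"
  shows "real n ^ Suc k / 2 \<le> real (card (vertex_lists n k))"
proof -
  let ?n = "real n" and ?k = "real k"
  have kn: "k < n" using assms by (cases k) auto
  have "vertex_lists n k = {xs. length xs = Suc k \<and> distinct xs \<and> set xs \<subseteq> {1..n}}"
    by (auto simp: vertex_lists_def)
  then have card: "card (vertex_lists n k) = \<Prod>{n - k..n}"
    using card_lists_distinct_length_eq[of "{1..n}" "Suc k"] kn by (simp add: Suc_diff_Suc)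
  have "real (2 * k * Suc k) \<le> ?n" using assms(1) by (rule of_nat_mono)
  then have "1 / 2 \<le> 1 + real (Suc k) * (- (?k / ?n))"
    using assms(2) by (simp add: field_simps)
  also have "\<dots> \<le> (1 + - (?k / ?n)) ^ Suc k"
    using kn by (intro Bernoulli_inequality) (simp add: field_simps)
  finally have "?n ^ Suc k * (1 / 2) \<le> ?n ^ Suc k * (1 + - (?k / ?n)) ^ Suc k"
    by (intro mult_left_mono) auto
  also have "\<dots> = (?n - ?k) ^ Suc k"
    using assms(2) by (simp add: field_simps flip: power_mult_distrib)
  also have "\<dots> = (\<Prod>i\<in>{n - k..n}. real (n - k))"
    using kn by simp
  also have "\<dots> \<le> (\<Prod>i\<in>{n - k..n}. real i)"
    by (intro prod_mono) auto
  finally show ?thesis by (simp add: card)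
qed


text \<open>The constant 90 has to outweigh every polylogarithmic loss, the largest being
  \<open>u ^ 80\<close> from the slack in \<open>balanced\<close>. The hypothesis
  \<open>40 * u^2 \<le> n\<close> comes from \<open>k \<le> 4 * u\<close> and
  \<open>Suc k \<le> 5 * u\<close> in \<open>2 * k * Suc k \<le> n\<close>. A failure probability of
  \<open>1 / u\<close> keeps the loss in expectation bounded, as the target length is at most
  \<open>4 * u\<close>.\<close>

lemma (in exp_rate) max_path_length_lower_tail:
  fixes n
  defines "W \<equiv> edge_weights l n" and "u \<equiv> ln (real n)"
  defines "s \<equiv> u - 90 * ln u"
  assumes l: "l = 1 / real n" and u: "70000 \<le> u" and s: "1 \<le> s" and un: "40 * u\<^sup>2 \<le> real n"
  shows "1 - 1 / u \<le> \<P>(x in W. alpha_star * s - 1 \<le> real (max_path_length n x))"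
proof -
  interpret W: prob_space W unfolding W_def by (rule prob_space_exp_product)
  let ?a = "alpha_star"
  have n: "0 < real n" using l rate_pos by simp
  have u0: "0 < u" using u by simp
  have exp_u: "exp u = real n" using n by (simp add: u_def)
  have lnu: "0 \<le> ln u" using u by simp
  have su: "s \<le> u" using lnu by (simp add: s_def)
  have exp_lnu: "exp (real m * ln u) = u ^ m" for m
    using u0 by (simp add: exp_of_nat_mult)
  define k where "k = nat \<lfloor>?a * s\<rfloor>"
  have as1: "1 \<le> ?a * s"
    using mult_mono[of 1 ?a 1 s] alpha_star_bounds s by simp
  have k: "real k \<le> ?a * s" "?a * s \<le> real k + 1" "1 \<le> k"
    using as1 by (auto simp: k_def le_nat_iff) (linarith+)?
  have "?a * s \<le> 4 * u"
    using alpha_star_bounds s su by (intro mult_mono) auto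
  then have k4: "real k \<le> 4 * u" using k by simp
  then have Sk: "real (Suc k) \<le> 5 * u" using u by simp
  \<comment> \<open>\<open>c\<close> makes \<open>exp (- (c / 2)) = u ^ (-5)\<close>, which beats
    the cubic factor in \<delta>, while \<alpha> at most 4 keeps
    \<open>exp (2 * \<alpha> * c)\<close> below \<open>u ^ 80\<close>. With
    \<open>q = 1 + 1 / u\<close> the tilt costs a factor of at most e in \<open>exp (q * s)\<close>,
    and the geometric series costs only \<open>u\<close>.\<close>
  define c q where "c = 10 * ln u" and "q = 1 + 1 / u"
  define p where "p = erlang_CDF (k - 1) l s"
  define Q where "Q = exp (?a * s) * (l / ?a) ^ k"
  have Q: "0 < Q" using rate_pos alpha_star(1) by (simp add: Q_def)
  have ls: "l * s \<le> 1"
  proof -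
    have "s \<le> exp u" using su exp_ge_add_one_self[of u] by linarith
    then show ?thesis using n by (simp add: l exp_u)
  qed
  have pQ: "Q / (exp 3 * real k) \<le> p"
    unfolding Q_def p_def using k s ls alpha_star(1) by (intro erlang_CDF_ge_chernoff) auto
  have k0: "0 < real k" using k by simp
  have p0: "0 < p"
    using pQ Q k0 by (intro less_le_trans[OF _ pQ]) auto
  define N where "N = real (card (vertex_lists n k))"
  have N: "real n ^ Suc k / 2 \<le> N"
  proof -
    have "real (2 * k * Suc k) \<le> 2 * (4 * u) * (5 * u)"
      unfolding of_nat_mult using k4 Sk u0 by (intro mult_mono) auto
    also have "\<dots> \<le> real n" using un by (simp add: power2_eq_square)
    finally have "2 * k * Suc k \<le> n" by (simp only: of_nat_le_iff)
    then show ?thesis unfolding N_def using n by (intro card_vertex_lists_ge) auto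
  qed
  have N0: "0 < N" using N n by (intro less_le_trans[OF _ N]) auto
  \<comment> \<open>By the defining equation \<open>\<alpha> ^ k\<close> is at most
    \<open>exp ((1 + \<alpha>) * s)\<close>, so the mean number of light paths is at least of order
    \<open>n * exp (- s) / k\<close>, and \<open>n * exp (- s) = u ^ 90\<close>.\<close>
  have Np: "u ^ 90 / (2 * exp 3 * real k) \<le> N * p"
  proof -
    have "?a ^ k = exp (real k * ln ?a)"
      using alpha_star(1) by (simp add: exp_of_nat_mult)
    also have "\<dots> \<le> exp (?a * s * ln ?a)"
      using k ln_alpha_star(1) by (auto intro!: mult_right_mono)
    also have "?a * s * ln ?a = (1 + ?a) * s"
      using alpha_star(2) by (metis mult.assoc mult.commute)
    finally have "exp (?a * s) / exp ((1 + ?a) * s) \<le> exp (?a * s) / ?a ^ k"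
      using alpha_star(1) by (intro divide_left_mono) auto
    then have "exp (- s) \<le> exp (?a * s) / ?a ^ k"
      by (simp add: algebra_simps flip: exp_diff)
    moreover have "u ^ 90 = real n * exp (- s)"
      using n exp_lnu[of 90] by (simp add: s_def exp_diff exp_u)
    ultimately have "u ^ 90 \<le> real n * (exp (?a * s) / ?a ^ k)"
      by (simp only: mult_left_mono of_nat_0_le_iff)
    also have "\<dots> = real n ^ Suc k * Q"
      using n by (simp add: Q_def l power_divide power_mult_distrib)
    finally have "u ^ 90 / (2 * exp 3 * real k) \<le> real n ^ Suc k * Q / (2 * exp 3 * real k)"
      using k0 by (intro divide_right_mono) auto
    also have "\<dots> = (real n ^ Suc k / 2) * (Q / (exp 3 * real k))" by simp
    also have "\<dots> \<le> N * p"
      using N pQ Q k0 N0 by (intro mult_mono) auto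
    finally show ?thesis .
  qed
  have e3: "exp 3 \<le> (27::real)"
  proof -
    have "exp 3 = exp (1::real) ^ 3" by (simp flip: exp_of_nat_mult)
    also have "\<dots> \<le> 3 ^ 3" using exp_le by (intro power_mono) auto
    finally show ?thesis by simp
  qed
  define \<delta> where "\<delta> = exp (alpha_star * s) * (l / alpha_star) ^ k * (2 * real (Suc k) ^ 2 * exp (- (c / 2))) / p"
  define \<epsilon> where "\<epsilon> = real (Suc k) ^ 2 * exp (q * s) / (real n * (q - 1))"
  define \<Lambda> where "\<Lambda> = 2 * real (Suc k) ^ 3 * exp (2 * alpha_star * c)"
  have \<delta>: "\<delta> \<le> 5400 / u\<^sup>2"
  proof -
    have "Q / p \<le> exp 3 * real k"
      using pQ p0 Q k0 by (simp add: field_simps)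
    have "\<delta> = (Q / p) * (2 * real (Suc k) ^ 2 * exp (- (c / 2)))"
      by (simp add: \<delta>_def Q_def)
    also have "exp (- (c / 2)) = 1 / u ^ 5"
      using exp_lnu[of 5] by (simp add: c_def exp_minus field_simps)
    also have "(Q / p) * (2 * real (Suc k) ^ 2 * (1 / u ^ 5)) \<le> (27 * (4 * u)) * (2 * (5 * u) ^ 2 * (1 / u ^ 5))"
    proof (rule mult_mono)
      show "Q / p \<le> 27 * (4 * u)"
        using \<open>Q / p \<le> exp 3 * real k\<close> mult_mono[OF e3 k4] k0 by simp
      show "2 * real (Suc k) ^ 2 * (1 / u ^ 5) \<le> 2 * (5 * u) ^ 2 * (1 / u ^ 5)"
        using Sk u0 by (intro mult_mono power_mono) auto
    qed (use u0 in auto)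
    also have "\<dots> = 5400 / u\<^sup>2"
      using u0 by (simp add: power_numeral_reduce field_simps)
    finally show ?thesis .
  qed
  have \<epsilon>: "\<epsilon> \<le> 75 / u\<^sup>2"
  proof -
    have "exp (q * s) = exp s * exp (s / u)"
      by (simp add: q_def algebra_simps flip: exp_add)
    also have "\<dots> \<le> exp s * 3"
    proof -
      have "exp (s / u) \<le> exp 1" using su u0 by simp
      then have "exp (s / u) \<le> 3" using exp_le by linarith
      then show ?thesis by (intro mult_left_mono) auto
    qed
    also have "exp s = real n / u ^ 90"
      using exp_lnu[of 90] by (simp add: s_def exp_diff exp_u)
    finally have eq: "exp (q * s) \<le> 3 * real n / u ^ 90" by (simp add: mult.commute)
    have "\<epsilon> = real (Suc k) ^ 2 * exp (q * s) * u / real n"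
      by (simp add: \<epsilon>_def q_def)
    also have "\<dots> \<le> (5 * u) ^ 2 * (3 * real n / u ^ 90) * u / real n"
      using Sk eq u0 n by (intro divide_right_mono mult_right_mono mult_mono power_mono) auto
    also have "\<dots> = 75 / u ^ 87"
      using u0 n by (simp add: power_numeral_reduce field_simps)
    also have "\<dots> \<le> 75 / u\<^sup>2"
      using u by (intro divide_left_mono power_increasing) auto
    finally show ?thesis .
  qed
  have \<Lambda>: "\<Lambda> / (N * p) \<le> 54000 / u\<^sup>2"
  proof -
    have "exp (2 * ?a * c) \<le> exp (real 80 * ln u)"
      using mult_right_mono[OF alpha_star_bounds(2), of "20 * ln u"] lnu by (simp add: c_def)
    then have "\<Lambda> \<le> 2 * (5 * u) ^ 3 * u ^ 80"
      unfolding \<Lambda>_def exp_lnu using Sk u0 by (intro mult_mono power_mono) auto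
    then have "\<Lambda> / (N * p) \<le> 2 * (5 * u) ^ 3 * u ^ 80 / (u ^ 90 / (2 * exp 3 * real k))"
      using Np u0 k0 N0 p0 by (intro frac_le) (auto simp: \<Lambda>_def)
    also have "\<dots> = 2 * (5 * u) ^ 3 * u ^ 80 * (2 * (exp 3 * real k)) / u ^ 90"
      by simp
    also have "\<dots> \<le> 2 * (5 * u) ^ 3 * u ^ 80 * (2 * (27 * (4 * u))) / u ^ 90"
      using mult_mono[OF e3 k4] k0 u0 by (intro divide_right_mono mult_left_mono) auto
    also have "\<dots> = 54000 * (u ^ 3 * u ^ 80 * u) / u ^ 90"
      by (simp add: power_mult_distrib)
    also have "u ^ 90 = u ^ 6 * (u ^ 3 * u ^ 80 * u)"
      by (simp flip: power_add power_Suc2)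
    also have "54000 * (u ^ 3 * u ^ 80 * u) / (u ^ 6 * (u ^ 3 * u ^ 80 * u)) = 54000 / u ^ 6"
      using u0 by (intro nonzero_mult_divide_mult_cancel_right) auto
    also have "\<dots> \<le> 54000 / u\<^sup>2"
      using u by (intro divide_left_mono power_increasing) auto
    finally show ?thesis .
  qed
  \<comment> \<open>The total error is at most
    \<open>(2 * 5400 + 2 * 75 + 54000) * w = 64950 * w\<close>, whence the threshold 70000 for
    \<open>u\<close>.\<close>
  define w where "w = 1 / u\<^sup>2"
  have bounds: "\<delta> \<le> 5400 * w" "\<epsilon> \<le> 75 * w" "\<Lambda> / (N * p) \<le> 54000 * w" "0 \<le> w"
    using \<delta> \<epsilon> \<Lambda> by (simp_all add: w_def)
  have w: "70000 * w \<le> 1 / u"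
    using u u0 by (simp add: w_def power2_eq_square field_simps)
  have "1 / u \<le> 1 / 70000" using u by (intro divide_left_mono) auto
  then have le1: "\<delta> \<le> 1" "\<epsilon> \<le> 1" using w bounds by linarith+
  have "1 - 2 * \<delta> - 2 * \<epsilon> - \<Lambda> / (N * p) \<le> \<P>(x in W. k \<le> max_path_length n x)"
    unfolding W_def \<delta>_def \<epsilon>_def \<Lambda>_def N_def p_def
  proof (rule prob_max_path_length_ge[OF l k(3)])
    show "0 < erlang_CDF (k - 1) l s" using p0 by (simp add: p_def)
    show "0 < real (card (vertex_lists n k))" using N0 by (simp add: N_def)
    show "exp (alpha_star * s) * (l / alpha_star) ^ k * (2 * real (Suc k) ^ 2 * exp (- (c / 2))) / erlang_CDF (k - 1) l s \<le> 1"
      using le1(1) unfolding \<delta>_def p_def .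
    show "real (Suc k) ^ 2 * exp (q * s) / (real n * (q - 1)) \<le> 1"
      using le1(2) unfolding \<epsilon>_def .
    show "0 \<le> s" using s by simp
    show "0 \<le> c" using lnu by (simp add: c_def)
    show "1 < q" using u0 by (simp add: q_def)
  qed
  then have "1 - 1 / u \<le> \<P>(x in W. k \<le> max_path_length n x)"
    using bounds w by linarith
  also have "\<dots> \<le> \<P>(x in W. ?a * s - 1 \<le> real (max_path_length n x))"
  proof (rule W.finite_measure_mono)
    have [measurable]: "max_path_length n \<in> W \<rightarrow>\<^sub>M count_space UNIV"
      unfolding W_def by (rule measurable_max_path_length)
    show "{x \<in> space W. ?a * s - 1 \<le> real (max_path_length n x)} \<in> sets W" by measurable
    show "{x \<in> space W. k \<le> max_path_length n x} \<subseteq> {x \<in> space W. ?a * s - 1 \<le> real (max_path_length n x)}"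
    proof -
      have "?a * s - 1 \<le> real m" if "k \<le> m" for m
        using k(2) of_nat_mono[OF that, where 'a = real] by linarith
      then show ?thesis by blast
    qed
  qed
  finally show ?thesis .
qed

text \<open>The estimates live on the product space and reach \<open>M\<close> and \<open>X\<close>
  only through the transfer lemma, so the thresholds for \<open>n\<close> are uniform in the
  probability space.\<close>

theorem theorem1:
  fixes \<omega> :: "nat \<Rightarrow> real"
  assumes "filterlim \<omega> at_top sequentially"
  shows "\<exists>L>0.
    (\<forall>\<delta>\<in>{0<..<1}. \<forall>\<^sub>F n in sequentially.
       \<forall>(M :: 'w measure) X. exponential_weights n M X \<longrightarrow>
         measure M {w \<in> space M.
           alpha_star * ln (real n) - L * ln (ln (real n))
             \<le> real (max_path_length n (\<lambda>e. X e w)) \<and>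
           real (max_path_length n (\<lambda>e. X e w))
             \<le> alpha_star * ln (real n) + \<omega> n} > 1 - \<delta>) \<and>
    (\<forall>\<^sub>F n in sequentially.
       \<forall>(M :: 'w measure) X. exponential_weights n M X \<longrightarrow>
         alpha_star * ln (real n) - L * ln (ln (real n))
           \<le> prob_space.expectation M (\<lambda>w. real (max_path_length n (\<lambda>e. X e w))) \<and>
         prob_space.expectation M (\<lambda>w. real (max_path_length n (\<lambda>e. X e w)))
           \<le> alpha_star * ln (real n) + L)"
proof -
  let ?a = alpha_star
  let ?W = "\<lambda>n. edge_weights (1 / real n) n"
  let ?m = max_path_length
  \<comment> \<open>With \<alpha> at most 4 the shift of 90 costs up to 360 times log log n; the
    remaining 40 absorb the additive constants. The same value dominates
    \<open>exp \<alpha>\<close>, which is at most 81.\<close>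
  define L where "L = (400::real)"
  have rate: "exp_rate (1 / real n)" if "2 \<le> n" for n
    using that by unfold_locales auto
  have large: "\<forall>\<^sub>F n in sequentially. 2 \<le> n \<and> 70000 \<le> ln (real n) \<and> 1 \<le> ln (ln (real n)) \<and>
      1 \<le> ln (real n) - 90 * ln (ln (real n)) \<and> 40 * (ln (real n))\<^sup>2 \<le> real n"
  proof (intro eventually_conj)
    show "\<forall>\<^sub>F n in sequentially. (2::nat) \<le> n" by (rule eventually_ge_at_top)
    show "\<forall>\<^sub>F n in sequentially. 70000 \<le> ln (real n)" by real_asymp
    show "\<forall>\<^sub>F n in sequentially. 1 \<le> ln (ln (real n))" by real_asymp
    show "\<forall>\<^sub>F n in sequentially. 1 \<le> ln (real n) - 90 * ln (ln (real n))" by real_asymp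
    show "\<forall>\<^sub>F n in sequentially. 40 * (ln (real n))\<^sup>2 \<le> real n" by real_asymp
  qed
  have a: "1 < ?a" "?a \<le> 4" "1 \<le> ln ?a"
    using alpha_star_bounds ln_alpha_star by auto
  have lower: "1 - 1 / ln (real n) \<le> \<P>(x in ?W n. ?a * (ln (real n) - 90 * ln (ln (real n))) - 1 \<le> real (?m n x))"
    if "2 \<le> n" "70000 \<le> ln (real n)" "1 \<le> ln (real n) - 90 * ln (ln (real n))"
      "40 * (ln (real n))\<^sup>2 \<le> real n" for n
    using exp_rate.max_path_length_lower_tail[OF rate] that by blast
  \<comment> \<open>The spare 6 covers the additive loss of 5 incurred in the expectation.\<close>
  have L_ge: "?a * ln (real n) - L * ln (ln (real n)) + 6 \<le> ?a * (ln (real n) - 90 * ln (ln (real n))) - 1"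
    if "1 \<le> ln (ln (real n))" for n
  proof -
    have "?a * (90 * ln (ln (real n))) \<le> 4 * (90 * ln (ln (real n)))"
      using a that by (intro mult_right_mono) auto
    then show ?thesis using that unfolding L_def right_diff_distrib by linarith
  qed
  have meas: "{x \<in> space (?W n). P (?m n x)} \<in> sets (?W n)" for n P
  proof -
    note [measurable] = measurable_max_path_length
    show ?thesis by measurable
  qed
  have prob: "\<forall>\<^sub>F n in sequentially. \<forall>(M :: 'w measure) X. exponential_weights n M X \<longrightarrow>
      measure M {w \<in> space M. ?a * ln (real n) - L * ln (ln (real n)) \<le> real (?m n (\<lambda>e. X e w)) \<and>
        real (?m n (\<lambda>e. X e w)) \<le> ?a * ln (real n) + \<omega> n} > 1 - \<delta>"
    if \<delta>: "\<delta> \<in> {0<..<1}" for \<delta>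
  proof -
    have "((\<lambda>t::real. exp ?a * exp (- (t * ln ?a))) \<longlongrightarrow> 0) at_top"
      using a by real_asymp
    then have "((\<lambda>n. exp ?a * exp (- (\<omega> n * ln ?a))) \<longlongrightarrow> 0) sequentially"
      using assms by (rule filterlim_compose)
    then have up: "\<forall>\<^sub>F n in sequentially. exp ?a * exp (- (\<omega> n * ln ?a)) < \<delta> / 2"
      by (rule order_tendstoD(2)) (use \<delta> in simp)
    have "(\<lambda>n. 1 / ln (real n)) \<longlonglongrightarrow> 0" by real_asymp
    then have lo: "\<forall>\<^sub>F n in sequentially. 1 / ln (real n) < \<delta> / 2"
      by (rule order_tendstoD(2)) (use \<delta> in simp)
    show ?thesis
      using large up lo
    proof eventually_elim
      fix n
      assume n: "2 \<le> n \<and> 70000 \<le> ln (real n) \<and> 1 \<le> ln (ln (real n)) \<and>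
          1 \<le> ln (real n) - 90 * ln (ln (real n)) \<and> 40 * (ln (real n))\<^sup>2 \<le> real n"
        and up: "exp ?a * exp (- (\<omega> n * ln ?a)) < \<delta> / 2" and lo: "1 / ln (real n) < \<delta> / 2"
      interpret exp_rate "1 / real n" using n by (intro rate) auto
      interpret W: prob_space "?W n" by (rule prob_space_exp_product)
      let ?P = "\<lambda>m. ?a * ln (real n) - L * ln (ln (real n)) \<le> real m \<and> real m \<le> ?a * ln (real n) + \<omega> n"
      let ?lo = "{x \<in> space (?W n). ?a * (ln (real n) - 90 * ln (ln (real n))) - 1 \<le> real (?m n x)}"
      let ?up = "{x \<in> space (?W n). ?a * ln (real n) + \<omega> n < real (?m n x)}"
      have "1 - 1 / ln (real n) \<le> measure (?W n) ?lo"
        using n by (intro lower) auto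
      also have "\<dots> \<le> measure (?W n) ({x \<in> space (?W n). ?P (?m n x)} \<union> ?up)"
        using L_ge[of n] n by (intro W.finite_measure_mono sets.Un meas) force
      also have "\<dots> \<le> \<P>(x in ?W n. ?P (?m n x)) + measure (?W n) ?up"
        by (intro measure_Un_le meas)
      also have "measure (?W n) ?up \<le> exp ?a * exp (- (\<omega> n * ln ?a))"
        using n by (intro max_path_length_upper_tail) auto
      finally have "1 - \<delta> < \<P>(x in ?W n. ?P (?m n x))"
        using up lo by linarith
      then have "1 - \<delta> < measure M {w \<in> space M. ?P (?m n (\<lambda>e. X e w))}"
        if "exponential_weights n M X" for M :: "'w measure" and X
        using exponential_weights_transfer(1)[OF that, of ?P] n by simp
      then show "\<forall>(M :: 'w measure) X. exponential_weights n M X \<longrightarrow>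
        measure M {w \<in> space M. ?P (?m n (\<lambda>e. X e w))} > 1 - \<delta>"
        by blast
    qed
  qed
  have expect: "\<forall>\<^sub>F n in sequentially. \<forall>(M :: 'w measure) X. exponential_weights n M X \<longrightarrow>
      ?a * ln (real n) - L * ln (ln (real n)) \<le> (\<integral>w. real (?m n (\<lambda>e. X e w)) \<partial>M) \<and>
      (\<integral>w. real (?m n (\<lambda>e. X e w)) \<partial>M) \<le> ?a * ln (real n) + L"
    using large
  proof eventually_elim
    fix n
    assume n: "2 \<le> n \<and> 70000 \<le> ln (real n) \<and> 1 \<le> ln (ln (real n)) \<and>
        1 \<le> ln (real n) - 90 * ln (ln (real n)) \<and> 40 * (ln (real n))\<^sup>2 \<le> real n"
    interpret exp_rate "1 / real n" using n by (intro rate) auto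
    interpret W: prob_space "?W n" by (rule prob_space_exp_product)
    define u where "u = ln (real n)"
    define b where "b = ?a * (u - 90 * ln u) - 1"
    have u: "0 < u" "70000 \<le> u" "1 \<le> ln u" "1 \<le> u - 90 * ln u" using n by (auto simp: u_def)
    have int: "integrable (?W n) (\<lambda>x. real (?m n x))"
      using n by (intro integrable_max_path_length) auto
    have b0: "0 \<le> b"
      using mult_mono[of 1 ?a 1 "u - 90 * ln u"] a u by (simp add: b_def)
    \<comment> \<open>The target \<open>b\<close> is at most \<open>4 * u\<close>, so an exceptional
      event of probability \<open>1 / u\<close> costs at most 4.\<close>
    have "b - 5 \<le> b * (1 - 1 / u)"
    proof -
      have "?a * (u - 90 * ln u) \<le> 4 * u" using a u by (intro mult_mono) auto
      then have "b / u \<le> 4" using u by (simp add: b_def field_simps)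
      then show ?thesis by (simp add: right_diff_distrib)
    qed
    also have "\<dots> \<le> b * \<P>(x in ?W n. b \<le> real (?m n x))"
      unfolding b_def u_def using n b0 by (intro mult_left_mono lower) (auto simp: b_def u_def)
    also have "\<dots> \<le> (\<integral>x. real (?m n x) \<partial>?W n)"
    proof -
      let ?S = "{x \<in> space (?W n). b \<le> real (?m n x)}"
      have S: "?S \<in> sets (?W n)" by (rule meas)
      have "b * measure (?W n) ?S = (\<integral>x. b * indicator ?S x \<partial>?W n)"
        using S sets.sets_into_space[OF S] by (simp add: Int_absorb2)
      also have "\<dots> \<le> (\<integral>x. real (?m n x) \<partial>?W n)"
        using int S b0 by (intro integral_mono integrable_mult_right integrable_real_indicator)
          (auto simp: indicator_def less_top[symmetric])
      finally show ?thesis .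
    qed
    finally have lo: "?a * ln (real n) - L * ln (ln (real n)) \<le> (\<integral>x. real (?m n x) \<partial>?W n)"
      using L_ge[of n] u unfolding b_def u_def by linarith
    have "exp ?a \<le> L"
    proof -
      have "exp ?a \<le> exp (real 4 * 1)" using a by simp
      also have "\<dots> = exp (1::real) ^ 4" by (rule exp_of_nat_mult)
      also have "\<dots> \<le> 3 ^ 4" using exp_le by (intro power_mono) auto
      finally show ?thesis by (simp add: L_def)
    qed
    then have up: "(\<integral>x. real (?m n x) \<partial>?W n) \<le> ?a * ln (real n) + L"
      using expectation_max_path_length_le[of n] n by simp
    have "(\<integral>w. real (?m n (\<lambda>e. X e w)) \<partial>M) = (\<integral>x. real (?m n x) \<partial>?W n)"
      if "exponential_weights n M X" for M :: "'w measure" and X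
      using exponential_weights_transfer(2)[OF that, of real] n by simp
    then show "\<forall>(M :: 'w measure) X. exponential_weights n M X \<longrightarrow>
      ?a * ln (real n) - L * ln (ln (real n)) \<le> (\<integral>w. real (?m n (\<lambda>e. X e w)) \<partial>M) \<and>
      (\<integral>w. real (?m n (\<lambda>e. X e w)) \<partial>M) \<le> ?a * ln (real n) + L"
      using lo up by simp
  qed
  show ?thesis
    using prob expect by (intro exI[of _ L]) (auto simp: L_def)
qed

end
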